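(* The unit sub-Lorentzian sphere $S=\{q\in M: d(q)=1\}$ of the problem described in the context is a real-analytic manifold diffeomorphic to $\mathbb R^2$, parametrized as follows: $S=\{\operatorname{Exp}(\lambda,1) : \lambda\in C,\ \mathbf t(\lambda)>1\}$.
   Context: Let $M=\mathbb R^3$ with coordinates $(x,y,z)$, $X_1=\frac{\partial}{\partial x}$, $X_2=\frac{\partial}{\partial y}+\frac{x^2}{2}\frac{\partial}{\partial z}$, $U_2=\{(u_1,u_2)\in\mathbb R^2: u_1\ge|u_2|\}$, $q_0=(0,0,0)$. An admissible trajectory is a Lipschitz curve $q:[0,t_1]\to M$ ($t_1\ge0$ free) with $\dot q=u_1X_1(q)+u_2X_2(q)$ a.e. for some bounded measurable control $u:[0,t_1]\to U_2$; its length is $l=\int_0^{t_1}\sqrt{u_1^2-u_2^2}\,dt$. The distance $d(q)$ is the supremum of lengths of admissible trajectories from $q_0$ to $q$, and $d(q)=0$ if there are none. Exponential mapping. For $\lambda=(\psi_0,c)\in C:=\mathbb R^2$ let $(\psi,x,y,z)(t)$ be the solution of $\dot\psi=cx$, $\dot x=\cosh\psi$, $\dot y=\sinh\psi$, $\dot z=\frac{x^2}{2}\sinh\psi$ ($c$ constant) with $\psi(0)=\psi_0$, $x(0)=y(0)=z(0)=0$; set $\operatorname{Exp}(\lambda,t)=(x(t),y(t),z(t))$ for $0<t<\mathbf t(\lambda)$, where $\mathbf t(\lambda)$ is the forward lifetime of this solution: $\mathbf t(\lambda)=+\infty$ if $c=0$, and if $c\ne0$, $\mathbf t(\lambda)=\frac{K(k)}{\text{\ae}\sqrt{|c|}}$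 with $E=-\sinh\psi_0$, $\text{\ae}=\sqrt{\sqrt{1+E^2}/2}$, $k=\sqrt{\frac12\big(1+\operatorname{sgn}(c)\frac{E}{\sqrt{1+E^2}}\big)}$, $K(k)=\int_0^{\pi/2}\frac{d\theta}{\sqrt{1-k^2\sin^2\theta}}$. *)

theory Defs
  imports "HOL-Analysis.Analysis"
begin

section \<open>Real-analytic maps, submanifolds and diffeomorphisms\<close>

text \<open>
  The exponents m range over the multi-indices, one natural number per coordinate. In a
  Euclidean space, \<open>has_sum\<close> is absolute convergence of the power series.
\<close>

definition real_analytic_at ::
    "('a::euclidean_space \<Rightarrow> 'b::euclidean_space) \<Rightarrow> 'a \<Rightarrow> bool" where
  "real_analytic_at f a \<longleftrightarrow>
     (\<exists>r>0. \<exists>c :: ('a \<Rightarrow> nat) \<Rightarrow> 'b. \<forall>x\<in>ball a r.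
        ((\<lambda>m. (\<Prod>i\<in>Basis. ((x - a) \<bullet> i) ^ m i) *\<^sub>R c m) has_sum f x)
          (Basis \<rightarrow>\<^sub>E (UNIV :: nat set)))"

text \<open>
  On a set that need not be open, a map is real-analytic if near each point of the set it is
  the restriction of a map that is real-analytic in the ambient space. On open sets this is
  analyticity at every point, on embedded submanifolds it is analyticity in charts.
\<close>

definition real_analytic_on ::
    "('a::euclidean_space \<Rightarrow> 'b::euclidean_space) \<Rightarrow> 'a set \<Rightarrow> bool" where
  "real_analytic_on f A \<longleftrightarrow>
     (\<forall>a\<in>A. \<exists>U g. open U \<and> a \<in> U \<and> real_analytic_at g a \<and> (\<forall>x\<in>A \<inter> U. f x = g x))"

definition real_analytic_diffeo ::
    "('a::euclidean_space \<Rightarrow> 'b::euclidean_space) \<Rightarrow> 'a set \<Rightarrow> 'b set \<Rightarrow> bool" where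
  "real_analytic_diffeo f A B \<longleftrightarrow>
     bij_betw f A B \<and> real_analytic_on f A \<and> real_analytic_on (inv_into A f) B"

definition real_analytic_diffeomorphic ::
    "'a::euclidean_space set \<Rightarrow> 'b::euclidean_space set \<Rightarrow> bool" where
  "real_analytic_diffeomorphic A B \<longleftrightarrow> (\<exists>f. real_analytic_diffeo f A B)"

text \<open>Embedded submanifolds of dimension n, by charts of the ambient space that flatten the set.\<close>

definition real_analytic_submanifold :: "nat \<Rightarrow> 'a::euclidean_space set \<Rightarrow> bool" where
  "real_analytic_submanifold n S \<longleftrightarrow>
     (\<forall>p\<in>S. \<exists>U V L (f :: 'a \<Rightarrow> 'a).
        open U \<and> p \<in> U \<and> open V \<and> subspace L \<and> dim L = n \<and>
        real_analytic_diffeo f U V \<and> f ` (S \<inter> U) = V \<inter> L)"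

section \<open>The sub-Lorentzian problem on the Martinet distribution\<close>

type_synonym point = "real \<times> real \<times> real"

definition X1 :: "point \<Rightarrow> point" where
  "X1 = (\<lambda>(x, y, z). (1, 0, 0))"

definition X2 :: "point \<Rightarrow> point" where
  "X2 = (\<lambda>(x, y, z). (0, 1, x\<^sup>2 / 2))"

definition U2 :: "(real \<times> real) set" where
  "U2 = {(u1, u2). u1 \<ge> \<bar>u2\<bar>}"

definition q0 :: point where
  "q0 = (0, 0, 0)"

definition admissible :: "real \<Rightarrow> (real \<Rightarrow> point) \<Rightarrow> (real \<Rightarrow> real \<times> real) \<Rightarrow> bool" where
  "admissible t1 q u \<longleftrightarrow>
     0 \<le> t1 \<and>
     (\<exists>L. L-lipschitz_on {0..t1} q) \<and>
     u \<in> borel_measurable (lebesgue_on {0..t1}) \<and>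
     bounded (u ` {0..t1}) \<and>
     u ` {0..t1} \<subseteq> U2 \<and>
     (AE t in lebesgue_on {0..t1}.
        (q has_vector_derivative fst (u t) *\<^sub>R X1 (q t) + snd (u t) *\<^sub>R X2 (q t))
          (at t within {0..t1}))"

definition len :: "real \<Rightarrow> (real \<Rightarrow> real \<times> real) \<Rightarrow> real" where
  "len t1 u = (LINT t|lebesgue_on {0..t1}. sqrt ((fst (u t))\<^sup>2 - (snd (u t))\<^sup>2))"

definition lengths_to :: "point \<Rightarrow> real set" where
  "lengths_to q1 = {len t1 u | t1 q u. admissible t1 q u \<and> q 0 = q0 \<and> q t1 = q1}"

text \<open>
  The supremum is taken in the extended reals, so that an unbounded set of lengths gives
  \<open>\<infinity>\<close> and not an unspecified real number.
\<close>

definition d :: "point \<Rightarrow> ereal" where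
  "d q = (if lengths_to q = {} then 0 else (SUP l\<in>lengths_to q. ereal l))"

definition unit_sphere :: "point set" where
  "unit_sphere = {q. d q = 1}"

section \<open>The exponential mapping\<close>

definition extremal ::
    "real \<times> real \<Rightarrow> real \<Rightarrow>
     (real \<Rightarrow> real) \<Rightarrow> (real \<Rightarrow> real) \<Rightarrow> (real \<Rightarrow> real) \<Rightarrow> (real \<Rightarrow> real) \<Rightarrow> bool" where
  "extremal = (\<lambda>(psi0, c) T psi x y z.
     psi 0 = psi0 \<and> x 0 = 0 \<and> y 0 = 0 \<and> z 0 = 0 \<and>
     (\<forall>t\<in>{0..T}.
        (psi has_real_derivative c * x t) (at t within {0..T}) \<and>
        (x has_real_derivative cosh (psi t)) (at t within {0..T}) \<and>
        (y has_real_derivative sinh (psi t)) (at t within {0..T}) \<and>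
        (z has_real_derivative (x t)\<^sup>2 / 2 * sinh (psi t)) (at t within {0..T})))"

text \<open>
  Solutions are unique, so the description determines the value whenever the solution exists
  on \<open>{0..t}\<close>.
\<close>

definition Exp :: "real \<times> real \<Rightarrow> real \<Rightarrow> point" where
  "Exp lam t = (THE q. \<exists>psi x y z. extremal lam t psi x y z \<and> q = (x t, y t, z t))"

definition elliptic_K :: "real \<Rightarrow> real" where
  "elliptic_K k = integral {0..pi/2} (\<lambda>\<theta>. 1 / sqrt (1 - k\<^sup>2 * (sin \<theta>)\<^sup>2))"

text \<open>The time at which the solution with initial data \<open>(psi0, c)\<close> blows up, in closed form.\<close>

definition lifetime :: "real \<times> real \<Rightarrow> ereal" where
  "lifetime = (\<lambda>(psi0, c).
     if c = 0 then \<infinity>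
     else
       let E = - sinh psi0;
           ae = sqrt (sqrt (1 + E\<^sup>2) / 2);
           k = sqrt (1 / 2 * (1 + sgn c * (E / sqrt (1 + E\<^sup>2))))
       in ereal (elliptic_K k / (ae * sqrt \<bar>c\<bar>)))"

end

theory Submission
  imports Defs "HOL-Complex_Analysis.Complex_Analysis"
begin

text \<open>
  Along an admissible curve \<open>x\<close> does not decrease, and after reparametrisation by \<open>x\<close> one has
  \<open>dy = w dx\<close> and \<open>dz = (x\<^sup>2 / 2) w dx\<close> with \<open>|w| \<le> 1\<close>, while the length is the integral of the concave
  function \<open>sqrt (1 - w\<^sup>2)\<close>. Prescribing the endpoint means two linear conditions on \<open>w\<close>. The problem is
  therefore one of convex optimisation, and its solution by Lagrange multipliers is global: no local
  analysis of extremals and no conjugate points enter. Multipliers \<open>a\<close>, \<open>b\<close> bound all lengths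
  (\<open>admissible_dual_bound\<close>), and the curve with \<open>w = p / sqrt (1 + p\<^sup>2)\<close>, \<open>p = a + b x\<^sup>2\<close>, attains the bound
  (\<open>extremal_length_attained\<close>). On a curve that ends at \<open>x\<close>, put \<open>e = b x\<^sup>2\<close> and measure the first coordinate in
  units of \<open>x\<close>. Then the endpoint is \<open>(x, x J, x\<^sup>3 M / 2)\<close> and the length is \<open>x I\<close>, where \<open>I\<close>, \<open>J\<close>, \<open>M\<close> depend only on
  \<open>(a, e)\<close>: they are integrals over the unit interval of \<open>1 / sqrt (1 + p\<^sup>2)\<close>, \<open>p / sqrt (1 + p\<^sup>2)\<close> and
  \<open>s\<^sup>2 p / sqrt (1 + p\<^sup>2)\<close> with \<open>p = a + e s\<^sup>2\<close>.

  Conversely, every point at positive distance is such an endpoint: there the dual function is bounded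
  below by a positive number, hence coercive, and at its minimum the gradient condition reads
  \<open>(J, M) = (y / x, 2 z / x\<^sup>3)\<close> (\<open>positive_distance_imp_endpoint\<close>). So the sphere consists of the points with
  \<open>x = 1 / I\<close>, and \<open>(a, e)\<close> ranges over the whole plane. Since \<open>(J, M)\<close> is the gradient of a strictly convex
  function, \<open>(a, e)\<close> is a global coordinate on the sphere (\<open>inj_slopes\<close>). The number \<open>a\<close> is \<open>sinh \<psi>\<close> at the start
  and \<open>e\<close> is its increase up to time 1.

  The system for the exponential mapping integrates to \<open>sinh \<psi> = a + c x\<^sup>2 / 2\<close>, so that its solutions are these
  extremals with \<open>b = c / 2\<close> (\<open>Exp_eq_endpoint\<close>). A solution exists at time 1 exactly if the integral of
  \<open>1 / sqrt (1 + (a + b s\<^sup>2)\<^sup>2)\<close> over the half line exceeds 1, and this integral is the complete elliptic integral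
  in the definition of the lifetime (\<open>primitive_rate_elliptic\<close>).

  Analyticity is obtained from complex extensions. A continuous function that is holomorphic in each
  variable has a power series (\<open>power_series_of_separately_holomorphic\<close>), and \<open>I\<close>, \<open>J\<close>, \<open>M\<close> extend to complex
  \<open>(a, e)\<close> near the real plane. The Jacobian of \<open>(J, M)\<close> is positive at real points, so the inverse function
  theorem in two complex variables extends the inverse as well (\<open>cslopes_local_inverse\<close>). Finally
  \<open>(x I - 1, a, e)\<close> are analytic coordinates on the set of points at positive distance, and the sphere
  is where the first of them vanishes.
\<close>

section \<open>Power series from separate holomorphy\<close>

lemma continuous_on_contour_integral_param:
  fixes f :: "'p::topological_space \<Rightarrow> complex \<Rightarrow> complex"
  assumes g: "valid_path g"
    and gd: "continuous_on {0..1} (\<lambda>t. vector_derivative g (at t))"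
    and cont: "continuous_on (U \<times> path_image g) (\<lambda>(z, w). f z w)"
  shows "continuous_on U (\<lambda>z. contour_integral g (f z))"
proof -
  have gc: "continuous_on {0..1} g"
    using valid_path_imp_path[OF g] by (simp add: path_def)
  have "continuous_on (U \<times> cbox 0 1) (\<lambda>x. (\<lambda>(z, w). f z w) (fst x, g (snd x)))"
    by (rule continuous_on_compose2[OF cont])
      (auto intro!: continuous_intros continuous_on_compose2[OF gc] simp: path_image_def)
  moreover have "continuous_on (U \<times> cbox 0 1) (\<lambda>x. vector_derivative g (at (snd x)))"
    by (rule continuous_on_compose2[OF gd]) (auto intro!: continuous_intros)
  ultimately have "continuous_on (U \<times> cbox 0 1) (\<lambda>(z, t). f z (g t) * vector_derivative g (at t))"
    by (auto simp: case_prod_beta intro!: continuous_intros)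
  from integral_continuous_on_param[OF this] show ?thesis
    by (simp add: contour_integral_integral)
qed

lemma continuous_on_vector_derivative_circlepath:
  "continuous_on A (\<lambda>t. vector_derivative (circlepath z r) (at t))"
  unfolding vector_derivative_circlepath by (intro continuous_intros)

text \<open>
  By Morera: the integral over a triangle commutes with the contour integral, and the inner integrals
  vanish by Cauchy.
\<close>
lemma holomorphic_on_contour_integral_param:
  assumes S: "open S"
    and cont: "continuous_on (S \<times> path_image (circlepath z0 r)) (\<lambda>(z, w). f z w)"
    and hol: "\<And>w. w \<in> path_image (circlepath z0 r) \<Longrightarrow> (\<lambda>z. f z w) holomorphic_on S"
  shows "(\<lambda>z. contour_integral (circlepath z0 r) (f z)) holomorphic_on S"
proof -
  let ?g = "circlepath z0 r"
  let ?G = "\<lambda>z. contour_integral ?g (f z)"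
  have cG: "continuous_on S ?G"
    by (rule continuous_on_contour_integral_param[OF _ _ cont])
      (auto intro: continuous_on_vector_derivative_circlepath)
  have tri: "contour_integral (linepath a b) ?G + contour_integral (linepath b c) ?G
      + contour_integral (linepath c a) ?G = 0" if abc: "convex hull {a, b, c} \<subseteq> S" for a b c
  proof -
    define L where "L = (\<lambda>a b w. contour_integral (linepath a b) (\<lambda>z. f z w))"
    have seg: "closed_segment p q \<subseteq> convex hull {a, b, c}"
      if "p \<in> {a, b, c}" "q \<in> {a, b, c}" for p q
      using that by (metis closed_segment_subset_convex_hull hull_inc)
    have cl: "continuous_on (closed_segment p q \<times> path_image ?g) (\<lambda>(z, w). f z w)"
      if "p \<in> {a, b, c}" "q \<in> {a, b, c}" for p q
      by (rule continuous_on_subset[OF cont]) (use seg[OF that] abc in blast)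
    have sw: "contour_integral (linepath p q) ?G = contour_integral ?g (L p q)"
      if "p \<in> {a, b, c}" "q \<in> {a, b, c}" for p q
      unfolding L_def
      by (rule contour_integral_swap)
        (use cl[OF that] in \<open>auto intro: continuous_on_vector_derivative_circlepath\<close>)
    have int: "L p q contour_integrable_on ?g"
      if "p \<in> {a, b, c}" "q \<in> {a, b, c}" for p q
    proof -
      have "continuous_on (path_image ?g \<times> closed_segment p q) (\<lambda>x. (\<lambda>(z, w). f z w) (snd x, fst x))"
        by (rule continuous_on_compose2[OF cl[OF that]]) (auto intro!: continuous_intros)
      hence "continuous_on (path_image ?g) (L p q)"
        unfolding L_def
        by (intro continuous_on_contour_integral_param) (auto simp: case_prod_beta)
      thus ?thesis by (rule contour_integrable_continuous_circlepath)
    qed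
    have zero: "L a b w + L b c w + L c a w = 0" if w: "w \<in> path_image ?g" for w
    proof -
      have "(\<lambda>z. f z w) holomorphic_on convex hull {a, b, c}"
        using hol[OF w] abc by (rule holomorphic_on_subset)
      from Cauchy_theorem_triangle[OF this] show ?thesis
        unfolding L_def
        by (intro has_chain_integral_chain_integral3[where i = 0, simplified]) simp
    qed
    have "contour_integral ?g (\<lambda>w. L a b w + L b c w + L c a w)
        = contour_integral ?g (L a b) + contour_integral ?g (L b c) + contour_integral ?g (L c a)"
      by (simp add: contour_integral_add contour_integrable_add int)
    moreover have "contour_integral ?g (\<lambda>w. L a b w + L b c w + L c a w)
        = contour_integral ?g (\<lambda>w. 0)"
      by (rule contour_integral_cong) (auto simp: zero simp del: path_image_circlepath)
    ultimately show ?thesis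
      by (simp add: sw)
  qed
  have "?G analytic_on S"
    by (rule Morera_local_triangle) (use S cG tri in blast)
  thus ?thesis
    by (simp add: analytic_imp_holomorphic)
qed

lemma summable_on_PiE_geometric:
  fixes a :: "'i \<Rightarrow> real"
  assumes B: "finite B" and a: "\<And>i. i \<in> B \<Longrightarrow> 0 \<le> a i \<and> a i < 1"
  shows "(\<lambda>m. \<Prod>i\<in>B. a i ^ m i) summable_on (B \<rightarrow>\<^sub>E (UNIV :: nat set))"
proof -
  have "Infinite_Set_Sum.abs_summable_on (\<lambda>n. a i ^ n) (UNIV :: nat set)" if "i \<in> B" for i
    unfolding abs_summable_on_nat_iff' using a[OF that] by (simp add: norm_power summable_geometric)
  hence "Infinite_Set_Sum.abs_summable_on (\<lambda>m. \<Prod>i\<in>B. a i ^ m i) (B \<rightarrow>\<^sub>E (UNIV :: nat set))"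
    by (intro abs_summable_on_prod_PiE[OF B]) simp_all
  thus ?thesis
    by (simp only: abs_summable_equivalent[symmetric] abs_summable_summable)
qed

text \<open>
  Osgood's lemma in power series form. The induction expands in one variable at a time by Cauchy's
  formula. The bound on the coefficients is part of the statement because it makes the multiple
  series absolutely summable, and this allows the iterated sums to be joined.

  The variables are the values of a function \<open>\<zeta>\<close>; the last assumption says that those outside
  \<open>B\<close> do not influence \<open>F\<close>, so that \<open>F\<close> is constant when the induction reaches the empty set.
\<close>
lemma power_series_of_separately_holomorphic:
  fixes F :: "('i \<Rightarrow> complex) \<Rightarrow> complex"
  assumes "finite B" and r: "0 < r"
    and "continuous_on {\<zeta>. \<forall>i. cmod (\<zeta> i) \<le> r} F"
    and "\<And>\<zeta> i. \<lbrakk>\<forall>i. cmod (\<zeta> i) \<le> r; i \<in> B\<rbrakk> \<Longrightarrow> (\<lambda>w. F (\<zeta>(i := w))) holomorphic_on ball 0 r"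
    and "\<And>\<zeta>. \<forall>i. cmod (\<zeta> i) \<le> r \<Longrightarrow> cmod (F \<zeta>) \<le> K"
    and "\<And>\<zeta> \<zeta>'. \<lbrakk>\<forall>i. cmod (\<zeta> i) \<le> r; \<forall>i. cmod (\<zeta>' i) \<le> r; \<forall>i\<in>B. \<zeta> i = \<zeta>' i\<rbrakk> \<Longrightarrow> F \<zeta> = F \<zeta>'"
  shows "\<exists>c. (\<forall>m \<in> B \<rightarrow>\<^sub>E UNIV. cmod (c m) \<le> K / r ^ (\<Sum>i\<in>B. m i)) \<and>
           (\<forall>\<zeta>. (\<forall>i. cmod (\<zeta> i) < r) \<longrightarrow>
              ((\<lambda>m. c m * (\<Prod>i\<in>B. \<zeta> i ^ m i)) has_sum F \<zeta>) (B \<rightarrow>\<^sub>E (UNIV :: nat set)))"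
  using assms(1,3-)
proof (induction B arbitrary: F K rule: finite_induct)
  case empty
  have E: "F \<zeta> = F (\<lambda>_. 0)" if "\<forall>i. cmod (\<zeta> i) < r" for \<zeta>
  proof (rule empty.prems(4))
    show "\<forall>i. cmod (\<zeta> i) \<le> r" using that less_imp_le by blast
    show "\<forall>i. cmod ((\<lambda>_. 0) i) \<le> r" using r by simp
  qed simp
  show ?case
  proof (intro exI[of _ "\<lambda>_. F (\<lambda>_. 0)"] conjI ballI allI impI)
    show "cmod (F (\<lambda>_. 0)) \<le> K / r ^ (\<Sum>i\<in>{}. m i)" for m :: "'i \<Rightarrow> nat"
      using empty.prems(3)[of "\<lambda>_. 0"] r by simp
    show "((\<lambda>m. F (\<lambda>_. 0) * (\<Prod>i\<in>{}. \<zeta> i ^ m i)) has_sum F \<zeta>) ({} \<rightarrow>\<^sub>E UNIV)"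
      if "\<forall>i. cmod (\<zeta> i) < r" for \<zeta>
      using E[OF that] by (simp add: has_sum_finite_iff)
  qed
next
  case (insert j B)
  let ?P = "{\<zeta>. \<forall>i. cmod (\<zeta> i) \<le> r}"
  let ?g = "circlepath 0 r"
  \<comment> \<open>Cauchy's formula for the \<open>k\<close>-th Taylor coefficient in the coordinate \<open>j\<close>; as an integral over
    a circle it stays continuous, and holomorphic in each of the other coordinates.\<close>
  define C where "C = (\<lambda>k \<zeta>. 1 / (2 * pi * \<i>) * contour_integral ?g (\<lambda>w. F (\<zeta>(j := w)) / w ^ Suc k))"
  have img: "path_image ?g = sphere 0 r" using r by simp
  have upd: "continuous_on A (\<lambda>x. (fst x)(j := snd x))" for A :: "(('i \<Rightarrow> complex) \<times> complex) set"
  proof (rule continuous_on_coordinatewise_then_product)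
    fix i
    have "continuous_on A (\<lambda>x. fst x i)"
      by (rule continuous_on_product_then_coordinatewise) (intro continuous_on_fst continuous_on_id)
    thus "continuous_on A (\<lambda>x. ((fst x)(j := snd x)) i)"
      by (cases "i = j") (simp_all add: continuous_on_snd continuous_on_id)
  qed
  have contF: "continuous_on (?P \<times> cball 0 r) (\<lambda>x. F ((fst x)(j := snd x)))"
    by (rule continuous_on_compose2[OF insert.prems(1) upd]) auto
  have slice: "continuous_on (cball 0 r) (\<lambda>w. F (\<zeta>(j := w)))"
    "(\<lambda>w. F (\<zeta>(j := w))) holomorphic_on ball 0 r" if "\<zeta> \<in> ?P" for \<zeta>
  proof -
    have "continuous_on (cball 0 r) (\<lambda>w. (\<lambda>x. F ((fst x)(j := snd x))) (\<zeta>, w))"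
      by (rule continuous_on_compose2[OF contF]) (use that in \<open>auto intro: continuous_on_Pair continuous_on_const continuous_on_id\<close>)
    thus "continuous_on (cball 0 r) (\<lambda>w. F (\<zeta>(j := w)))" by simp
    show "(\<lambda>w. F (\<zeta>(j := w))) holomorphic_on ball 0 r"
      by (rule insert.prems(2)) (use that in auto)
  qed
  have C_deriv: "C k \<zeta> = (deriv ^^ k) (\<lambda>w. F (\<zeta>(j := w))) 0 / fact k" if "\<zeta> \<in> ?P" for k \<zeta>
    unfolding C_def
    using Cauchy_higher_derivative_integral_circlepath(2)[OF slice[OF that], of 0 k] r
    by (simp add: field_simps)
  have C_bound: "cmod (C k \<zeta>) \<le> K / r ^ k" if "\<zeta> \<in> ?P" for k \<zeta>
  proof -
    have "cmod (F (\<zeta>(j := w))) \<le> K" if "cmod (0 - w) = r" for w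
      using \<open>\<zeta> \<in> ?P\<close> that by (intro insert.prems(3)) auto
    from Cauchy_inequality[OF slice(2,1)[OF that] r this, of k] show ?thesis
      by (simp add: C_deriv[OF that] norm_divide field_simps)
  qed
  have expand: "((\<lambda>k. C k \<zeta> * \<zeta> j ^ k) has_sum F \<zeta>) UNIV" if "\<forall>i. cmod (\<zeta> i) < r" for \<zeta>
  proof (rule norm_summable_imp_has_sum)
    have \<zeta>: "\<zeta> \<in> ?P" using that less_imp_le by blast
    show "(\<lambda>k. C k \<zeta> * \<zeta> j ^ k) sums F \<zeta>"
      using holomorphic_power_series[OF slice(2)[OF \<zeta>], of "\<zeta> j"] that
      by (simp add: C_deriv[OF \<zeta>])
    show "summable (\<lambda>k. norm (C k \<zeta> * \<zeta> j ^ k))"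
    proof (rule summable_comparison_test')
      show "summable (\<lambda>k. K * (cmod (\<zeta> j) / r) ^ k)"
        using that r by (intro summable_mult summable_geometric) auto
      show "norm (norm (C k \<zeta> * \<zeta> j ^ k)) \<le> K * (cmod (\<zeta> j) / r) ^ k" for k
        using mult_right_mono[OF C_bound[OF \<zeta>, of k], of "cmod (\<zeta> j) ^ k"] r
        by (simp add: norm_mult norm_power power_divide)
    qed
  qed
  have integrand: "continuous_on (?P \<times> sphere 0 r) (\<lambda>(\<zeta>, w). F (\<zeta>(j := w)) / w ^ Suc k)" for k
    unfolding case_prod_beta
    by (intro continuous_on_divide continuous_on_subset[OF contF])
      (use r in \<open>auto simp del: power_Suc intro!: continuous_on_power continuous_on_snd continuous_on_id\<close>)
  have C_cont: "continuous_on ?P (C k)" for k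
    unfolding C_def
    by (intro continuous_on_mult continuous_on_const continuous_on_contour_integral_param
          continuous_on_vector_derivative_circlepath) (use integrand[of k] img in auto)
  have C_hol: "(\<lambda>v. C k (\<zeta>(i := v))) holomorphic_on ball 0 r"
    if \<zeta>: "\<forall>i. cmod (\<zeta> i) \<le> r" and i: "i \<in> B" for \<zeta> i k
  proof -
    have ij: "i \<noteq> j" using i insert.hyps by auto
    have "continuous_on A (\<lambda>x. \<zeta>(i := fst x))" for A :: "(complex \<times> complex) set"
    proof (rule continuous_on_coordinatewise_then_product)
      show "continuous_on A (\<lambda>x. (\<zeta>(i := fst x)) l)" for l
        by (cases "l = i") (simp_all add: continuous_on_fst continuous_on_id)
    qed
    hence "continuous_on (ball 0 r \<times> sphere 0 r)
        (\<lambda>x. (\<lambda>(\<zeta>, w). F (\<zeta>(j := w)) / w ^ Suc k) (\<zeta>(i := fst x), snd x))"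
      by (intro continuous_on_compose2[OF integrand] continuous_on_Pair continuous_on_snd
          continuous_on_id) (use \<zeta> in auto)
    hence cont_vw: "continuous_on (ball 0 r \<times> sphere 0 r)
        (\<lambda>(v, w). F (\<zeta>(i := v, j := w)) / w ^ Suc k)"
      by (simp add: case_prod_beta)
    have hol_v: "(\<lambda>v. F (\<zeta>(i := v, j := w)) / w ^ Suc k) holomorphic_on ball 0 r"
      if w: "w \<in> sphere 0 r" for w
    proof -
      have "(\<lambda>v. F (\<zeta>(j := w, i := v))) holomorphic_on ball 0 r"
        using \<zeta> w i by (intro insert.prems(2)) auto
      hence "(\<lambda>v. F (\<zeta>(i := v, j := w))) holomorphic_on ball 0 r"
        by (simp only: fun_upd_twist[OF ij])
      moreover have "w \<noteq> 0" using w r by auto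
      ultimately show ?thesis
        by (intro holomorphic_intros) auto
    qed
    have "(\<lambda>v. contour_integral ?g (\<lambda>w. F (\<zeta>(i := v, j := w)) / w ^ Suc k))
        holomorphic_on ball 0 r"
      by (rule holomorphic_on_contour_integral_param[where f = "\<lambda>v w. F (\<zeta>(i := v, j := w)) / w ^ Suc k"])
        (use cont_vw hol_v in \<open>simp_all only: img open_ball\<close>)
    thus ?thesis
      unfolding C_def by (intro holomorphic_intros)
  qed
  have C_dep: "C k \<zeta> = C k \<zeta>'" if "\<forall>i. cmod (\<zeta> i) \<le> r" "\<forall>i. cmod (\<zeta>' i) \<le> r" "\<forall>i\<in>B. \<zeta> i = \<zeta>' i"
    for k \<zeta> \<zeta>'
  proof -
    have "F (\<zeta>(j := w)) = F (\<zeta>'(j := w))" if "w \<in> sphere 0 r" for w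
      using \<open>\<forall>i. cmod (\<zeta> i) \<le> r\<close> \<open>\<forall>i. cmod (\<zeta>' i) \<le> r\<close> \<open>\<forall>i\<in>B. \<zeta> i = \<zeta>' i\<close> that
      by (intro insert.prems(4)) auto
    thus ?thesis
      unfolding C_def by (intro arg_cong2[where f = "(*)"] refl contour_integral_cong)
        (use img in \<open>auto simp del: path_image_circlepath\<close>)
  qed
  have "\<forall>k. \<exists>c. (\<forall>m \<in> B \<rightarrow>\<^sub>E UNIV. cmod (c m) \<le> K / r ^ k / r ^ (\<Sum>i\<in>B. m i)) \<and>
           (\<forall>\<zeta>. (\<forall>i. cmod (\<zeta> i) < r) \<longrightarrow>
              ((\<lambda>m. c m * (\<Prod>i\<in>B. \<zeta> i ^ m i)) has_sum C k \<zeta>) (B \<rightarrow>\<^sub>E UNIV))"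
    by (intro allI insert.IH C_cont C_hol C_bound C_dep) simp_all
  from choice[OF this] obtain c
    where c: "\<forall>k. (\<forall>m \<in> B \<rightarrow>\<^sub>E UNIV. cmod (c k m) \<le> K / r ^ k / r ^ (\<Sum>i\<in>B. m i)) \<and>
           (\<forall>\<zeta>. (\<forall>i. cmod (\<zeta> i) < r) \<longrightarrow>
              ((\<lambda>m. c k m * (\<Prod>i\<in>B. \<zeta> i ^ m i)) has_sum C k \<zeta>) (B \<rightarrow>\<^sub>E UNIV))" ..
  have c_bound: "cmod (c k m) \<le> K / r ^ k / r ^ (\<Sum>i\<in>B. m i)" if "m \<in> B \<rightarrow>\<^sub>E UNIV" for k m
    using c that by blast
  have c_sum: "((\<lambda>m. c k m * (\<Prod>i\<in>B. \<zeta> i ^ m i)) has_sum C k \<zeta>) (B \<rightarrow>\<^sub>E UNIV)"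
    if "\<forall>i. cmod (\<zeta> i) < r" for k \<zeta>
    using c that by blast
  define c' where "c' = (\<lambda>m. c (m j) (restrict m B))"
  have restr: "restrict m B \<in> B \<rightarrow>\<^sub>E (UNIV :: nat set)" for m by auto
  have sums_B: "(\<Sum>i\<in>B. restrict m B i) = (\<Sum>i\<in>B. m i)" for m :: "'i \<Rightarrow> nat"
    by (rule sum.cong) auto
  have bound': "cmod (c' m) \<le> K / r ^ (\<Sum>i\<in>insert j B. m i)" for m
    using c_bound[OF restr, of "m j" m] insert.hyps
    by (simp add: c'_def sums_B power_add field_simps)
  have "((\<lambda>m. c' m * (\<Prod>i\<in>insert j B. \<zeta> i ^ m i)) has_sum F \<zeta>) (insert j B \<rightarrow>\<^sub>E UNIV)"
    if \<zeta>: "\<forall>i. cmod (\<zeta> i) < r" for \<zeta>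
  proof -
    let ?t = "\<lambda>m. c' m * (\<Prod>i\<in>insert j B. \<zeta> i ^ m i)"
    let ?h = "\<lambda>(k, m). m(j := k)"
    have inj: "inj_on ?h (UNIV \<times> (B \<rightarrow>\<^sub>E (UNIV :: nat set)))"
      using inj_combinator[OF insert.hyps(2), of "\<lambda>_. UNIV :: nat set"] by simp
    have ran: "insert j B \<rightarrow>\<^sub>E UNIV = ?h ` (UNIV \<times> (B \<rightarrow>\<^sub>E (UNIV :: nat set)))"
      by (rule PiE_insert_eq)
    have th: "?t (?h (k, m)) = (c k m * (\<Prod>i\<in>B. \<zeta> i ^ m i)) * \<zeta> j ^ k" if "m \<in> B \<rightarrow>\<^sub>E UNIV" for k m
    proof -
      have "restrict (m(j := k)) B = m"
        using that insert.hyps by (auto simp: PiE_def extensional_def restrict_def fun_eq_iff)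
      moreover have "(\<Prod>i\<in>B. \<zeta> i ^ (m(j := k)) i) = (\<Prod>i\<in>B. \<zeta> i ^ m i)"
        using insert.hyps by (intro prod.cong) auto
      ultimately show ?thesis
        using insert.hyps by (simp add: c'_def)
    qed
    have "?t summable_on (insert j B \<rightarrow>\<^sub>E UNIV)"
    proof (rule abs_summable_summable, rule summable_on_comparison_test)
      show "(\<lambda>m. K * (\<Prod>i\<in>insert j B. (cmod (\<zeta> i) / r) ^ m i)) summable_on (insert j B \<rightarrow>\<^sub>E UNIV)"
        by (intro summable_on_cmult_right summable_on_PiE_geometric) (use insert.hyps \<zeta> r in auto)
      show "norm (?t m) \<le> K * (\<Prod>i\<in>insert j B. (cmod (\<zeta> i) / r) ^ m i)" for m
      proof -
        have "norm (?t m) \<le> K / r ^ (\<Sum>i\<in>insert j B. m i) * (\<Prod>i\<in>insert j B. cmod (\<zeta> i) ^ m i)"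
          unfolding norm_mult prod_norm[symmetric] norm_power
          by (intro mult_right_mono bound' prod_nonneg) auto
        also have "\<dots> = K * (\<Prod>i\<in>insert j B. (cmod (\<zeta> i) / r) ^ m i)"
          by (simp add: power_divide prod_dividef power_sum)
        finally show ?thesis .
      qed
    qed auto
    hence summ: "(?t \<circ> ?h) summable_on (UNIV \<times> (B \<rightarrow>\<^sub>E UNIV))"
      unfolding ran by (subst (asm) summable_on_reindex[OF inj])
    have "((?t \<circ> ?h) has_sum F \<zeta>) (UNIV \<times> (B \<rightarrow>\<^sub>E UNIV))"
    proof (rule has_sum_SigmaI[OF _ expand[OF \<zeta>] summ])
      fix k :: nat
      have "((\<lambda>m. (c k m * (\<Prod>i\<in>B. \<zeta> i ^ m i)) * \<zeta> j ^ k) has_sum C k \<zeta> * \<zeta> j ^ k) (B \<rightarrow>\<^sub>E UNIV)"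
        by (intro has_sum_cmult_left c_sum \<zeta>)
      moreover have "?t (?h (k, m)) = (c k m * (\<Prod>i\<in>B. \<zeta> i ^ m i)) * \<zeta> j ^ k" if "m \<in> B \<rightarrow>\<^sub>E UNIV" for m
        by (rule th[OF that])
      ultimately show "((\<lambda>m. (?t \<circ> ?h) (k, m)) has_sum C k \<zeta> * \<zeta> j ^ k) (B \<rightarrow>\<^sub>E UNIV)"
        by (subst has_sum_cong[where g = "\<lambda>m. (c k m * (\<Prod>i\<in>B. \<zeta> i ^ m i)) * \<zeta> j ^ k"]) simp_all
    qed
    thus ?thesis
      unfolding ran by (subst has_sum_reindex[OF inj])
  qed
  with bound' show ?case by blast
qed


text \<open>
  Tychonoff's theorem; it provides the bound that Cauchy's estimate starts from.
\<close>
lemma compact_polydisc: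
  "compact {\<zeta> :: 'i \<Rightarrow> complex. \<forall>i. cmod (\<zeta> i) \<le> r}"
proof -
  have "{\<zeta> :: 'i \<Rightarrow> complex. \<forall>i. cmod (\<zeta> i) \<le> r} = PiE UNIV (\<lambda>_. cball 0 r)"
    by (auto simp: PiE_def)
  moreover have "compactin (product_topology (\<lambda>_::'i. euclidean) UNIV) (PiE UNIV (\<lambda>_. cball (0::complex) r))"
    by (simp add: compactin_PiE)
  ultimately show ?thesis
    by (simp add: euclidean_product_topology)
qed

lemma has_sum_finite_family:
  fixes f :: "'i \<Rightarrow> 'm \<Rightarrow> 'b::topological_comm_monoid_add"
  assumes "finite A" "\<And>b. b \<in> A \<Longrightarrow> (f b has_sum s b) M"
  shows "((\<lambda>m. \<Sum>b\<in>A. f b m) has_sum (\<Sum>b\<in>A. s b)) M"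
  using assms by (induction A rule: finite_induct) (auto intro: has_sum_add)

text \<open>
  The criterion for analyticity used below: a continuous, separately holomorphic extension to complex
  arguments suffices. Unlike power series, such extensions pass through quotients, integrals over
  a parameter and inverse functions without any estimates.
\<close>
theorem real_analytic_at_of_separately_holomorphic:
  fixes f :: "'a::euclidean_space \<Rightarrow> 'b::euclidean_space"
    and F :: "'b \<Rightarrow> ('a \<Rightarrow> complex) \<Rightarrow> complex"
  assumes r: "0 < r"
    and cont: "\<And>b. b \<in> Basis \<Longrightarrow>
      continuous_on {\<zeta>. \<forall>i\<in>Basis. cmod (\<zeta> i - of_real (a \<bullet> i)) \<le> r} (F b)"
    and hol: "\<And>b \<zeta> i. \<lbrakk>b \<in> Basis; \<forall>i\<in>Basis. cmod (\<zeta> i - of_real (a \<bullet> i)) \<le> r; i \<in> Basis\<rbrakk> \<Longrightarrow>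
      (\<lambda>w. F b (\<zeta>(i := w))) holomorphic_on ball (of_real (a \<bullet> i)) r"
    and ext: "\<And>b x. \<lbrakk>b \<in> Basis; x \<in> ball a r\<rbrakk> \<Longrightarrow> f x \<bullet> b = Re (F b (\<lambda>i. if i \<in> Basis then of_real (x \<bullet> i) else 0))"
  shows "real_analytic_at f a"
proof -
  let ?P = "{\<zeta> :: 'a \<Rightarrow> complex. \<forall>i. cmod (\<zeta> i) \<le> r}"
  let ?M = "Basis \<rightarrow>\<^sub>E (UNIV :: nat set)"
  \<comment> \<open>The translation that moves \<open>a\<close> to the origin. The value 0 off the basis makes the composite
    depend on the basis coordinates only.\<close>
  define T where "T = (\<lambda>(\<zeta> :: 'a \<Rightarrow> complex) i. if i \<in> Basis then of_real (a \<bullet> i) + \<zeta> i else 0)"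
  have contT: "continuous_on A T" for A
  proof (rule continuous_on_coordinatewise_then_product)
    fix i
    have "continuous_on A (\<lambda>\<zeta> :: 'a \<Rightarrow> complex. \<zeta> i)"
      by (rule continuous_on_product_then_coordinatewise) (rule continuous_on_id)
    thus "continuous_on A (\<lambda>\<zeta>. T \<zeta> i)"
      by (cases "i \<in> Basis") (simp_all add: T_def continuous_on_add)
  qed
  have T_in: "\<forall>i\<in>Basis. cmod (T \<zeta> i - of_real (a \<bullet> i)) \<le> r" if "\<forall>i. cmod (\<zeta> i) \<le> r" for \<zeta>
    using that by (simp add: T_def)
  have "\<forall>b\<in>Basis. \<exists>c. \<forall>\<zeta>. (\<forall>i. cmod (\<zeta> i) < r) \<longrightarrow>
      ((\<lambda>m. c m * (\<Prod>i\<in>Basis. \<zeta> i ^ m i)) has_sum F b (T \<zeta>)) ?M"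
  proof
    fix b :: 'b assume b: "b \<in> Basis"
    have c1: "continuous_on ?P (\<lambda>\<zeta>. F b (T \<zeta>))"
      by (rule continuous_on_compose2[OF cont[OF b] contT]) (use T_in in auto)
    have "compact ((\<lambda>\<zeta>. F b (T \<zeta>)) ` ?P)"
      by (rule compact_continuous_image[OF c1 compact_polydisc])
    then obtain K where K: "\<And>\<zeta>. \<forall>i. cmod (\<zeta> i) \<le> r \<Longrightarrow> cmod (F b (T \<zeta>)) \<le> K"
      by (auto dest!: compact_imp_bounded simp: bounded_iff) blast
    have h1: "(\<lambda>w. F b (T (\<zeta>(i := w)))) holomorphic_on ball 0 r"
      if \<zeta>: "\<forall>i. cmod (\<zeta> i) \<le> r" and i: "i \<in> Basis" for \<zeta> i
    proof -
      have "T (\<zeta>(i := w)) = (T \<zeta>)(i := of_real (a \<bullet> i) + w)" for w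
        using i by (auto simp: T_def fun_eq_iff)
      moreover have "((\<lambda>v. F b ((T \<zeta>)(i := v))) \<circ> (\<lambda>w. of_real (a \<bullet> i) + w)) holomorphic_on ball 0 r"
        by (rule holomorphic_on_compose_gen[OF _ hol[OF b T_in[OF \<zeta>] i]])
          (auto intro!: holomorphic_intros simp: dist_norm)
      ultimately show ?thesis by (simp add: comp_def)
    qed
    have d1: "F b (T \<zeta>) = F b (T \<zeta>')" if "\<forall>i\<in>Basis. \<zeta> i = \<zeta>' i" for \<zeta> \<zeta>'
    proof -
      have "T \<zeta> = T \<zeta>'" using that by (simp add: T_def fun_eq_iff)
      thus ?thesis by simp
    qed
    show "\<exists>c. \<forall>\<zeta>. (\<forall>i. cmod (\<zeta> i) < r) \<longrightarrow>
        ((\<lambda>m. c m * (\<Prod>i\<in>Basis. \<zeta> i ^ m i)) has_sum F b (T \<zeta>)) ?M"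
      using power_series_of_separately_holomorphic[OF finite_Basis r c1 h1 K d1] by blast
  qed
  from bchoice[OF this] obtain c where c': "\<forall>b\<in>Basis. \<forall>\<zeta>. (\<forall>i. cmod (\<zeta> i) < r) \<longrightarrow>
      ((\<lambda>m. c b m * (\<Prod>i\<in>Basis. \<zeta> i ^ m i)) has_sum F b (T \<zeta>)) ?M" ..
  have c: "((\<lambda>m. c b m * (\<Prod>i\<in>Basis. \<zeta> i ^ m i)) has_sum F b (T \<zeta>)) ?M"
    if "b \<in> Basis" "\<forall>i. cmod (\<zeta> i) < r" for b \<zeta>
    using c' that by blast
  define c' where "c' = (\<lambda>m. \<Sum>b\<in>Basis. Re (c b m) *\<^sub>R b)"
  have "((\<lambda>m. (\<Prod>i\<in>Basis. ((x - a) \<bullet> i) ^ m i) *\<^sub>R c' m) has_sum f x) ?M" if x: "x \<in> ball a r" for x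
  proof -
    define \<zeta> where "\<zeta> = (\<lambda>i. if i \<in> Basis then complex_of_real ((x - a) \<bullet> i) else 0)"
    have \<zeta>: "\<forall>i. cmod (\<zeta> i) < r"
    proof
      fix i
      have "\<bar>(x - a) \<bullet> i\<bar> < r" if "i \<in> Basis"
        using Basis_le_norm[OF that, of "x - a"] x by (simp add: dist_norm norm_minus_commute)
      thus "cmod (\<zeta> i) < r"
        using r by (simp add: \<zeta>_def)
    qed
    have T\<zeta>: "T \<zeta> = (\<lambda>i. if i \<in> Basis then of_real (x \<bullet> i) else 0)"
      by (simp add: T_def \<zeta>_def fun_eq_iff inner_diff_left)
    have Re_of_real_mult: "Re (z * of_real y) = Re z * y" for z y
      by simp
    have prod_eq: "(\<Prod>i\<in>Basis. \<zeta> i ^ m i) = of_real (\<Prod>i\<in>Basis. ((x - a) \<bullet> i) ^ m i)" for m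
      by (simp add: \<zeta>_def)
    have "((\<lambda>m. (\<Prod>i\<in>Basis. ((x - a) \<bullet> i) ^ m i) *\<^sub>R (Re (c b m) *\<^sub>R b)) has_sum (f x \<bullet> b) *\<^sub>R b) ?M"
      if b: "b \<in> Basis" for b
    proof -
      have "((\<lambda>m. Re (c b m * (\<Prod>i\<in>Basis. \<zeta> i ^ m i))) has_sum Re (F b (T \<zeta>))) ?M"
        by (rule has_sum_Re[OF c[OF b \<zeta>]])
      hence "((\<lambda>m. Re (c b m) * (\<Prod>i\<in>Basis. ((x - a) \<bullet> i) ^ m i)) has_sum f x \<bullet> b) ?M"
        unfolding prod_eq T\<zeta> ext[OF b x] Re_of_real_mult .
      from has_sum_bounded_linear[OF bounded_linear_scaleR_left this, of b]
      show ?thesis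
        by (simp add: mult.commute)
    qed
    hence "((\<lambda>m. \<Sum>b\<in>Basis. (\<Prod>i\<in>Basis. ((x - a) \<bullet> i) ^ m i) *\<^sub>R (Re (c b m) *\<^sub>R b))
        has_sum (\<Sum>b\<in>Basis. (f x \<bullet> b) *\<^sub>R b)) ?M"
      by (intro has_sum_finite_family) auto
    thus ?thesis
      by (simp add: c'_def scaleR_sum_right euclidean_representation)
  qed
  thus ?thesis
    unfolding real_analytic_at_def using r by blast
qed


lemma real_analytic_at_pairI:
  fixes f :: "real \<times> real \<Rightarrow> 'b::euclidean_space" and G :: "'b \<Rightarrow> complex \<times> complex \<Rightarrow> complex"
  assumes W: "open W" "(of_real a1, of_real a2) \<in> W"
    and cont: "\<And>b. b \<in> Basis \<Longrightarrow> continuous_on W (G b)"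
    and diff: "\<And>b z w. \<lbrakk>b \<in> Basis; (z, w) \<in> W\<rbrakk> \<Longrightarrow> (\<lambda>u. G b (u, w)) field_differentiable at z"
      "\<And>b z w. \<lbrakk>b \<in> Basis; (z, w) \<in> W\<rbrakk> \<Longrightarrow> (\<lambda>u. G b (z, u)) field_differentiable at w"
    and ext: "\<And>b x y. \<lbrakk>b \<in> Basis; (of_real x, of_real y) \<in> W\<rbrakk> \<Longrightarrow>
      f (x, y) \<bullet> b = Re (G b (of_real x, of_real y))"
  shows "real_analytic_at f (a1, a2)"
proof -
  let ?i = "(1, 0) :: real \<times> real" and ?j = "(0, 1) :: real \<times> real"
  have Basis: "(Basis :: (real \<times> real) set) = {?i, ?j}"
    by (auto simp: Basis_prod_def zero_prod_def)
  obtain e where e: "e > 0" "ball (of_real a1, of_real a2) e \<subseteq> W"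
    using W open_contains_ball by blast
  define r where "r = e / 3"
  have r: "r > 0" using e by (simp add: r_def)
  have inW: "(z, w) \<in> W" if "cmod (z - of_real a1) \<le> r" "cmod (w - of_real a2) \<le> r" for z w
  proof -
    have "dist (z, w) (complex_of_real a1, complex_of_real a2)
        \<le> cmod (z - of_real a1) + cmod (w - of_real a2)"
      using norm_Pair_le[of "z - of_real a1" "w - of_real a2"] by (simp add: dist_norm)
    also have "\<dots> < e" using that e by (simp add: r_def)
    finally show ?thesis using e by (auto simp: dist_commute)
  qed
  have coord: "continuous_on A (\<lambda>\<zeta> :: real \<times> real \<Rightarrow> complex. \<zeta> k)" for A k
    by (rule continuous_on_product_then_coordinatewise) (rule continuous_on_id)
  show ?thesis
  proof (rule real_analytic_at_of_separately_holomorphic[OF r, where F = "\<lambda>b \<zeta>. G b (\<zeta> ?i, \<zeta> ?j)"])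
    fix b :: 'b assume b: "b \<in> Basis"
    show "continuous_on {\<zeta>. \<forall>i\<in>Basis. cmod (\<zeta> i - of_real ((a1, a2) \<bullet> i)) \<le> r}
        (\<lambda>\<zeta>. G b (\<zeta> ?i, \<zeta> ?j))"
      by (rule continuous_on_compose2[OF cont[OF b] continuous_on_Pair[OF coord coord]])
        (auto simp: Basis intro: inW)
    show "(\<lambda>w. G b ((\<zeta>(i := w)) ?i, (\<zeta>(i := w)) ?j)) holomorphic_on ball (of_real ((a1, a2) \<bullet> i)) r"
      if \<zeta>: "\<forall>i\<in>Basis. cmod (\<zeta> i - of_real ((a1, a2) \<bullet> i)) \<le> r" and i: "i \<in> Basis" for \<zeta> i
      unfolding holomorphic_on_def
    proof
      fix w assume "w \<in> ball (complex_of_real ((a1, a2) \<bullet> i)) r"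
      hence w: "cmod (w - of_real ((a1, a2) \<bullet> i)) \<le> r"
        by (simp add: dist_norm norm_minus_commute)
      from i consider "i = ?i" | "i = ?j" by (auto simp: Basis)
      hence "(\<lambda>w. G b ((\<zeta>(i := w)) ?i, (\<zeta>(i := w)) ?j)) field_differentiable at w"
      proof cases
        case 1
        have "(w, \<zeta> ?j) \<in> W" by (rule inW) (use w \<zeta> 1 in \<open>simp_all add: Basis\<close>)
        from diff(1)[OF b this] show ?thesis using 1 by simp
      next
        case 2
        have "(\<zeta> ?i, w) \<in> W" by (rule inW) (use w \<zeta> 2 in \<open>simp_all add: Basis\<close>)
        from diff(2)[OF b this] show ?thesis using 2 by simp
      qed
      thus "(\<lambda>w. G b ((\<zeta>(i := w)) ?i, (\<zeta>(i := w)) ?j)) field_differentiable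
          at w within ball (of_real ((a1, a2) \<bullet> i)) r"
        by (rule field_differentiable_at_within)
    qed
    show "f x \<bullet> b = Re (G b (if ?i \<in> Basis then of_real (x \<bullet> ?i) else 0,
        if ?j \<in> Basis then of_real (x \<bullet> ?j) else 0))" if x: "x \<in> ball (a1, a2) r" for x
    proof -
      obtain x1 x2 where x_eq: "x = (x1, x2)" by (metis prod.exhaust)
      have "\<bar>x1 - a1\<bar> \<le> r" "\<bar>x2 - a2\<bar> \<le> r"
        using x norm_fst_le[of "a1 - x1" "a2 - x2"] norm_snd_le[of "a2 - x2" "a1 - x1"]
        unfolding x_eq mem_ball dist_norm diff_Pair real_norm_def
        by - linarith+
      hence "(complex_of_real x1, complex_of_real x2) \<in> W"
        by (intro inW) (simp_all only: of_real_diff[symmetric] norm_of_real)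
      from ext[OF b this] show ?thesis
        by (simp add: Basis inner_prod_def x_eq)
    qed
  qed
qed

lemma real_analytic_at_tripleI:
  fixes f :: "real \<times> real \<times> real \<Rightarrow> 'b::euclidean_space"
    and G :: "'b \<Rightarrow> complex \<times> complex \<times> complex \<Rightarrow> complex"
  assumes W: "open W" "(of_real a1, of_real a2, of_real a3) \<in> W"
    and cont: "\<And>b. b \<in> Basis \<Longrightarrow> continuous_on W (G b)"
    and diff: "\<And>b z w v. \<lbrakk>b \<in> Basis; (z, w, v) \<in> W\<rbrakk> \<Longrightarrow> (\<lambda>u. G b (u, w, v)) field_differentiable at z"
      "\<And>b z w v. \<lbrakk>b \<in> Basis; (z, w, v) \<in> W\<rbrakk> \<Longrightarrow> (\<lambda>u. G b (z, u, v)) field_differentiable at w"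
      "\<And>b z w v. \<lbrakk>b \<in> Basis; (z, w, v) \<in> W\<rbrakk> \<Longrightarrow> (\<lambda>u. G b (z, w, u)) field_differentiable at v"
    and ext: "\<And>b x y z. \<lbrakk>b \<in> Basis; (of_real x, of_real y, of_real z) \<in> W\<rbrakk> \<Longrightarrow>
      f (x, y, z) \<bullet> b = Re (G b (of_real x, of_real y, of_real z))"
  shows "real_analytic_at f (a1, a2, a3)"
proof -
  let ?i = "(1, 0, 0) :: real \<times> real \<times> real" and ?j = "(0, 1, 0) :: real \<times> real \<times> real"
    and ?k = "(0, 0, 1) :: real \<times> real \<times> real"
  have Basis: "(Basis :: (real \<times> real \<times> real) set) = {?i, ?j, ?k}"
    by (auto simp: Basis_prod_def zero_prod_def)
  obtain e where e: "e > 0" "ball (of_real a1, of_real a2, of_real a3) e \<subseteq> W"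
    using W open_contains_ball by blast
  define r where "r = e / 4"
  have r: "r > 0" using e by (simp add: r_def)
  have inW: "(z, w, v) \<in> W"
    if "cmod (z - of_real a1) \<le> r" "cmod (w - of_real a2) \<le> r" "cmod (v - of_real a3) \<le> r" for z w v
  proof -
    have "dist (z, w, v) (complex_of_real a1, complex_of_real a2, complex_of_real a3)
        \<le> cmod (z - of_real a1) + (cmod (w - of_real a2) + cmod (v - of_real a3))"
      using norm_Pair_le[of "z - of_real a1" "(w - of_real a2, v - of_real a3)"]
        norm_Pair_le[of "w - of_real a2" "v - of_real a3"] by (simp add: dist_norm)
    also have "\<dots> < e" using that e by (simp add: r_def)
    finally show ?thesis using e by (auto simp: dist_commute)
  qed
  have coord: "continuous_on A (\<lambda>\<zeta> :: real \<times> real \<times> real \<Rightarrow> complex. \<zeta> k)" for A k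
    by (rule continuous_on_product_then_coordinatewise) (rule continuous_on_id)
  show ?thesis
  proof (rule real_analytic_at_of_separately_holomorphic[OF r, where F = "\<lambda>b \<zeta>. G b (\<zeta> ?i, \<zeta> ?j, \<zeta> ?k)"])
    fix b :: 'b assume b: "b \<in> Basis"
    show "continuous_on {\<zeta>. \<forall>i\<in>Basis. cmod (\<zeta> i - of_real ((a1, a2, a3) \<bullet> i)) \<le> r}
        (\<lambda>\<zeta>. G b (\<zeta> ?i, \<zeta> ?j, \<zeta> ?k))"
      by (rule continuous_on_compose2[OF cont[OF b]
            continuous_on_Pair[OF coord continuous_on_Pair[OF coord coord]]])
        (auto simp: Basis intro: inW)
    show "(\<lambda>w. G b ((\<zeta>(i := w)) ?i, (\<zeta>(i := w)) ?j, (\<zeta>(i := w)) ?k))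
        holomorphic_on ball (of_real ((a1, a2, a3) \<bullet> i)) r"
      if \<zeta>: "\<forall>i\<in>Basis. cmod (\<zeta> i - of_real ((a1, a2, a3) \<bullet> i)) \<le> r" and i: "i \<in> Basis" for \<zeta> i
      unfolding holomorphic_on_def
    proof
      fix w assume "w \<in> ball (complex_of_real ((a1, a2, a3) \<bullet> i)) r"
      hence w: "cmod (w - of_real ((a1, a2, a3) \<bullet> i)) \<le> r"
        by (simp add: dist_norm norm_minus_commute)
      from i consider "i = ?i" | "i = ?j" | "i = ?k" by (auto simp: Basis)
      hence "(\<lambda>w. G b ((\<zeta>(i := w)) ?i, (\<zeta>(i := w)) ?j, (\<zeta>(i := w)) ?k)) field_differentiable at w"
      proof cases
        case 1
        have "(w, \<zeta> ?j, \<zeta> ?k) \<in> W" by (rule inW) (use w \<zeta> 1 in \<open>simp_all add: Basis\<close>)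
        from diff(1)[OF b this] show ?thesis using 1 by simp
      next
        case 2
        have "(\<zeta> ?i, w, \<zeta> ?k) \<in> W" by (rule inW) (use w \<zeta> 2 in \<open>simp_all add: Basis\<close>)
        from diff(2)[OF b this] show ?thesis using 2 by simp
      next
        case 3
        have "(\<zeta> ?i, \<zeta> ?j, w) \<in> W" by (rule inW) (use w \<zeta> 3 in \<open>simp_all add: Basis\<close>)
        from diff(3)[OF b this] show ?thesis using 3 by simp
      qed
      thus "(\<lambda>w. G b ((\<zeta>(i := w)) ?i, (\<zeta>(i := w)) ?j, (\<zeta>(i := w)) ?k)) field_differentiable
          at w within ball (of_real ((a1, a2, a3) \<bullet> i)) r"
        by (rule field_differentiable_at_within)
    qed
    show "f x \<bullet> b = Re (G b (if ?i \<in> Basis then of_real (x \<bullet> ?i) else 0,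
        if ?j \<in> Basis then of_real (x \<bullet> ?j) else 0, if ?k \<in> Basis then of_real (x \<bullet> ?k) else 0))"
      if x: "x \<in> ball (a1, a2, a3) r" for x
    proof -
      obtain x1 x2 x3 where x_eq: "x = (x1, x2, x3)" by (metis prod.exhaust)
      have "\<bar>x1 - a1\<bar> \<le> r" "\<bar>x2 - a2\<bar> \<le> r" "\<bar>x3 - a3\<bar> \<le> r"
        using x norm_fst_le[of "a1 - x1" "(a2 - x2, a3 - x3)"]
          norm_snd_le[of "(a2 - x2, a3 - x3)" "a1 - x1"]
          norm_fst_le[of "a2 - x2" "a3 - x3"] norm_snd_le[of "a3 - x3" "a2 - x2"]
        unfolding x_eq mem_ball dist_norm diff_Pair real_norm_def
        by - linarith+
      hence "(complex_of_real x1, complex_of_real x2, complex_of_real x3) \<in> W"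
        by (intro inW) (simp_all only: of_real_diff[symmetric] norm_of_real)
      from ext[OF b this] show ?thesis
        by (simp add: Basis inner_prod_def x_eq)
    qed
  qed
qed

section \<open>Moments along a segment\<close>

text \<open>
  The even moments, over the unit interval, of \<open>g\<close> read along the segment from \<open>a\<close> to \<open>a + e\<close> at the point
  \<open>a + s\<^sup>2 e\<close>. Along an extremal the hyperbolic sine of the angle is \<open>a + s\<^sup>2 e\<close>, where \<open>s\<close> is the fraction of
  the final \<open>x\<close> already covered. The definition is common to real and complex arguments.
\<close>
definition moment :: "nat \<Rightarrow> ('a \<Rightarrow> 'a) \<Rightarrow> 'a \<times> 'a \<Rightarrow> 'a::real_normed_field" where
  "moment n g v = integral {0..1} (\<lambda>s. of_real s ^ (2 * n) * g (fst v + (of_real s)\<^sup>2 * snd v))"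

text \<open>
  The pairs \<open>(a, e)\<close> for which the segment from \<open>a\<close> to \<open>a + e\<close> lies in \<open>V\<close>, when \<open>V\<close> is convex.
\<close>
definition chords :: "'a::real_normed_field set \<Rightarrow> ('a \<times> 'a) set" where
  "chords V = {v. fst v \<in> V \<and> fst v + snd v \<in> V}"

lemma chords_UNIV [simp]: "chords UNIV = UNIV"
  by (simp add: chords_def)

lemma open_chords:
  assumes "open V"
  shows "open (chords V)"
proof -
  have "chords V = (fst -` V) \<inter> ((\<lambda>v. fst v + snd v) -` V)"
    by (auto simp: chords_def)
  thus ?thesis
    using assms by (auto intro!: open_Int open_vimage continuous_intros)
qed

lemma convex_chords:
  assumes "convex V"
  shows "convex (chords V)"
proof (rule convexI)
  fix x y :: "'a \<times> 'a" and u v :: real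
  assume xy: "x \<in> chords V" "y \<in> chords V" and uv: "0 \<le> u" "0 \<le> v" "u + v = 1"
  have "u *\<^sub>R fst x + v *\<^sub>R fst y \<in> V"
    by (rule convexD[OF assms _ _ uv]) (use xy in \<open>simp_all add: chords_def\<close>)
  moreover have "u *\<^sub>R (fst x + snd x) + v *\<^sub>R (fst y + snd y) \<in> V"
    by (rule convexD[OF assms _ _ uv]) (use xy in \<open>simp_all add: chords_def\<close>)
  ultimately show "u *\<^sub>R x + v *\<^sub>R y \<in> chords V"
    by (simp add: chords_def scaleR_add_right algebra_simps)
qed

lemma chord_mem:
  assumes "convex V" "v \<in> chords V" "0 \<le> s" "s \<le> 1"
  shows "fst v + (of_real s)\<^sup>2 * snd v \<in> V"
proof -
  have "(1 - s\<^sup>2) *\<^sub>R fst v + s\<^sup>2 *\<^sub>R (fst v + snd v) \<in> V"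
    by (rule convexD[OF assms(1)]) (use assms in \<open>simp_all add: chords_def power_le_one\<close>)
  thus ?thesis
    by (simp add: scaleR_conv_of_real algebra_simps)
qed

lemma continuous_on_chord:
  fixes g :: "'a::real_normed_field \<Rightarrow> 'a"
  assumes "convex V" "continuous_on V g"
  shows "continuous_on (chords V \<times> {0..1}) (\<lambda>x. g (fst (fst x) + (of_real (snd x))\<^sup>2 * snd (fst x)))"
  by (rule continuous_on_compose2[OF assms(2)])
    (use chord_mem[OF assms(1)] in \<open>auto intro!: continuous_intros\<close>)

lemma continuous_on_moment_integrand:
  fixes g :: "'a::real_normed_field \<Rightarrow> 'a"
  assumes "convex V" "continuous_on V g"
  shows "continuous_on (chords V \<times> {0..1})
    (\<lambda>x. of_real (snd x) ^ (2 * n) * g (fst (fst x) + (of_real (snd x))\<^sup>2 * snd (fst x)))"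
  by (rule continuous_on_mult[OF _ continuous_on_chord[OF assms]]) (intro continuous_intros)

lemma continuous_on_moment_slice:
  fixes g :: "'a::real_normed_field \<Rightarrow> 'a"
  assumes "convex V" "continuous_on V g" "v \<in> chords V"
  shows "continuous_on {0..1} (\<lambda>s. of_real s ^ (2 * n) * g (fst v + (of_real s)\<^sup>2 * snd v))"
proof -
  have "continuous_on {0..1} (\<lambda>s. (\<lambda>x. of_real (snd x) ^ (2 * n) *
      g (fst (fst x) + (of_real (snd x))\<^sup>2 * snd (fst x))) (v, s))"
    by (rule continuous_on_compose2[OF continuous_on_moment_integrand[OF assms(1,2)]])
      (use assms(3) in \<open>auto intro: continuous_on_Pair continuous_on_const continuous_on_id\<close>)
  thus ?thesis by simp
qed

lemma continuous_on_moment: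
  fixes g :: "'a::{real_normed_field, banach} \<Rightarrow> 'a"
  assumes "convex V" "continuous_on V g"
  shows "continuous_on (chords V) (moment n g)"
proof -
  have "continuous_on (chords V) (\<lambda>v. integral (cbox 0 1)
      (\<lambda>s. of_real s ^ (2 * n) * g (fst v + (of_real s)\<^sup>2 * snd v)))"
    by (rule integral_continuous_on_param)
      (use continuous_on_moment_integrand[OF assms, of n] in \<open>simp add: case_prod_beta\<close>)
  thus ?thesis
    by (simp add: moment_def[abs_def])
qed

text \<open>
  Differentiation under the integral. Over the complex numbers the derivative is visibly
  complex linear.
\<close>
lemma has_derivative_moment:
  fixes g g' :: "'a::{real_normed_field, banach} \<Rightarrow> 'a"
  assumes V: "open V" "convex V"
    and g: "\<And>p. p \<in> V \<Longrightarrow> (g has_field_derivative g' p) (at p)"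
    and g': "continuous_on V g'"
    and v: "v \<in> chords V"
  shows "(moment n g has_derivative (\<lambda>h. moment n g' v * fst h + moment (Suc n) g' v * snd h)) (at v)"
proof -
  let ?p = "\<lambda>v s. fst v + (of_real s)\<^sup>2 * snd v :: 'a"
  define k where "k = (\<lambda>v s. of_real s ^ (2 * n) * g' (?p v s))"
  define fx where "fx = (\<lambda>v s. (blinfun_mult_right (k v s) o\<^sub>L fst_blinfun)
    + (blinfun_mult_right (k v s * (of_real s)\<^sup>2) o\<^sub>L snd_blinfun) :: ('a \<times> 'a) \<Rightarrow>\<^sub>L 'a)"
  have fx_apply: "blinfun_apply (fx v s) h = k v s * fst h + k v s * (of_real s)\<^sup>2 * snd h" for v s h
    by (simp add: fx_def blinfun.bilinear_simps)
  have cg: "continuous_on V g"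
    by (rule continuous_at_imp_continuous_on) (use g DERIV_isCont in blast)
  have ck: "continuous_on (chords V \<times> cbox 0 1) (\<lambda>x. k (fst x) (snd x))"
    using continuous_on_moment_integrand[OF V(2) g', of n] by (simp add: k_def)
  have cfx: "continuous_on (chords V \<times> cbox 0 1) (\<lambda>(v, s). fx v s)"
    unfolding fx_def case_prod_beta by (intro continuous_intros ck)
  have D: "((\<lambda>v. integral (cbox 0 1) (\<lambda>s. of_real s ^ (2 * n) * g (?p v s)))
      has_derivative integral (cbox 0 1) (fx v)) (at v within chords V)"
  proof (rule leibniz_rule[OF _ _ cfx v convex_chords[OF V(2)]])
    fix v :: "'a \<times> 'a" and s :: real assume v: "v \<in> chords V" and s: "s \<in> cbox 0 1"
    have "?p v s \<in> V" using v s by (intro chord_mem V) auto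
    hence outer: "(g has_derivative (*) (g' (?p v s))) (at (?p v s))"
      using g by (simp add: has_field_derivative_def)
    have "((\<lambda>v. ?p v s) has_derivative (\<lambda>h. fst h + (of_real s)\<^sup>2 * snd h)) (at v)"
      by (intro bounded_linear_imp_has_derivative bounded_linear_add bounded_linear_fst
          bounded_linear_const_mult bounded_linear_snd)
    from has_derivative_compose[OF this outer]
    have "((\<lambda>v. g (?p v s)) has_derivative (\<lambda>h. g' (?p v s) * (fst h + (of_real s)\<^sup>2 * snd h))) (at v)" .
    from has_derivative_mult_right[OF this, of "of_real s ^ (2 * n)"]
    show "((\<lambda>v. of_real s ^ (2 * n) * g (?p v s)) has_derivative blinfun_apply (fx v s))
        (at v within chords V)"
      by (rule has_derivative_at_withinI[OF has_derivative_eq_rhs])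
        (simp add: fun_eq_iff fx_apply k_def algebra_simps)
  next
    fix v :: "'a \<times> 'a" assume "v \<in> chords V"
    from continuous_on_moment_slice[OF V(2) cg this, of n]
    show "(\<lambda>s. of_real s ^ (2 * n) * g (?p v s)) integrable_on cbox 0 1"
      by (simp add: integrable_continuous_real)
  qed
  have A: "blinfun_apply (integral (cbox 0 1) (fx v)) h
      = moment n g' v * fst h + moment (Suc n) g' v * snd h" for h
  proof -
    have "continuous_on {0..1} (\<lambda>s. (\<lambda>(v, s). fx v s) (v, s))"
      by (rule continuous_on_compose2[OF cfx]) (use v in \<open>auto intro: continuous_on_Pair continuous_on_const continuous_on_id\<close>)
    hence "fx v integrable_on cbox 0 1"
      by (simp add: integrable_continuous_real)
    hence "blinfun_apply (integral (cbox 0 1) (fx v)) h = integral (cbox 0 1) (\<lambda>s. fx v s h)"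
      by (rule blinfun_apply_integral)
    also have "\<dots> = integral {0..1} (\<lambda>s. fx v s h)" by simp
    also have "\<dots> = integral {0..1} (\<lambda>s. (of_real s ^ (2 * n) * g' (?p v s)) * fst h
        + (of_real s ^ (2 * Suc n) * g' (?p v s)) * snd h)"
      by (simp add: fx_apply k_def power2_eq_square algebra_simps)
    also have "\<dots> = moment n g' v * fst h + moment (Suc n) g' v * snd h"
      unfolding moment_def
      by (simp only: Henstock_Kurzweil_Integration.integral_add integral_mult_left
          integrable_continuous_real continuous_on_mult_right continuous_on_moment_slice[OF V(2) g' v])
    finally show ?thesis .
  qed
  have M: "moment n g = (\<lambda>v. integral (cbox 0 1) (\<lambda>s. of_real s ^ (2 * n) * g (?p v s)))"
    by (simp add: moment_def fun_eq_iff)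
  from D show ?thesis
    unfolding M at_within_open[OF v open_chords[OF V(1)]]
    by (rule has_derivative_eq_rhs) (rule ext, rule A)
qed

lemma moment_of_real:
  fixes g :: "real \<Rightarrow> real" and G :: "complex \<Rightarrow> complex"
  assumes G: "\<And>p. G (of_real p) = of_real (g p)" and g: "continuous_on UNIV g"
  shows "moment n G (of_real a, of_real e) = of_real (moment n g (a, e))"
proof -
  have "continuous_on {0..1} (\<lambda>s. s ^ (2 * n) * g (a + s\<^sup>2 * e))"
    using continuous_on_moment_slice[OF convex_UNIV g, of "(a, e)" n] by simp
  hence "((\<lambda>s. s ^ (2 * n) * g (a + s\<^sup>2 * e)) has_integral moment n g (a, e)) {0..1}"
    by (simp add: moment_def integrable_integral integrable_continuous_real)
  from has_integral_of_real[OF this, where 'b = complex]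
  have I: "((\<lambda>s. complex_of_real (s ^ (2 * n) * g (a + s\<^sup>2 * e)))
      has_integral complex_of_real (moment n g (a, e))) {0..1}" .
  have eq: "complex_of_real (s ^ (2 * n) * g (a + s\<^sup>2 * e))
      = of_real s ^ (2 * n) * G (of_real a + (of_real s)\<^sup>2 * of_real e)" for s
  proof -
    have "complex_of_real a + (of_real s)\<^sup>2 * of_real e = of_real (a + s\<^sup>2 * e)" by simp
    hence "G (of_real a + (of_real s)\<^sup>2 * of_real e) = of_real (g (a + s\<^sup>2 * e))"
      by (simp only: G)
    thus ?thesis by simp
  qed
  show ?thesis
    using I unfolding moment_def eq fst_conv snd_conv by (rule integral_unique)
qed

section \<open>The gradient map and its holomorphic inverse\<close>

text \<open>
  The derivative of \<open>y\<close> with respect to \<open>x\<close> along an extremal is \<open>slope p\<close> and that of length is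
  \<open>rate p\<close>, where \<open>p = sinh \<psi>\<close>; thus \<open>slope p = tanh \<psi>\<close> and \<open>rate p = 1 / cosh \<psi>\<close>.
\<close>
definition slope :: "real \<Rightarrow> real" where "slope p = p / sqrt (1 + p\<^sup>2)"
definition rate :: "real \<Rightarrow> real" where "rate p = 1 / sqrt (1 + p\<^sup>2)"

definition cslope :: "complex \<Rightarrow> complex" where "cslope p = p / csqrt (1 + p\<^sup>2)"
definition crate :: "complex \<Rightarrow> complex" where "crate p = 1 / csqrt (1 + p\<^sup>2)"

text \<open>
  The largest horizontal strip about the real axis free of the branch points of \<open>csqrt (1 + p\<^sup>2)\<close>.
\<close>
definition strip :: "complex set" where "strip = {p. \<bar>Im p\<bar> < 1}"

lemma one_plus_square_pos [simp]: "0 < 1 + p\<^sup>2" and one_plus_square_nonzero [simp]: "1 + p\<^sup>2 \<noteq> 0"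
  for p :: real
proof -
  show "0 < 1 + p\<^sup>2" by (rule add_pos_nonneg) simp_all
  thus "1 + p\<^sup>2 \<noteq> 0" by simp
qed

lemma rate_pos: "0 < rate p"
  by (simp add: rate_def)

lemma has_derivative_slope: "(slope has_real_derivative rate p ^ 3) (at p)"
proof -
  let ?r = "sqrt (1 + p\<^sup>2)"
  have nn: "\<not> 1 + p\<^sup>2 < 0" using one_plus_square_pos[of p] by linarith
  have s2: "?r * ?r = 1 + p\<^sup>2"
    by simp
  have d: "((\<lambda>p. sqrt (1 + p\<^sup>2)) has_real_derivative (2 * p) / (2 * ?r)) (at p)"
    by (auto intro!: derivative_eq_intros simp: field_simps nn)
  have "(slope has_real_derivative (1 * ?r - p * ((2 * p) / (2 * ?r))) / (?r * ?r)) (at p)"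
    unfolding slope_def[abs_def] by (rule DERIV_divide[OF DERIV_ident d]) simp
  moreover have "(1 * ?r - p * ((2 * p) / (2 * ?r))) / (?r * ?r) = (?r * ?r - p\<^sup>2) / (?r * ?r * ?r)"
    by (simp add: divide_simps power2_eq_square del: real_sqrt_mult_self)
  moreover have "(?r * ?r - p\<^sup>2) / (?r * ?r * ?r) = rate p ^ 3"
    unfolding s2 by (simp add: rate_def power_divide power3_eq_cube)
  ultimately show ?thesis by simp
qed

lemma continuous_rate: "continuous_on A rate"
  unfolding rate_def[abs_def] by (intro continuous_intros) simp

lemma continuous_slope: "continuous_on A slope"
  unfolding slope_def[abs_def] by (intro continuous_intros) simp

lemma strict_mono_slope: "p < q \<Longrightarrow> slope p < slope q"
  by (rule DERIV_pos_imp_increasing) (use has_derivative_slope rate_pos in \<open>auto intro!: exI\<close>)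

lemma open_strip: "open strip" and convex_strip: "convex strip"
proof -
  have *: "strip = {p. Im p < 1} \<inter> {p. Im p > -1}"
    by (auto simp: strip_def)
  show "open strip"
    unfolding * by (intro open_Int open_halfspace_Im_lt open_halfspace_Im_gt)
  show "convex strip"
    unfolding * by (intro convex_Int convex_halfspace_Im_lt convex_halfspace_Im_gt)
qed

lemma of_real_strip [simp]: "of_real p \<in> strip"
  by (simp add: strip_def)

lemma strip_not_nonpos:
  assumes "p \<in> strip"
  shows "1 + p\<^sup>2 \<notin> \<real>\<^sub>\<le>\<^sub>0"
proof
  assume "1 + p\<^sup>2 \<in> \<real>\<^sub>\<le>\<^sub>0"
  hence *: "1 + (Re p)\<^sup>2 - (Im p)\<^sup>2 \<le> 0"
    using zero_le_square[of "Im p"]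
    by (auto simp: complex_nonpos_Reals_iff power2_eq_square)
  have "(Im p)\<^sup>2 < 1"
    using assms by (simp add: strip_def abs_square_less_1)
  thus False
    using * zero_le_power2[of "Re p"] by linarith
qed

lemma csqrt_strip_nz: "p \<in> strip \<Longrightarrow> csqrt (1 + p\<^sup>2) \<noteq> 0"
  using strip_not_nonpos[of p] by auto

lemma has_derivative_cslope:
  assumes "p \<in> strip"
  shows "(cslope has_field_derivative crate p ^ 3) (at p)"
proof -
  let ?r = "csqrt (1 + p\<^sup>2)"
  have nz: "?r \<noteq> 0" by (rule csqrt_strip_nz[OF assms])
  have s2: "?r * ?r = 1 + p\<^sup>2"
    by (metis power2_csqrt power2_eq_square)
  have d: "((\<lambda>p. csqrt (1 + p\<^sup>2)) has_field_derivative (2 * p) / (2 * ?r)) (at p)"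
    by (rule derivative_eq_intros strip_not_nonpos[OF assms] refl | simp)+
  have "(cslope has_field_derivative (1 * ?r - p * ((2 * p) / (2 * ?r))) / (?r * ?r)) (at p)"
    unfolding cslope_def[abs_def] by (rule DERIV_divide[OF DERIV_ident d nz])
  moreover have "(1 * ?r - p * ((2 * p) / (2 * ?r))) / (?r * ?r) = (?r * ?r - p\<^sup>2) / (?r * ?r * ?r)"
    using nz by (simp add: field_simps power2_eq_square)
  moreover have "(?r * ?r - p\<^sup>2) / (?r * ?r * ?r) = crate p ^ 3"
    by (simp add: s2 crate_def power_divide power3_eq_cube)
  ultimately show ?thesis by simp
qed

lemma has_derivative_crate:
  assumes "p \<in> strip"
  shows "(crate has_field_derivative - p * crate p ^ 3) (at p)"
proof -
  let ?r = "csqrt (1 + p\<^sup>2)"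
  have nz: "?r \<noteq> 0" by (rule csqrt_strip_nz[OF assms])
  have d: "((\<lambda>p. csqrt (1 + p\<^sup>2)) has_field_derivative (2 * p) / (2 * ?r)) (at p)"
    by (rule derivative_eq_intros strip_not_nonpos[OF assms] refl | simp)+
  have "(crate has_field_derivative (0 * ?r - 1 * ((2 * p) / (2 * ?r))) / (?r * ?r)) (at p)"
    unfolding crate_def[abs_def] by (rule DERIV_divide[OF DERIV_const d nz])
  moreover have "(0 * ?r - 1 * ((2 * p) / (2 * ?r))) / (?r * ?r) = - p * crate p ^ 3"
    using nz by (simp add: crate_def power_divide field_simps power3_eq_cube)
  ultimately show ?thesis by simp
qed

lemma continuous_crate: "continuous_on strip crate"
  by (rule continuous_at_imp_continuous_on) (use has_derivative_crate DERIV_isCont in blast)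

lemma csqrt_of_real_1_plus: "csqrt (1 + (of_real p)\<^sup>2) = of_real (sqrt (1 + p\<^sup>2))"
  using of_real_sqrt[of "1 + p\<^sup>2"] by (simp add: add_nonneg_nonneg)

lemma cslope_of_real: "cslope (of_real p) = of_real (slope p)"
  by (simp add: cslope_def slope_def csqrt_of_real_1_plus)

lemma crate_of_real: "crate (of_real p) = of_real (rate p)"
  by (simp add: crate_def rate_def csqrt_of_real_1_plus)

text \<open>
  The gradient of the strictly convex function \<open>moment 0 (\<lambda>p. sqrt (1 + p\<^sup>2))\<close>. For an extremal that ends at
  \<open>(x, y, z)\<close> it equals \<open>(y / x, 2 z / x\<^sup>3)\<close>.
\<close>
definition slopes :: "real \<times> real \<Rightarrow> real \<times> real" where
  "slopes v = (moment 0 slope v, moment 1 slope v)"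

definition cslopes :: "complex \<times> complex \<Rightarrow> complex \<times> complex" where
  "cslopes v = (moment 0 cslope v, moment 1 cslope v)"

lemma moment_integrable:
  assumes "continuous_on UNIV g"
  shows "(\<lambda>s. s ^ (2 * n) * g (a + s\<^sup>2 * e)) integrable_on {0..1::real}"
    and "continuous_on {0..1} (\<lambda>s. s ^ (2 * n) * g (a + s\<^sup>2 * e :: real) :: real)"
  using continuous_on_moment_slice[OF convex_UNIV assms, of "(a, e)" n]
  by (simp_all add: integrable_continuous_real)

lemma has_integral_moment:
  assumes "continuous_on UNIV g"
  shows "((\<lambda>s. s ^ (2 * n) * g (a + s\<^sup>2 * e)) has_integral moment n g (a, e)) {0..1::real}"
  using moment_integrable(1)[OF assms, of n a e] by (simp add: moment_def integrable_integral)

text \<open>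
  A strictly monotone map is injective: the pairing of the difference of two values with the
  difference of the arguments is the integral of a continuous nonnegative function, which can
  only vanish identically.
\<close>
lemma inj_slopes: "inj slopes"
proof (rule injI, clarsimp)
  fix a e a' e' assume eq: "slopes (a, e) = slopes (a', e')"
  let ?p = "\<lambda>s. a + s\<^sup>2 * e" and ?q = "\<lambda>s. a' + s\<^sup>2 * e'"
  let ?f = "\<lambda>s. (slope (?p s) - slope (?q s)) * (?p s - ?q s)"
  have cs: "continuous_on UNIV slope" by (rule continuous_slope)
  note m = has_integral_moment[OF cs]
  \<comment> \<open>The difference of the two gradients, paired with the difference of the two arguments.\<close>
  have "((\<lambda>s. (s ^ (2 * 0) * slope (?p s) - s ^ (2 * 0) * slope (?q s)) * (a - a')
      + (s ^ (2 * 1) * slope (?p s) - s ^ (2 * 1) * slope (?q s)) * (e - e'))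
      has_integral (moment 0 slope (a, e) - moment 0 slope (a', e')) * (a - a')
        + (moment 1 slope (a, e) - moment 1 slope (a', e')) * (e - e')) {0..1}"
    by (intro has_integral_add has_integral_diff has_integral_mult_left m)
  moreover have "(s ^ (2 * 0) * slope (?p s) - s ^ (2 * 0) * slope (?q s)) * (a - a')
      + (s ^ (2 * 1) * slope (?p s) - s ^ (2 * 1) * slope (?q s)) * (e - e') = ?f s" for s
    by (simp add: algebra_simps power2_eq_square)
  ultimately have "(?f has_integral 0) {0..1}"
    using eq by (simp add: slopes_def)
  hence "integral {0..1} ?f = 0" by (rule integral_unique)
  moreover have "continuous_on {0..1} ?f"
    by (intro continuous_intros continuous_on_compose2[OF cs]) auto
  moreover have "0 \<le> ?f s" for s
    using strict_mono_slope[of "?p s" "?q s"] strict_mono_slope[of "?q s" "?p s"]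
    by (cases "?p s" "?q s" rule: linorder_cases) (auto simp: mult_nonpos_nonpos)
  ultimately have z: "?f s = 0" if "s \<in> {0..1}" for s
    using integral_eq_0_iff[of 0 1 ?f] that by auto
  have pq: "?p s = ?q s" if "s \<in> {0..1}" for s
    using z[OF that] strict_mono_slope[of "?p s" "?q s"] strict_mono_slope[of "?q s" "?p s"]
    by (cases "?p s" "?q s" rule: linorder_cases) auto
  show "a = a' \<and> e = e'"
    using pq[of 0] pq[of 1] by simp
qed

lemma continuous_slopes: "continuous_on A slopes"
proof -
  have "continuous_on UNIV slopes"
    unfolding slopes_def[abs_def]
    using continuous_on_moment[OF convex_UNIV continuous_slope[of UNIV]]
    by (intro continuous_on_Pair) auto
  thus ?thesis by (rule continuous_on_subset) simp
qed

lemma open_image_slopes: "open N \<Longrightarrow> open (slopes ` N)"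
  by (intro invariance_of_domain continuous_slopes inj_on_subset[OF inj_slopes]) auto

text \<open>
  The Jacobian determinant of \<open>slopes\<close> is of this form, with \<open>g\<close> the derivative of \<open>slope\<close>.
  The determinant is positive by the strict Cauchy-Schwarz inequality.
\<close>
lemma moment_hankel_pos:
  fixes g :: "real \<Rightarrow> real"
  assumes g: "continuous_on UNIV g" "\<And>p. 0 < g p"
  shows "0 < moment 0 g v * moment 2 g v - (moment 1 g v)\<^sup>2"
proof -
  obtain a e where v: "v = (a, e)" by (cases v)
  let ?g = "\<lambda>s. g (a + s\<^sup>2 * e)"
  let ?m = "\<lambda>n. moment n g v"
  note m = has_integral_moment[OF g(1), of _ a e, folded v]
  have cg: "continuous_on {0..1} ?g"
    using moment_integrable(2)[OF g(1), of 0 a e] by simp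
  have pos: "0 < integral {0..1} f"
    if "continuous_on {0..1} f" "\<And>s. s \<in> {0..1} \<Longrightarrow> 0 \<le> f s" "t \<in> {0..1}" "f t \<noteq> 0" for f :: "real \<Rightarrow> real" and t
    using integral_eq_0_iff[of 0 1 f] integral_nonneg[of f "{0..1}"] that integrable_continuous_real
    by (metis less_eq_real_def zero_less_one)
  have "0 < integral {0..1} ?g"
    by (rule pos[OF cg, of 0]) (use g(2) in \<open>auto intro: less_imp_le simp: less_imp_neq[symmetric]\<close>)
  hence m0: "0 < ?m 0" using m[of 0] by (simp add: integral_unique)
  \<comment> \<open>the mean of \<open>s\<^sup>2\<close>; the determinant is \<open>(moment 0 g v)\<^sup>2\<close> times its variance\<close>
  define \<mu> where "\<mu> = ?m 1 / ?m 0"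
  have "((\<lambda>s. s ^ (2 * 2) * ?g s - 2 * \<mu> * (s ^ (2 * 1) * ?g s) + \<mu>\<^sup>2 * (s ^ (2 * 0) * ?g s)) has_integral
      ?m 2 - 2 * \<mu> * ?m 1 + \<mu>\<^sup>2 * ?m 0) {0..1}"
    by (intro has_integral_add has_integral_diff has_integral_mult_right m)
  moreover have "s ^ (2 * 2) * ?g s - 2 * \<mu> * (s ^ (2 * 1) * ?g s) + \<mu>\<^sup>2 * (s ^ (2 * 0) * ?g s)
      = ?g s * (s\<^sup>2 - \<mu>)\<^sup>2" for s
    by (simp add: power2_eq_square algebra_simps eval_nat_numeral)
  ultimately have I: "((\<lambda>s. ?g s * (s\<^sup>2 - \<mu>)\<^sup>2) has_integral ?m 2 - 2 * \<mu> * ?m 1 + \<mu>\<^sup>2 * ?m 0) {0..1}"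
    by simp
  obtain t where t: "t \<in> {0..1}" "t\<^sup>2 \<noteq> \<mu>"
  proof (cases "\<mu> = 0")
    case True thus ?thesis using that[of 1] by simp
  next
    case False thus ?thesis using that[of 0] by simp
  qed
  have "0 < integral {0..1} (\<lambda>s. ?g s * (s\<^sup>2 - \<mu>)\<^sup>2)"
    by (rule pos[OF _ _ t(1)])
      (use cg g(2) t(2) in \<open>auto intro!: continuous_intros mult_nonneg_nonneg intro: less_imp_le simp: less_imp_neq[symmetric]\<close>)
  hence "0 < ?m 2 - 2 * \<mu> * ?m 1 + \<mu>\<^sup>2 * ?m 0"
    using I by (simp add: integral_unique)
  hence "0 < (?m 2 - 2 * \<mu> * ?m 1 + \<mu>\<^sup>2 * ?m 0) * ?m 0"
    using m0 by simp
  also have "\<dots> = ?m 0 * ?m 2 - (?m 1)\<^sup>2"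
    using m0 by (simp add: \<mu>_def field_simps power2_eq_square)
  finally show ?thesis .
qed

text \<open>
  The inverse function theorem treats \<open>cslopes\<close> as a real map; this lemma brings back complex
  linearity for the derivative of the inverse.
\<close>
lemma linear_inverse_of_complex_linear:
  fixes L :: "complex \<times> complex \<Rightarrow> complex \<times> complex"
  assumes L: "\<And>h. L h = (A * fst h + B * snd h, C * fst h + D * snd h)" and bij: "bij L"
  obtains A' B' C' D' where "inv L = (\<lambda>h. (A' * fst h + B' * snd h, C' * fst h + D' * snd h))"
proof -
  obtain p q where p: "L p = (1, 0)" and q: "L q = (0, 1)"
    using bij by (metis bij_pointE)
  have "L (fst p * fst h + fst q * snd h, snd p * fst h + snd q * snd h) = h" for h
  proof -
    have "A * fst p + B * snd p = 1" "C * fst p + D * snd p = 0"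
      "A * fst q + B * snd q = 0" "C * fst q + D * snd q = 1"
      using p q by (simp_all add: L)
    moreover have "L (fst p * fst h + fst q * snd h, snd p * fst h + snd q * snd h)
      = ((A * fst p + B * snd p) * fst h + (A * fst q + B * snd q) * snd h,
         (C * fst p + D * snd p) * fst h + (C * fst q + D * snd q) * snd h)"
      by (simp add: L algebra_simps)
    ultimately show ?thesis by simp
  qed
  hence "inv L h = (fst p * fst h + fst q * snd h, snd p * fst h + snd q * snd h)" for h
    using bij by (metis bij_inv_eq_iff)
  thus ?thesis by (intro that[of "fst p" "fst q" "snd p" "snd q"] ext)
qed

text \<open>
  The inverse of \<open>slopes\<close> is analytic: near each value it extends to a holomorphic map, namely the local
  inverse of the complexified map.
\<close>
lemma cslopes_local_inverse:
  obtains V G where "open V" "(of_real (fst (slopes v)), of_real (snd (slopes v))) \<in> V"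
    "\<And>y. y \<in> V \<Longrightarrow> G y \<in> chords strip"
    "\<And>y. y \<in> V \<Longrightarrow> \<exists>A B C D. (G has_derivative
        (\<lambda>h. (A * fst h + B * snd h, C * fst h + D * snd h))) (at y)"
    "\<And>y1 y2. (of_real y1, of_real y2) \<in> V \<Longrightarrow>
        \<exists>a e. slopes (a, e) = (y1, y2) \<and> G (of_real y1, of_real y2) = (of_real a, of_real e)"
proof -
  let ?W = "chords strip"
  define q where "q = (\<lambda>p. crate p ^ 3)"
  define m where "m = (\<lambda>n. moment n q)"
  define x0 :: "complex \<times> complex" where "x0 = (of_real (fst v), of_real (snd v))"
  have x0: "x0 \<in> ?W"
    by (simp add: x0_def chords_def flip: of_real_add)
  have oW: "open ?W" by (rule open_chords[OF open_strip])
  have cq: "continuous_on strip q"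
    unfolding q_def by (intro continuous_intros continuous_crate)
  have cm: "continuous_on ?W (m n)" for n
    unfolding m_def by (rule continuous_on_moment[OF convex_strip cq])
  define L where "L = (\<lambda>x h. (m 0 x * fst h + m 1 x * snd h, m 1 x * fst h + m 2 x * snd h))"
  have bl: "bounded_linear (L x)" for x
    unfolding L_def
    by (intro bounded_linear_Pair bounded_linear_add bounded_linear_const_mult
        bounded_linear_fst bounded_linear_snd)
  define f' where "f' = (\<lambda>x. Blinfun (L x))"
  have f'_apply: "blinfun_apply (f' x) = L x" for x
    unfolding f'_def by (rule bounded_linear_Blinfun_apply[OF bl])
  have der: "(cslopes has_derivative blinfun_apply (f' x)) (at x)" if x: "x \<in> ?W" for x
  proof -
    have "(moment n cslope has_derivative (\<lambda>h. m n x * fst h + m (Suc n) x * snd h)) (at x)" for n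
      unfolding m_def
      by (rule has_derivative_moment[OF open_strip convex_strip _ cq x])
        (simp add: q_def has_derivative_cslope)
    from has_derivative_Pair[OF this[of 0] this[of 1]] show ?thesis
      by (simp add: f'_apply L_def cslopes_def[abs_def] numeral_2_eq_2)
  qed
  have cf': "continuous_on ?W f'"
    by (rule continuous_on_blinfun_componentwise)
      (unfold f'_apply L_def, intro continuous_on_Pair continuous_on_add continuous_on_mult_right cm)
  have q_real: "q (of_real p) = of_real (rate p ^ 3)" for p
    by (simp add: q_def crate_of_real)
  have crate3: "continuous_on UNIV (\<lambda>p. rate p ^ 3)"
    by (intro continuous_intros continuous_rate)
  have m_real: "m n x0 = of_real (moment n (\<lambda>p. rate p ^ 3) v)" for n
    using moment_of_real[OF q_real crate3, of n "fst v" "snd v"] by (simp add: m_def x0_def)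
  define \<Delta> where "\<Delta> = m 0 x0 * m 2 x0 - (m 1 x0)\<^sup>2"
  have \<Delta>: "\<Delta> \<noteq> 0"
    using moment_hankel_pos[OF crate3, of v] rate_pos
    by (simp add: \<Delta>_def m_real flip: of_real_mult of_real_power of_real_diff)
  \<comment> \<open>Cramer's rule\<close>
  define R where "R = (\<lambda>h. (inverse \<Delta> * (m 2 x0 * fst h - m 1 x0 * snd h), inverse \<Delta> * (m 0 x0 * snd h - m 1 x0 * fst h)))"
  have blR: "bounded_linear R"
    unfolding R_def
    by (intro bounded_linear_Pair bounded_linear_sub
        bounded_linear_const_mult bounded_linear_fst bounded_linear_snd)
  have RL: "R (L x0 h) = h" for h
  proof -
    have "m 2 x0 * (m 0 x0 * fst h + m 1 x0 * snd h) - m 1 x0 * (m 1 x0 * fst h + m 2 x0 * snd h)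
        = fst h * \<Delta>"
      by (simp add: \<Delta>_def algebra_simps power2_eq_square)
    moreover have "m 0 x0 * (m 1 x0 * fst h + m 2 x0 * snd h) - m 1 x0 * (m 0 x0 * fst h + m 1 x0 * snd h)
        = snd h * \<Delta>"
      by (simp add: \<Delta>_def algebra_simps power2_eq_square)
    ultimately show ?thesis
      using \<Delta> by (simp only: R_def L_def fst_conv snd_conv) (simp add: prod_eq_iff field_simps)
  qed
  have inv: "Blinfun R o\<^sub>L f' x0 = id_blinfun"
    by (rule blinfun_eqI) (simp add: f'_apply bounded_linear_Blinfun_apply[OF blR] RL)
  have "\<exists>U' V G G'. open U' \<and> U' \<subseteq> ?W \<and> x0 \<in> U' \<and> open V \<and> cslopes x0 \<in> V
      \<and> homeomorphism U' V cslopes G \<and> (\<forall>y\<in>V. (G has_derivative (G' y)) (at y))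
      \<and> (\<forall>y\<in>V. G' y = Hilbert_Choice.inv (blinfun_apply (f' (G y))))
      \<and> (\<forall>y\<in>V. bij (blinfun_apply (f' (G y))))"
    by (rule inverse_function_theorem[OF oW _ cf' x0 inv, where f = cslopes]) (use der in blast)+
  then obtain U' V G G' where U': "open U'" "U' \<subseteq> ?W" "x0 \<in> U'" and V: "open V" "cslopes x0 \<in> V"
    and hom: "homeomorphism U' V cslopes G"
    and dG: "\<And>y. y \<in> V \<Longrightarrow> (G has_derivative (G' y)) (at y)"
    and G': "\<And>y. y \<in> V \<Longrightarrow> G' y = Hilbert_Choice.inv (blinfun_apply (f' (G y)))"
    and bij: "\<And>y. y \<in> V \<Longrightarrow> bij (blinfun_apply (f' (G y)))"
    by blast
  have cslopes_real: "cslopes (of_real a, of_real e)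
      = (of_real (fst (slopes (a, e))), of_real (snd (slopes (a, e))))" for a e
    by (simp add: cslopes_def slopes_def moment_of_real cslope_of_real continuous_slope)
  let ?c = "\<lambda>u :: real \<times> real. (complex_of_real (fst u), complex_of_real (snd u))"
  \<comment> \<open>By invariance of domain the real points near \<open>slopes v\<close> are images of real parameters near \<open>v\<close>,
    so after shrinking \<open>V\<close> the complex inverse takes real values at real points.\<close>
  have oN: "open (?c -` U')"
    by (intro open_vimage U' continuous_intros)
  define O' where "O' = slopes ` (?c -` U')"
  have "open O'" "slopes v \<in> O'"
    unfolding O'_def using open_image_slopes[OF oN] U'(3) by (auto simp: x0_def)
  then obtain \<epsilon> where \<epsilon>: "\<epsilon> > 0" "ball (slopes v) \<epsilon> \<subseteq> O'"
    using open_contains_ball by blast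
  define V' where "V' = V \<inter> ball (?c (slopes v)) \<epsilon>"
  show ?thesis
  proof (rule that[of V' G])
    show "open V'" unfolding V'_def using V by auto
    show "?c (slopes v) \<in> V'"
      using V \<epsilon> cslopes_real[of "fst v" "snd v"] by (simp add: V'_def x0_def)
    fix y assume "y \<in> V'"
    hence y: "y \<in> V" by (simp add: V'_def)
    show "G y \<in> ?W"
      using hom y U' unfolding homeomorphism_def by blast
    obtain A B C D where "Hilbert_Choice.inv (L (G y)) = (\<lambda>h. (A * fst h + B * snd h, C * fst h + D * snd h))"
      by (rule linear_inverse_of_complex_linear[of "L (G y)" "m 0 (G y)" "m 1 (G y)" "m 1 (G y)" "m 2 (G y)"])
        (use bij[OF y] in \<open>simp_all add: f'_apply L_def\<close>)
    hence "G' y = (\<lambda>h. (A * fst h + B * snd h, C * fst h + D * snd h))"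
      by (simp only: G'[OF y] f'_apply)
    thus "\<exists>A B C D. (G has_derivative (\<lambda>h. (A * fst h + B * snd h, C * fst h + D * snd h))) (at y)"
      using dG[OF y] by (intro exI) simp
  next
    fix y1 y2 assume y: "(complex_of_real y1, complex_of_real y2) \<in> V'"
    have "dist (slopes v) (y1, y2) = dist (?c (slopes v)) (?c (y1, y2))"
      by (cases "slopes v") (simp add: dist_Pair_Pair dist_of_real)
    hence "(y1, y2) \<in> O'"
      using y \<epsilon> by (auto simp: V'_def)
    then obtain a e where ae: "slopes (a, e) = (y1, y2)" "?c (a, e) \<in> U'"
      by (auto simp: O'_def)
    have "G (cslopes (?c (a, e))) = ?c (a, e)"
      using hom ae(2) unfolding homeomorphism_def by blast
    thus "\<exists>a e. slopes (a, e) = (y1, y2) \<and> G (of_real y1, of_real y2) = (of_real a, of_real e)"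
      using ae cslopes_real[of a e] by auto
  qed
qed

section \<open>Bounds on lengths by Lagrange multipliers\<close>

lemma ex_antiderivative:
  fixes f :: "real \<Rightarrow> real"
  assumes "continuous_on UNIV f"
  obtains F where "\<And>x. (F has_real_derivative f x) (at x)" "F 0 = 0"
proof -
  have "\<exists>F. \<forall>x::real. -\<infinity> < ereal x \<longrightarrow> ereal x < \<infinity> \<longrightarrow> (F has_vector_derivative f x) (at x)"
    by (rule einterval_antiderivative) (use assms in \<open>auto simp: continuous_on_eq_continuous_at\<close>)
  then obtain F where "\<And>x. (F has_real_derivative f x) (at x)"
    by (auto simp: has_real_derivative_iff_has_vector_derivative)
  hence "((\<lambda>x. F x - F 0) has_real_derivative f x) (at x)" for x
    using DERIV_diff[of F "f x" x UNIV "\<lambda>_. F 0" 0] by simp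
  thus ?thesis by (rule that) simp
qed

text \<open>
  The integral of \<open>s ^ (2 * n) * g (a + b * s\<^sup>2)\<close> from 0 to \<open>X\<close>, rescaled to the unit interval. This form makes
  visible how extremals with the same \<open>b * X\<^sup>2\<close> are dilations of each other.
\<close>
definition primitive :: "nat \<Rightarrow> (real \<Rightarrow> real) \<Rightarrow> real \<Rightarrow> real \<Rightarrow> real \<Rightarrow> real" where
  "primitive n g a b X = X ^ (2 * n + 1) * moment n g (a, b * X\<^sup>2)"

lemma has_derivative_primitive:
  assumes g: "continuous_on UNIV g"
  shows "(primitive n g a b has_real_derivative X ^ (2 * n) * g (a + b * X\<^sup>2)) (at X)"
proof -
  let ?f = "\<lambda>s. s ^ (2 * n) * g (a + b * s\<^sup>2)"
  have "continuous_on UNIV ?f"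
    by (intro continuous_intros continuous_on_compose2[OF g]) auto
  from ex_antiderivative[OF this]
  obtain F where F: "\<And>x. (F has_real_derivative ?f x) (at x)" "F 0 = 0"
    by blast
  have "F X = primitive n g a b X" for X
  proof -
    have "((\<lambda>s. F (X * s)) has_real_derivative ?f (X * s) * X) (at s within {0..1})" for s
      by (rule has_field_derivative_at_within, rule DERIV_chain2[OF F(1)])
        (auto intro!: derivative_eq_intros)
    hence "((\<lambda>s. ?f (X * s) * X) has_integral F (X * 1) - F (X * 0)) {0..1}"
      by (intro fundamental_theorem_of_calculus)
        (simp_all add: has_real_derivative_iff_has_vector_derivative)
    moreover have "?f (X * s) * X = X ^ (2 * n + 1) * (s ^ (2 * n) * g (a + s\<^sup>2 * (b * X\<^sup>2)))" for s
      by (simp add: power_mult_distrib algebra_simps)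
    ultimately have 1: "((\<lambda>s. X ^ (2 * n + 1) * (s ^ (2 * n) * g (a + s\<^sup>2 * (b * X\<^sup>2)))) has_integral F X) {0..1}"
      by (simp add: F(2))
    have 2: "((\<lambda>s. X ^ (2 * n + 1) * (s ^ (2 * n) * g (a + s\<^sup>2 * (b * X\<^sup>2)))) has_integral primitive n g a b X) {0..1}"
      unfolding primitive_def by (intro has_integral_mult_right has_integral_moment g)
    show ?thesis
      by (rule has_integral_unique[OF 1 2])
  qed
  hence "F = primitive n g a b" by (rule ext)
  thus ?thesis using F(1) by simp
qed

lemma primitive_0 [simp]: "primitive n g a b 0 = 0"
  by (simp add: primitive_def)

lemma continuous_primitive:
  assumes "continuous_on UNIV g"
  shows "continuous_on A (primitive n g a b)"
  by (rule continuous_at_imp_continuous_on) (use has_derivative_primitive[OF assms] DERIV_isCont in blast)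

text \<open>
  The fundamental theorem of calculus for Lipschitz functions, by dominated convergence of the
  difference quotients.
\<close>
lemma integral_lipschitz_derivative:
  fixes f f' :: "real \<Rightarrow> real"
  assumes ab: "a \<le> b" and lip: "L-lipschitz_on {a..b} f"
    and meas: "f' \<in> borel_measurable (lebesgue_on {a..b})"
    and der: "AE t in lebesgue_on {a..b}. (f has_real_derivative f' t) (at t within {a..b})"
  shows "(LINT t|lebesgue_on {a..b}. f' t) = f b - f a"
proof -
  let ?M = "lebesgue_on {a..b}"
  \<comment> \<open>The constant extension of \<open>f\<close> keeps the difference quotients defined up to \<open>b\<close>.\<close>
  define F where "F = (\<lambda>t. f (max a (min t b)))"
  have clamp: "max a (min t b) \<in> {a..b}" for t using ab by auto
  have lipF: "\<bar>F s - F t\<bar> \<le> L * \<bar>s - t\<bar>" for s t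
  proof -
    have "\<bar>F s - F t\<bar> \<le> L * \<bar>max a (min s b) - max a (min t b)\<bar>"
      using lipschitz_onD[OF lip clamp clamp, of s t] by (simp add: F_def dist_real_def)
    also have "\<dots> \<le> L * \<bar>s - t\<bar>"
      by (rule mult_left_mono) (use lipschitz_on_nonneg[OF lip] in auto)
    finally show ?thesis .
  qed
  have "L-lipschitz_on UNIV F"
    by (rule lipschitz_onI) (use lipF lipschitz_on_nonneg[OF lip] in \<open>simp_all add: dist_real_def\<close>)
  hence contF: "continuous_on A F" for A
    by (rule continuous_on_subset[OF lipschitz_on_continuous_on]) simp
  obtain Q where Q: "\<And>x. (Q has_real_derivative F x) (at x)"
    using ex_antiderivative[OF contF] by blast
  define h where "h = (\<lambda>n. inverse (real (Suc n)))"
  have h: "0 < h n" for n by (simp add: h_def)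
  have h0: "h \<longlonglongrightarrow> 0" unfolding h_def by (rule LIMSEQ_inverse_real_of_nat)
  define s where "s = (\<lambda>n t. (F (t + h n) - F t) / h n)"
  have cs: "continuous_on A (s n)" for n A
    unfolding s_def using h[of n]
    by (intro continuous_on_divide continuous_on_diff continuous_on_compose2[OF contF[of UNIV]]
        continuous_on_add continuous_on_id continuous_on_const) auto
  have quot: "(\<lambda>n. (Q (x + h n) - Q x) / h n) \<longlonglongrightarrow> F x" for x
  proof -
    have "filterlim h (at 0) sequentially"
      using h0 h by (simp add: filterlim_at less_imp_neq[symmetric])
    with Q[of x, unfolded DERIV_def] show ?thesis
      by (rule filterlim_compose)
  qed
  \<comment> \<open>The integral of a difference quotient telescopes to difference quotients of a primitive \<open>Q\<close> of
    \<open>F\<close> at the two ends.\<close>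
  have int_s: "(LINT t|?M. s n t) = (Q (b + h n) - Q b) / h n - (Q (a + h n) - Q a) / h n" for n
  proof -
    have "((\<lambda>t. (Q (t + h n) - Q t) / h n) has_real_derivative s n t) (at t)" for t
      unfolding s_def using Q[of t] Q[of "t + h n"]
      by (intro DERIV_cdivide DERIV_diff) (simp_all add: DERIV_shift)
    hence "(s n has_integral (Q (b + h n) - Q b) / h n - (Q (a + h n) - Q a) / h n) {a..b}"
      by (intro fundamental_theorem_of_calculus[OF ab])
        (simp add: has_real_derivative_iff_has_vector_derivative has_vector_derivative_at_within)
    moreover have "integrable ?M (s n)"
      by (rule continuous_imp_integrable_real[OF cs])
    ultimately show ?thesis
      by (simp add: lebesgue_integral_eq_integral integral_unique)
  qed
  have "(\<lambda>n. LINT t|?M. s n t) \<longlonglongrightarrow> (LINT t|?M. f' t)"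
  proof (rule integral_dominated_convergence[where w = "\<lambda>_. L"])
    show "s n \<in> borel_measurable ?M" for n
      by (rule continuous_imp_measurable_on_sets_lebesgue[OF cs]) simp
    show "integrable ?M (\<lambda>_. L)"
      by (rule continuous_imp_integrable_real) (rule continuous_on_const)
    show "AE t in ?M. norm (s n t) \<le> L" for n
    proof (rule AE_I2)
      fix t
      have "\<bar>F (t + h n) - F t\<bar> \<le> L * h n"
        using lipF[of "t + h n" t] h[of n] by simp
      thus "norm (s n t) \<le> L"
        using h[of n] by (simp add: s_def abs_divide divide_le_eq)
    qed
    have "AE t in ?M. t \<noteq> b"
    proof -
      have "AE t in lebesgue. t \<noteq> b"
        by (intro AE_I'[of "{b}"]) (auto simp: null_sets_def)
      thus ?thesis
        by (simp add: AE_restrict_space_iff) (auto elim: eventually_mono)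
    qed
    moreover have "AE t in ?M. t \<in> {a..b}"
      by (rule AE_I2) simp
    ultimately show "AE t in ?M. (\<lambda>n. s n t) \<longlonglongrightarrow> f' t"
      using der
    proof eventually_elim
      case (elim t)
      have ev: "eventually (\<lambda>n. t + h n \<in> {a..b}) sequentially"
      proof -
        have "eventually (\<lambda>n. h n < b - t) sequentially"
          using h0 elim by (intro order_tendstoD(2)) auto
        thus ?thesis
          by eventually_elim (use elim h in \<open>auto intro: add_nonneg_nonneg less_imp_le simp: add_increasing2 less_imp_le\<close>)
      qed
      have "filterlim (\<lambda>n. t + h n) (at t within {a..b}) sequentially"
        unfolding filterlim_at
      proof
        show "\<forall>\<^sub>F n in sequentially. t + h n \<in> {a..b} \<and> t + h n \<noteq> t"
          using ev by eventually_elim (use h in \<open>simp add: less_imp_neq[symmetric]\<close>)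
        show "(\<lambda>n. t + h n) \<longlonglongrightarrow> t"
          using tendsto_add[OF tendsto_const h0, of t] by simp
      qed
      with elim(3)[unfolded has_field_derivative_iff]
      have "(\<lambda>n. (f (t + h n) - f t) / (t + h n - t)) \<longlonglongrightarrow> f' t"
        by (rule filterlim_compose)
      moreover have "eventually (\<lambda>n. (f (t + h n) - f t) / (t + h n - t) = s n t) sequentially"
        using ev by eventually_elim (use elim in \<open>simp add: s_def F_def\<close>)
      ultimately show ?case
        by (rule Lim_transform_eventually)
    qed
  qed (rule meas)
  moreover have "(\<lambda>n. LINT t|?M. s n t) \<longlonglongrightarrow> F b - F a"
    unfolding int_s by (intro tendsto_diff quot)
  moreover have "F b - F a = f b - f a"
    using ab by (simp add: F_def)
  ultimately show ?thesis
    using LIMSEQ_unique by metis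
qed

text \<open>
  \<open>cosh \<psi>\<close> as a function of \<open>p = sinh \<psi>\<close>. It is a primitive of \<open>slope\<close>, and the Legendre transform of
  \<open>- sqrt (1 - w\<^sup>2)\<close>, the negative of the integrand of the length.
\<close>
definition hyp :: "real \<Rightarrow> real" where "hyp p = sqrt (1 + p\<^sup>2)"

lemma hyp_pos: "0 < hyp p"
  by (simp add: hyp_def)

lemma hyp_eq: "hyp p = rate p + p * slope p"
proof -
  have "hyp p * hyp p = 1 + p * p"
    by (simp add: hyp_def power2_eq_square[symmetric])
  thus ?thesis
    using hyp_pos[of p] by (simp add: rate_def slope_def hyp_def[symmetric] field_simps)
qed

lemma continuous_hyp: "continuous_on A hyp"
  unfolding hyp_def[abs_def] by (intro continuous_intros)

lemma has_derivative_hyp: "(hyp has_real_derivative slope p) (at p)"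
proof -
  have nn: "\<not> 1 + p\<^sup>2 < 0" using one_plus_square_pos[of p] by linarith
  show ?thesis
    unfolding hyp_def[abs_def] slope_def
    by (auto intro!: derivative_eq_intros simp: field_simps nn)
qed

lemma slope_sq: "1 - (slope p)\<^sup>2 = (rate p)\<^sup>2"
  by (simp add: slope_def rate_def power_divide field_simps)

lemma abs_slope_less: "\<bar>slope p\<bar> < 1"
proof -
  have "(slope p)\<^sup>2 < 1"
    using slope_sq[of p] rate_pos[of p] by (smt (verit) zero_less_power)
  thus ?thesis by (simp add: abs_square_less_1)
qed

text \<open>
  The Fenchel-Young inequality behind the bound on lengths, in a form that is homogeneous in the
  control, so that the parametrisation of the curve does not matter.
\<close>
lemma pairing_le_hyp:
  assumes "\<bar>u2\<bar> \<le> u1"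
  shows "sqrt (u1\<^sup>2 - u2\<^sup>2) + p * u2 \<le> hyp p * u1"
proof -
  define r where "r = sqrt (u1\<^sup>2 - u2\<^sup>2)"
  have "u2\<^sup>2 \<le> u1\<^sup>2"
    using power_mono[OF assms, of 2] by simp
  hence r2: "r\<^sup>2 = u1\<^sup>2 - u2\<^sup>2"
    by (simp add: r_def)
  \<comment> \<open>Lagrange's identity, that is, Cauchy-Schwarz for \<open>(1, p)\<close> and \<open>(r, u2)\<close>\<close>
  have "(r + p * u2)\<^sup>2 + (u2 - p * r)\<^sup>2 = (1 + p\<^sup>2) * (r\<^sup>2 + u2\<^sup>2)"
    by (simp add: power2_eq_square algebra_simps)
  moreover have "r\<^sup>2 + u2\<^sup>2 = u1\<^sup>2"
    using r2 by simp
  ultimately have "(r + p * u2)\<^sup>2 \<le> (1 + p\<^sup>2) * u1\<^sup>2"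
    using zero_le_power2[of "u2 - p * r"] by (simp only:)
  hence "r + p * u2 \<le> sqrt ((1 + p\<^sup>2) * u1\<^sup>2)"
    by (rule real_le_rsqrt)
  also have "\<dots> = hyp p * u1"
    using assms by (simp add: real_sqrt_mult hyp_def)
  finally show ?thesis by (simp add: r_def)
qed

lemma primitive_hyp: "primitive 0 hyp a b X = primitive 0 rate a b X + a * primitive 0 slope a b X + b * primitive 1 slope a b X"
proof -
  let ?e = "b * X\<^sup>2"
  note r = has_integral_moment[OF continuous_rate[of UNIV], of _ a ?e]
    and s = has_integral_moment[OF continuous_slope[of UNIV], of _ a ?e]
    and h = has_integral_moment[OF continuous_hyp[of UNIV], of 0 a ?e]
  have "((\<lambda>s. s ^ (2 * 0) * rate (a + s\<^sup>2 * ?e) + a * (s ^ (2 * 0) * slope (a + s\<^sup>2 * ?e))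
      + ?e * (s ^ (2 * 1) * slope (a + s\<^sup>2 * ?e))) has_integral
      moment 0 rate (a, ?e) + a * moment 0 slope (a, ?e) + ?e * moment 1 slope (a, ?e)) {0..1}"
    by (intro has_integral_add has_integral_mult_right r s)
  moreover have "s ^ (2 * 0) * rate (a + s\<^sup>2 * ?e) + a * (s ^ (2 * 0) * slope (a + s\<^sup>2 * ?e))
      + ?e * (s ^ (2 * 1) * slope (a + s\<^sup>2 * ?e)) = s ^ (2 * 0) * hyp (a + s\<^sup>2 * ?e)" for s
    by (simp add: hyp_eq algebra_simps, simp add: power2_eq_square)
  ultimately have "moment 0 hyp (a, ?e)
      = moment 0 rate (a, ?e) + a * moment 0 slope (a, ?e) + ?e * moment 1 slope (a, ?e)"
    using h has_integral_unique by (simp only:) blast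
  thus ?thesis
    by (simp add: primitive_def algebra_simps power2_eq_square eval_nat_numeral)
qed

lemma integrable_bounded_measurable_interval:
  fixes f :: "real \<Rightarrow> real"
  assumes "f \<in> borel_measurable (lebesgue_on {a..b})" "\<And>t. t \<in> {a..b} \<Longrightarrow> \<bar>f t\<bar> \<le> B"
  shows "integrable (lebesgue_on {a..b}) f"
  by (rule measurable_bounded_by_integrable_imp_lebesgue_integrable[where g = "\<lambda>_. B"])
    (use assms in \<open>auto intro!: continuous_imp_integrable_real\<close>)

lemma borel_measurable_components:
  assumes "u \<in> borel_measurable M"
  shows "(\<lambda>t. fst (u t) :: real) \<in> borel_measurable M" "(\<lambda>t. snd (u t) :: real) \<in> borel_measurable M"
proof -
  have "fst \<in> borel_measurable (borel :: (real \<times> real) measure)"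
    "snd \<in> borel_measurable (borel :: (real \<times> real) measure)"
    by (auto intro!: borel_measurable_continuous_onI continuous_on_fst continuous_on_snd continuous_on_id)
  from this[THEN measurable_compose[OF assms]] show "(\<lambda>t. fst (u t)) \<in> borel_measurable M" "(\<lambda>t. snd (u t)) \<in> borel_measurable M"
    by simp_all
qed

lemma admissible_components:
  assumes adm: "admissible T q u"
  defines "x \<equiv> \<lambda>t. fst (q t)" and "y \<equiv> \<lambda>t. fst (snd (q t))" and "z \<equiv> \<lambda>t. snd (snd (q t))"
  obtains L where "L-lipschitz_on {0..T} x" "L-lipschitz_on {0..T} y" "L-lipschitz_on {0..T} z"
    "AE t in lebesgue_on {0..T}. (x has_real_derivative fst (u t)) (at t within {0..T}) \<and>
       (y has_real_derivative snd (u t)) (at t within {0..T}) \<and>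
       (z has_real_derivative (x t)\<^sup>2 / 2 * snd (u t)) (at t within {0..T})"
proof -
  obtain L where L: "L-lipschitz_on {0..T} q"
    using adm by (auto simp: admissible_def)
  have 1: "dist (fst p) (fst p') \<le> dist p p'" "dist (fst (snd p)) (fst (snd p')) \<le> dist p p'"
    "dist (snd (snd p)) (snd (snd p')) \<le> dist p p'" for p p' :: point
    by (rule dist_fst_le order_trans[OF dist_fst_le dist_snd_le] order_trans[OF dist_snd_le dist_snd_le])+
  have "L-lipschitz_on {0..T} x" "L-lipschitz_on {0..T} y" "L-lipschitz_on {0..T} z"
    unfolding x_def y_def z_def
    by (rule lipschitz_onI, rule order_trans[OF 1(1) lipschitz_onD[OF L]], assumption+, rule lipschitz_on_nonneg[OF L],
        rule lipschitz_onI, rule order_trans[OF 1(2) lipschitz_onD[OF L]], assumption+, rule lipschitz_on_nonneg[OF L],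
        rule lipschitz_onI, rule order_trans[OF 1(3) lipschitz_onD[OF L]], assumption+, rule lipschitz_on_nonneg[OF L])
  moreover have "AE t in lebesgue_on {0..T}. (x has_real_derivative fst (u t)) (at t within {0..T}) \<and>
       (y has_real_derivative snd (u t)) (at t within {0..T}) \<and>
       (z has_real_derivative (x t)\<^sup>2 / 2 * snd (u t)) (at t within {0..T})"
  proof -
    have "AE t in lebesgue_on {0..T}. (q has_vector_derivative
        fst (u t) *\<^sub>R X1 (q t) + snd (u t) *\<^sub>R X2 (q t)) (at t within {0..T})"
      using adm by (auto simp: admissible_def)
    thus ?thesis
    proof eventually_elim
      case (elim t)
      have v: "fst (u t) *\<^sub>R X1 (q t) + snd (u t) *\<^sub>R X2 (q t)
          = (fst (u t), snd (u t), (x t)\<^sup>2 / 2 * snd (u t))"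
        by (cases "q t") (simp add: X1_def X2_def x_def)
      note D = elim[unfolded v]
      note D1 = bounded_linear.has_vector_derivative[OF bounded_linear_fst D]
      note D2 = bounded_linear.has_vector_derivative[OF bounded_linear_snd D]
      note D3 = bounded_linear.has_vector_derivative[OF bounded_linear_fst D2]
      note D4 = bounded_linear.has_vector_derivative[OF bounded_linear_snd D2]
      show ?case
        using D1 D3 D4
        by (simp add: x_def y_def z_def has_real_derivative_iff_has_vector_derivative)
    qed
  qed
  ultimately show ?thesis by (rule that)
qed

text \<open>
  Every pair of Lagrange multipliers \<open>a\<close>, \<open>b\<close> for the conditions on \<open>y\<close> and \<open>z\<close> bounds the length. The bound
  results from integrating \<open>pairing_le_hyp\<close> with \<open>p = a + b * x\<^sup>2\<close> along the curve.
\<close>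
lemma admissible_dual_bound:
  assumes adm: "admissible T q u" and q: "q 0 = q0" "q T = (X, Y, Z)"
  shows "0 \<le> X" "len T u \<le> primitive 0 hyp a b X - a * Y - 2 * b * Z"
proof -
  let ?M = "lebesgue_on {0..T}"
  define x y z where xyz: "x = (\<lambda>t. fst (q t))" "y = (\<lambda>t. fst (snd (q t)))" "z = (\<lambda>t. snd (snd (q t)))"
  obtain L where L: "L-lipschitz_on {0..T} x" "L-lipschitz_on {0..T} y" "L-lipschitz_on {0..T} z"
    and der: "AE t in ?M. (x has_real_derivative fst (u t)) (at t within {0..T}) \<and>
       (y has_real_derivative snd (u t)) (at t within {0..T}) \<and>
       (z has_real_derivative (x t)\<^sup>2 / 2 * snd (u t)) (at t within {0..T})"
    using admissible_components[OF adm] unfolding xyz by blast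
  have T: "0 \<le> T" and u_meas: "u \<in> borel_measurable ?M" and "bounded (u ` {0..T})"
    and U: "\<And>t. t \<in> {0..T} \<Longrightarrow> u t \<in> U2"
    using adm by (auto simp: admissible_def)
  then obtain B where "\<forall>v\<in>u ` {0..T}. norm v \<le> B"
    unfolding bounded_iff by blast
  hence B: "norm (u t) \<le> B" if "t \<in> {0..T}" for t
    using that by simp
  have u12: "\<bar>snd (u t)\<bar> \<le> fst (u t)" if "t \<in> {0..T}" for t
    using U[OF that] by (auto simp: U2_def case_prod_beta)
  have B1: "fst (u t) \<le> B" if "t \<in> {0..T}" for t
    using B[OF that] norm_fst_le[of "fst (u t)" "snd (u t)"] by simp
  note meas = borel_measurable_components[OF u_meas]
  have ends: "x 0 = 0" "y 0 = 0" "z 0 = 0" "x T = X" "y T = Y" "z T = Z"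
    using q by (simp_all add: xyz q0_def)
  have "(LINT t|?M. fst (u t)) = x T - x 0"
    by (rule integral_lipschitz_derivative[OF T L(1) meas(1)]) (use der in eventually_elim, blast)
  moreover have "0 \<le> (LINT t|?M. fst (u t))"
    by (rule integral_nonneg_AE) (rule AE_I2, use u12 in fastforce)
  ultimately show "0 \<le> X" by (simp add: ends)
  define S where "S = primitive 0 hyp a b"
  define S' where "S' = (\<lambda>x. hyp (a + b * x\<^sup>2))"
  have dS: "(S has_real_derivative S' x) (at x)" for x
    using has_derivative_primitive[OF continuous_hyp, of 0 a b x] by (simp add: S_def S'_def)
  have cS': "continuous_on A S'" for A
    unfolding S'_def by (intro continuous_on_compose2[OF continuous_hyp[of UNIV]] continuous_intros) auto
  \<comment> \<open>a bound for \<open>x\<close> on the whole time interval\<close>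
  define R where "R = L * T"
  have xR: "x t \<in> {-R..R}" if "t \<in> {0..T}" for t
  proof -
    have "\<bar>x t\<bar> \<le> L * t"
      using lipschitz_onD[OF L(1) that, of 0] T that by (simp add: ends dist_real_def)
    also have "\<dots> \<le> R"
      unfolding R_def using that lipschitz_on_nonneg[OF L(1)] by (intro mult_left_mono) auto
    finally show ?thesis by auto
  qed
  have "bounded (S' ` {-R..R})"
    by (intro compact_imp_bounded compact_continuous_image cS') simp
  then obtain K where "\<forall>v\<in>S' ` {-R..R}. norm v \<le> K"
    unfolding bounded_iff by blast
  hence K: "\<bar>S' x\<bar> \<le> K" if "x \<in> {-R..R}" for x
    using that by simp
  define C where "C = max K 0"
  have lipS: "\<bar>S p - S p'\<bar> \<le> C * \<bar>p - p'\<bar>" if "p \<in> {-R..R}" "p' \<in> {-R..R}" for p p'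
  proof -
    have "norm (S p - S p') \<le> C * norm (p - p')"
      by (rule field_differentiable_bound[of "{-R..R}" S S'])
        (use dS K that in \<open>auto simp: C_def le_max_iff_disj intro: has_field_derivative_at_within\<close>)
    thus ?thesis by simp
  qed
  \<comment> \<open>The Lagrangian along the curve; its derivative dominates the integrand of the length.\<close>
  define \<Psi> where "\<Psi> = (\<lambda>t. S (x t) - a * y t - 2 * b * z t)"
  define \<Psi>' where "\<Psi>' = (\<lambda>t. S' (x t) * fst (u t) - (a + b * (x t)\<^sup>2) * snd (u t))"
  have "(C * L)-lipschitz_on {0..T} (\<lambda>t. S (x t))"
  proof (rule lipschitz_onI)
    fix s t assume st: "s \<in> {0..T}" "t \<in> {0..T}"
    have "\<bar>S (x s) - S (x t)\<bar> \<le> C * \<bar>x s - x t\<bar>"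
      by (rule lipS[OF xR xR]) (use st in auto)
    also have "\<dots> \<le> C * (L * \<bar>s - t\<bar>)"
      using lipschitz_onD[OF L(1) st] by (intro mult_left_mono) (simp_all add: dist_real_def C_def)
    finally show "dist (S (x s)) (S (x t)) \<le> C * L * dist s t"
      by (simp add: dist_real_def)
  qed (use lipschitz_on_nonneg[OF L(1)] in \<open>simp add: C_def\<close>)
  hence lip\<Psi>: "(C * L + \<bar>a\<bar> * L + \<bar>2 * b\<bar> * L)-lipschitz_on {0..T} \<Psi>"
    unfolding \<Psi>_def by (intro lipschitz_on_diff lipschitz_on_cmult_real L)
  have cx: "continuous_on {0..T} x"
    by (rule lipschitz_on_continuous_on[OF L(1)])
  have mx: "(\<lambda>t. g (x t)) \<in> borel_measurable ?M" if "continuous_on UNIV g" for g :: "real \<Rightarrow> real"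
    by (rule continuous_imp_measurable_on_sets_lebesgue)
      (auto intro: continuous_on_compose2[OF that cx])
  have m\<Psi>': "\<Psi>' \<in> borel_measurable ?M"
    unfolding \<Psi>'_def
    by (intro borel_measurable_diff borel_measurable_times meas mx[OF cS'] mx[of "\<lambda>x. a + b * x\<^sup>2"]
        continuous_intros)
  have int\<Psi>: "(LINT t|?M. \<Psi>' t) = \<Psi> T - \<Psi> 0"
  proof (rule integral_lipschitz_derivative[OF T lip\<Psi> m\<Psi>'])
    show "AE t in ?M. (\<Psi> has_real_derivative \<Psi>' t) (at t within {0..T})"
      using der
    proof eventually_elim
      case (elim t)
      have "((\<lambda>t. S (x t)) has_real_derivative S' (x t) * fst (u t)) (at t within {0..T})"
        by (rule DERIV_chain2[OF dS]) (use elim in blast)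
      moreover have "((\<lambda>t. a * y t) has_real_derivative a * snd (u t)) (at t within {0..T})"
        by (rule DERIV_cmult) (use elim in blast)
      moreover have "((\<lambda>t. 2 * b * z t) has_real_derivative 2 * b * ((x t)\<^sup>2 / 2 * snd (u t))) (at t within {0..T})"
        by (rule DERIV_cmult) (use elim in blast)
      ultimately have "(\<Psi> has_real_derivative S' (x t) * fst (u t) - a * snd (u t)
          - 2 * b * ((x t)\<^sup>2 / 2 * snd (u t))) (at t within {0..T})"
        unfolding \<Psi>_def by (intro DERIV_diff)
      thus ?case
        by (rule DERIV_cong) (simp add: \<Psi>'_def algebra_simps)
    qed
  qed
  have len_int: "integrable ?M (\<lambda>t. sqrt ((fst (u t))\<^sup>2 - (snd (u t))\<^sup>2))"
  proof (rule integrable_bounded_measurable_interval)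
    show "(\<lambda>t. sqrt ((fst (u t))\<^sup>2 - (snd (u t))\<^sup>2)) \<in> borel_measurable ?M"
      using meas by measurable
    fix t assume t: "t \<in> {0..T}"
    have "(snd (u t))\<^sup>2 \<le> (fst (u t))\<^sup>2"
      using power_mono[OF u12[OF t], of 2] by simp
    moreover have "sqrt ((fst (u t))\<^sup>2 - (snd (u t))\<^sup>2) \<le> fst (u t)"
      using u12[OF t] by (intro real_le_lsqrt) auto
    ultimately show "\<bar>sqrt ((fst (u t))\<^sup>2 - (snd (u t))\<^sup>2)\<bar> \<le> B"
      using B1[OF t] by simp
  qed
  have le: "sqrt ((fst (u t))\<^sup>2 - (snd (u t))\<^sup>2) \<le> \<Psi>' t" if "t \<in> {0..T}" for t
    using pairing_le_hyp[OF u12[OF that], of "a + b * (x t)\<^sup>2"] by (simp add: \<Psi>'_def S'_def)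
  have int\<Psi>': "integrable ?M \<Psi>'"
  proof (rule integrable_bounded_measurable_interval[OF m\<Psi>'])
    fix t assume t: "t \<in> {0..T}"
    have "\<bar>S' (x t)\<bar> * \<bar>fst (u t)\<bar> \<le> C * B"
      using K[OF xR[OF t]] B1[OF t] u12[OF t] by (intro mult_mono) (auto simp: C_def)
    moreover have "\<bar>a + b * (x t)\<^sup>2\<bar> * \<bar>snd (u t)\<bar> \<le> (\<bar>a\<bar> + \<bar>b\<bar> * R\<^sup>2) * B"
    proof (intro mult_mono)
      have "(x t)\<^sup>2 \<le> R\<^sup>2"
        using xR[OF t] by (intro abs_le_square_iff[THEN iffD1]) auto
      hence "\<bar>b * (x t)\<^sup>2\<bar> \<le> \<bar>b\<bar> * R\<^sup>2"
        by (simp add: abs_mult mult_left_mono)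
      thus "\<bar>a + b * (x t)\<^sup>2\<bar> \<le> \<bar>a\<bar> + \<bar>b\<bar> * R\<^sup>2"
        using abs_triangle_ineq[of a "b * (x t)\<^sup>2"] by linarith
    qed (use B1[OF t] u12[OF t] in auto)
    ultimately show "\<bar>\<Psi>' t\<bar> \<le> C * B + (\<bar>a\<bar> + \<bar>b\<bar> * R\<^sup>2) * B"
      unfolding \<Psi>'_def
      by (intro order_trans[OF abs_triangle_ineq4] add_mono) (simp_all add: abs_mult)
  qed
  have "len T u \<le> (LINT t|?M. \<Psi>' t)"
    unfolding len_def by (rule integral_mono[OF len_int int\<Psi>']) (use le in simp)
  thus "len T u \<le> primitive 0 hyp a b X - a * Y - 2 * b * Z"
    by (simp add: int\<Psi> \<Psi>_def ends S_def)
qed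

text \<open>
  The curve is parametrised by \<open>x\<close> itself, so that no differential equation has to be solved.
  Together with \<open>primitive_hyp\<close> its length meets the upper bound \<open>admissible_dual_bound\<close>.
\<close>
lemma extremal_length_attained:
  assumes X: "0 \<le> X"
  shows "primitive 0 rate a b X \<in> lengths_to (X, primitive 0 slope a b X, primitive 1 slope a b X / 2)"
proof -
  define p where "p = (\<lambda>s. a + b * s\<^sup>2)"
  define Y where "Y = primitive 0 slope a b"
  define Z where "Z = (\<lambda>s. primitive 1 slope a b s / 2)"
  define q where "q = (\<lambda>s. (s, Y s, Z s))"
  define u where "u = (\<lambda>s. (1::real, slope (p s)))"
  have cp: "continuous_on A (\<lambda>s. g (p s))" if "continuous_on UNIV g" for g :: "real \<Rightarrow> real" and A
    unfolding p_def by (intro continuous_on_compose2[OF that] continuous_intros) auto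
  have dY: "(Y has_real_derivative slope (p s)) (at s)" for s
    using has_derivative_primitive[OF continuous_slope, of 0 a b s] by (simp add: Y_def p_def)
  have dZ: "(Z has_real_derivative s\<^sup>2 / 2 * slope (p s)) (at s)" for s
    using DERIV_cdivide[OF has_derivative_primitive[OF continuous_slope, of 1 a b s], of 2]
    by (simp add: Z_def p_def)
  have sl: "\<bar>slope r\<bar> \<le> 1" for r using abs_slope_less[of r] by simp
  have lipY: "1-lipschitz_on {0..X} Y"
  proof (rule lipschitz_onI)
    fix s t assume "s \<in> {0..X}" "t \<in> {0..X}"
    hence "norm (Y s - Y t) \<le> 1 * norm (s - t)"
      by (intro field_differentiable_bound[of "{0..X}" Y "\<lambda>s. slope (p s)"])
        (use sl dY in \<open>auto intro: has_field_derivative_at_within\<close>)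
    thus "dist (Y s) (Y t) \<le> 1 * dist s t" by (simp add: dist_norm)
  qed simp
  have lipZ: "(X\<^sup>2)-lipschitz_on {0..X} Z"
  proof (rule lipschitz_onI)
    fix s t assume st: "s \<in> {0..X}" "t \<in> {0..X}"
    have "norm (r\<^sup>2 / 2 * slope (p r)) \<le> X\<^sup>2" if "r \<in> {0..X}" for r
    proof -
      have "r\<^sup>2 \<le> X\<^sup>2"
        using that by (intro power_mono) auto
      hence "r\<^sup>2 / 2 \<le> X\<^sup>2"
        using zero_le_power2[of X] by linarith
      hence "\<bar>r\<^sup>2 / 2\<bar> * \<bar>slope (p r)\<bar> \<le> X\<^sup>2 * 1"
        using sl by (intro mult_mono) auto
      thus ?thesis by (simp add: abs_mult)
    qed
    hence "norm (Z s - Z t) \<le> X\<^sup>2 * norm (s - t)"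
      using st by (intro field_differentiable_bound[of "{0..X}" Z "\<lambda>s. s\<^sup>2 / 2 * slope (p s)"])
        (use dZ in \<open>auto intro: has_field_derivative_at_within\<close>)
    thus "dist (Z s) (Z t) \<le> X\<^sup>2 * dist s t" by (simp add: dist_norm)
  qed simp
  have "\<exists>L. L-lipschitz_on {0..X} q"
    unfolding q_def by (rule exI, rule lipschitz_on_Pair[OF lipschitz_on_id lipschitz_on_Pair[OF lipY lipZ]])
  moreover have "u \<in> borel_measurable (lebesgue_on {0..X})"
    unfolding u_def
    by (rule continuous_imp_measurable_on_sets_lebesgue)
      (auto intro!: continuous_on_Pair continuous_on_const cp continuous_slope)
  moreover have "bounded (u ` {0..X})"
    unfolding u_def
    by (intro compact_imp_bounded compact_continuous_image continuous_on_Pair continuous_on_const cp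
        continuous_slope) simp
  moreover have "u ` {0..X} \<subseteq> U2"
    using sl by (auto simp: u_def U2_def)
  moreover have "AE t in lebesgue_on {0..X}.
      (q has_vector_derivative fst (u t) *\<^sub>R X1 (q t) + snd (u t) *\<^sub>R X2 (q t)) (at t within {0..X})"
  proof (rule AE_I2)
    fix t
    have "(q has_vector_derivative (1, slope (p t), t\<^sup>2 / 2 * slope (p t))) (at t within {0..X})"
      unfolding q_def using dY[of t] dZ[of t]
      by (intro has_vector_derivative_Pair)
        (auto simp: has_real_derivative_iff_has_vector_derivative has_vector_derivative_at_within)
    thus "(q has_vector_derivative fst (u t) *\<^sub>R X1 (q t) + snd (u t) *\<^sub>R X2 (q t)) (at t within {0..X})"
      by (simp add: u_def q_def X1_def X2_def mult.commute)
  qed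
  ultimately have "admissible X q u"
    using X by (simp add: admissible_def)
  moreover have "q 0 = q0" "q X = (X, Y X, Z X)"
    by (simp_all add: q_def q0_def Y_def Z_def)
  moreover have "len X u = primitive 0 rate a b X"
  proof -
    have "((\<lambda>s. rate (p s)) has_integral primitive 0 rate a b X - primitive 0 rate a b 0) {0..X}"
    proof (rule fundamental_theorem_of_calculus[OF X])
      fix s
      show "(primitive 0 rate a b has_vector_derivative rate (p s)) (at s within {0..X})"
        using has_derivative_primitive[OF continuous_rate, of 0 a b s]
        by (simp add: p_def has_real_derivative_iff_has_vector_derivative has_vector_derivative_at_within)
    qed
    moreover have "integrable (lebesgue_on {0..X}) (\<lambda>s. rate (p s))"
      by (rule continuous_imp_integrable_real[OF cp[OF continuous_rate]])
    moreover have "sqrt (1 - (slope r)\<^sup>2) = rate r" for r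
      using rate_pos[of r] by (simp add: slope_sq)
    ultimately show ?thesis
      by (simp add: len_def u_def lebesgue_integral_eq_integral integral_unique)
  qed
  ultimately show ?thesis
    unfolding lengths_to_def Y_def Z_def
    by (intro CollectI exI[of _ X] exI[of _ q] exI[of _ u]) simp
qed

section \<open>Distance and the unit sphere\<close>

text \<open>
  The end of the extremal with parameters \<open>(a, e)\<close> that stops when its first coordinate is \<open>x\<close>.
\<close>
definition endpoint :: "real \<Rightarrow> real \<times> real \<Rightarrow> point" where
  "endpoint x v = (x, x * moment 0 slope v, x ^ 3 / 2 * moment 1 slope v)"

lemma moment_rate_pos: "0 < moment 0 rate v"
proof -
  obtain a e where v: "v = (a, e)" by (cases v)
  let ?f = "\<lambda>s. rate (a + s\<^sup>2 * e)"
  have c: "continuous_on {0..1} ?f"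
    by (intro continuous_on_compose2[OF continuous_rate[of UNIV]] continuous_intros) auto
  have I: "(?f has_integral moment 0 rate v) {0..1}"
    using has_integral_moment[OF continuous_rate, of 0 a e] by (simp add: v)
  have "0 \<le> moment 0 rate v"
    by (rule has_integral_nonneg[OF I]) (use rate_pos less_imp_le in blast)
  moreover have "moment 0 rate v \<noteq> 0"
    using integral_eq_0_iff[OF c] rate_pos[THEN less_imp_le] rate_pos[THEN less_imp_neq] integral_unique[OF I]
    by force
  ultimately show ?thesis by simp
qed

lemma primitive_eq_moment:
  assumes "X \<noteq> 0"
  shows "primitive n g a (e / X\<^sup>2) X = X ^ (2 * n + 1) * moment n g (a, e)"
  using assms by (simp add: primitive_def)

lemma dual_bound:
  assumes "l \<in> lengths_to (X, Y, Z)"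
  shows "0 \<le> X" "l \<le> primitive 0 hyp a b X - a * Y - 2 * b * Z"
proof -
  obtain T q u where l: "l = len T u" "admissible T q u" "q 0 = q0" "q T = (X, Y, Z)"
    using assms by (auto simp: lengths_to_def)
  show "0 \<le> X" "l \<le> primitive 0 hyp a b X - a * Y - 2 * b * Z"
    using admissible_dual_bound[OF l(2-4)] by (simp_all add: l(1))
qed

lemma d_endpoint:
  assumes x: "0 < x"
  shows "d (endpoint x v) = ereal (x * moment 0 rate v)"
proof -
  obtain a e where v: "v = (a, e)" by (cases v)
  define b where "b = e / x\<^sup>2"
  have p: "primitive n g a b x = x ^ (2 * n + 1) * moment n g v" for n g
    using x by (simp add: b_def v primitive_eq_moment)
  have ep: "endpoint x v = (x, primitive 0 slope a b x, primitive 1 slope a b x / 2)"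
    by (simp add: endpoint_def p eval_nat_numeral)
  have mem: "x * moment 0 rate v \<in> lengths_to (endpoint x v)"
    using extremal_length_attained[of x a b] x by (simp add: ep p)
  have "l \<le> x * moment 0 rate v" if "l \<in> lengths_to (endpoint x v)" for l
  proof -
    have "l \<le> primitive 0 rate a b x"
      using dual_bound(2)[OF that[unfolded ep], of a b] primitive_hyp[of a b x] by simp
    thus ?thesis by (simp add: p)
  qed
  hence "(SUP l\<in>lengths_to (endpoint x v). ereal l) = ereal (x * moment 0 rate v)"
    using mem by (intro antisym SUP_least SUP_upper) auto
  thus ?thesis
    using mem by (auto simp: d_def)
qed

lemma hyp_minus_abs_tendsto_0:
  assumes "p \<noteq> 0"
  shows "(\<lambda>n. hyp (real n * p) - \<bar>real n * p\<bar>) \<longlonglongrightarrow> 0"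
proof (rule tendsto_sandwich)
  show "\<forall>\<^sub>F n in sequentially. 0 \<le> hyp (real n * p) - \<bar>real n * p\<bar>"
    by (rule always_eventually) (simp add: hyp_def real_le_rsqrt)
  have bound: "hyp q - \<bar>q\<bar> \<le> 1 / \<bar>q\<bar>" if "q \<noteq> 0" for q
  proof -
    have "1 + q\<^sup>2 \<le> (\<bar>q\<bar> + 1 / \<bar>q\<bar>)\<^sup>2"
      using that by (simp add: power2_sum)
    hence "hyp q \<le> \<bar>q\<bar> + 1 / \<bar>q\<bar>"
      unfolding hyp_def by (intro real_le_lsqrt) simp_all
    thus ?thesis by simp
  qed
  have "hyp (real n * p) - \<bar>real n * p\<bar> \<le> (1 / \<bar>p\<bar>) * inverse (real n)" if "n > 0" for n
  proof -
    have "1 / \<bar>real n * p\<bar> = (1 / \<bar>p\<bar>) * inverse (real n)"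
      by (simp add: abs_mult divide_inverse)
    thus ?thesis using bound[of "real n * p"] that assms by simp
  qed
  thus "\<forall>\<^sub>F n in sequentially. hyp (real n * p) - \<bar>real n * p\<bar> \<le> (1 / \<bar>p\<bar>) * inverse (real n)"
    by (intro eventually_mono[OF eventually_gt_at_top[of 0]])
  show "(\<lambda>n. (1 / \<bar>p\<bar>) * inverse (real n)) \<longlonglongrightarrow> 0"
    using tendsto_mult[OF tendsto_const lim_inverse_n, of "1 / \<bar>p\<bar>"] by simp
qed simp

text \<open>
  The function \<open>moment 0 hyp\<close> equals the norm \<open>moment 0 abs\<close> up to an error that vanishes along every ray.
\<close>
lemma moment_hyp_minus_abs_tendsto_0:
  assumes "(a, e) \<noteq> (0, 0)"
  shows "(\<lambda>n. moment 0 hyp (real n * a, real n * e) - real n * moment 0 abs (a, e)) \<longlonglongrightarrow> 0"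
proof -
  let ?p = "\<lambda>s. a + s\<^sup>2 * e"
  define f where "f = (\<lambda>n s. hyp (real n * ?p s) - real n * \<bar>?p s\<bar>)"
  define g where "g = (\<lambda>s. if ?p s = 0 then 1 else 0 :: real)"
  have cabs: "continuous_on UNIV (abs :: real \<Rightarrow> real)" by (intro continuous_intros)
  have I: "(f n has_integral (moment 0 hyp (real n * a, real n * e) - real n * moment 0 abs (a, e))) {0..1}" for n
  proof -
    have "((\<lambda>s. s ^ (2 * 0) * hyp (real n * a + s\<^sup>2 * (real n * e)) - real n * (s ^ (2 * 0) * \<bar>?p s\<bar>))
        has_integral (moment 0 hyp (real n * a, real n * e) - real n * moment 0 abs (a, e))) {0..1}"
      by (intro has_integral_diff has_integral_mult_right has_integral_moment continuous_hyp cabs)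
    thus ?thesis by (simp add: f_def algebra_simps)
  qed
  have bnd: "norm (f n s) \<le> 1" for n s
  proof -
    have "hyp q \<le> 1 + \<bar>q\<bar>" "\<bar>q\<bar> \<le> hyp q" for q
      unfolding hyp_def by (auto intro!: real_le_lsqrt real_le_rsqrt simp: power2_eq_square algebra_simps)
    from this[of "real n * ?p s"] show ?thesis by (simp add: f_def abs_mult)
  qed
  have lim: "(\<lambda>n. f n s) \<longlonglongrightarrow> g s" for s
  proof (cases "?p s = 0")
    case True
    thus ?thesis by (simp add: f_def g_def hyp_def)
  next
    case False
    thus ?thesis
      using hyp_minus_abs_tendsto_0[OF False] by (simp add: f_def g_def abs_mult)
  qed
  have "(\<lambda>n. integral {0..1} (f n)) \<longlonglongrightarrow> integral {0..1} g"
    by (rule dominated_convergence(2)[where h = "\<lambda>_. 1"]) (use I bnd lim in \<open>auto simp: integrable_on_def\<close>)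
  moreover have "(g has_integral 0) {0..1}"
  proof (rule has_integral_spike_finite[OF _ _ has_integral_0])
    have "{s \<in> {0..1}. ?p s = 0} \<subseteq> {sqrt (- a / e)}"
    proof
      fix s assume s: "s \<in> {s \<in> {0..1}. ?p s = 0}"
      hence "e \<noteq> 0" using assms by auto
      hence "s\<^sup>2 = - a / e" using s by (simp add: field_simps)
      thus "s \<in> {sqrt (- a / e)}"
        using s real_sqrt_unique[of s "- a / e"] by auto
    qed
    thus "finite {s \<in> {0..1}. ?p s = 0}"
      by (rule finite_subset) simp
  qed (auto simp: g_def)
  ultimately show ?thesis
    by (simp only: integral_unique[OF I] integral_unique)
qed

lemma moment_abs_scale:
  assumes "0 \<le> r"
  shows "moment 0 abs (r * a, r * e) = r * moment 0 abs (a, e :: real)"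
proof -
  have cabs: "continuous_on UNIV (abs :: real \<Rightarrow> real)" by (intro continuous_intros)
  have "((\<lambda>s. r * (s ^ (2 * 0) * \<bar>a + s\<^sup>2 * e\<bar>)) has_integral r * moment 0 abs (a, e)) {0..1}"
    by (intro has_integral_mult_right has_integral_moment cabs)
  moreover have "r * (s ^ (2 * 0) * \<bar>a + s\<^sup>2 * e\<bar>) = s ^ (2 * 0) * \<bar>r * a + s\<^sup>2 * (r * e)\<bar>" for s
  proof -
    have "r * a + s\<^sup>2 * (r * e) = r * (a + s\<^sup>2 * e)" by (simp add: algebra_simps)
    thus ?thesis using assms by (simp add: abs_mult)
  qed
  ultimately show ?thesis
    using has_integral_moment[OF cabs, of 0 "r * a" "r * e"] has_integral_unique by (simp only:) blast
qed

lemma moment_abs_le_hyp: "moment 0 abs v \<le> moment 0 hyp (v :: real \<times> real)"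
proof -
  obtain a e where v: "v = (a, e)" by (cases v)
  have cabs: "continuous_on UNIV (abs :: real \<Rightarrow> real)" by (intro continuous_intros)
  have "\<bar>q\<bar> \<le> hyp q" for q
    unfolding hyp_def by (rule real_le_rsqrt) simp
  thus ?thesis
    unfolding v by (intro has_integral_le[OF has_integral_moment has_integral_moment] cabs continuous_hyp) simp
qed

text \<open>
  A convex function with positive lower bound \<open>m\<close> that is asymptotically homogeneous grows linearly, so it
  attains its minimum, and there its gradient \<open>slopes v - (c1, c2)\<close> vanishes. Without positivity the statement
  fails: on the boundary of the range of \<open>slopes\<close> the infimum is 0 and is not attained.
\<close>
lemma tilted_hyp_minimiser:
  assumes m: "0 < m" and le: "\<And>v. m \<le> moment 0 hyp v - fst v * c1 - snd v * c2"
  obtains v where "slopes v = (c1, c2)"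
proof -
  define h where "h = (\<lambda>v. moment 0 hyp v - fst v * c1 - snd v * c2)"
  define \<eta> where "\<eta> = (\<lambda>v :: real \<times> real. moment 0 abs v - fst v * c1 - snd v * c2)"
  have cabs: "continuous_on UNIV (abs :: real \<Rightarrow> real)" by (intro continuous_intros)
  have ch: "continuous_on A h" for A
  proof -
    have "continuous_on A (moment 0 hyp)"
      by (rule continuous_on_subset[of UNIV])
        (use continuous_on_moment[OF convex_UNIV continuous_hyp, of 0] in simp_all)
    thus ?thesis
      unfolding h_def by (intro continuous_on_diff continuous_on_mult_right continuous_on_fst
          continuous_on_snd continuous_on_id)
  qed
  have c\<eta>: "continuous_on A \<eta>" for A
  proof -
    have "continuous_on A (moment 0 abs :: real \<times> real \<Rightarrow> real)"
      by (rule continuous_on_subset[of UNIV])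
        (use continuous_on_moment[OF convex_UNIV cabs, of 0] in simp_all)
    thus ?thesis
      unfolding \<eta>_def by (intro continuous_on_diff continuous_on_mult_right continuous_on_fst
          continuous_on_snd continuous_on_id)
  qed
  \<comment> \<open>\<open>\<eta>\<close> is the slope of \<open>h\<close> at infinity. In a direction where it is not positive, \<open>h\<close> would drop
    below \<open>m\<close> far out on the ray.\<close>
  have \<eta>_pos: "0 < \<eta> v" if "v \<noteq> 0" for v
  proof (rule ccontr)
    assume "\<not> 0 < \<eta> v"
    hence neg: "\<eta> v \<le> 0" by simp
    obtain a e where v: "v = (a, e)" by (cases v)
    have ge: "m \<le> moment 0 hyp (real n * a, real n * e) - real n * moment 0 abs (a, e)" for n
    proof -
      have "real n * \<eta> v \<le> 0"
        using neg by (simp add: mult_nonneg_nonpos)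
      moreover have "real n * \<eta> v = real n * moment 0 abs (a, e) - real n * a * c1 - real n * e * c2"
        by (simp add: \<eta>_def v algebra_simps)
      moreover have "m \<le> moment 0 hyp (real n * a, real n * e) - real n * a * c1 - real n * e * c2"
        using le[of "(real n * a, real n * e)"] by simp
      ultimately show ?thesis by linarith
    qed
    have "(a, e) \<noteq> (0, 0)"
      using that by (auto simp: v prod_eq_iff)
    from LIMSEQ_le_const[OF moment_hyp_minus_abs_tendsto_0[OF this]] ge
    have "m \<le> 0" by blast
    thus False using m by simp
  qed
  have "sphere (0 :: real \<times> real) 1 \<noteq> {}" by simp
  from continuous_attains_inf[OF compact_sphere this c\<eta>]
  obtain \<theta> where \<theta>: "\<theta> \<in> sphere 0 1" "\<And>w. w \<in> sphere 0 1 \<Longrightarrow> \<eta> \<theta> \<le> \<eta> w"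
    by blast
  have \<delta>: "0 < \<eta> \<theta>" using \<theta>(1) by (intro \<eta>_pos) auto
  have grow: "norm v * \<eta> \<theta> \<le> h v" for v
  proof (cases "v = 0")
    case True
    thus ?thesis using le[of v] m by (simp add: h_def)
  next
    case False
    have "norm v * \<eta> \<theta> \<le> norm v * \<eta> (v /\<^sub>R norm v)"
      using False by (intro mult_left_mono \<theta>(2)) auto
    also have "\<dots> = \<eta> v"
    proof -
      have "moment 0 abs (v /\<^sub>R norm v) = moment 0 abs v / norm v"
        using moment_abs_scale[of "inverse (norm v)" "fst v" "snd v"]
        by (simp add: scaleR_prod_def field_simps)
      thus ?thesis
        using False by (simp add: \<eta>_def field_simps)
    qed
    also have "\<dots> \<le> h v"
      using moment_abs_le_hyp[of v] by (simp add: \<eta>_def h_def)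
    finally show ?thesis .
  qed
  define R where "R = h 0 / \<eta> \<theta>"
  have h0: "0 \<le> h 0" using le[of 0] m by (simp add: h_def)
  have R: "0 \<le> R" using h0 \<delta> by (simp add: R_def)
  have "cball (0 :: real \<times> real) R \<noteq> {}" using R by simp
  from continuous_attains_inf[OF compact_cball this ch]
  obtain v where v: "v \<in> cball 0 R" "\<And>w. w \<in> cball 0 R \<Longrightarrow> h v \<le> h w"
    by blast
  have min: "h v \<le> h w" for w
  proof (cases "w \<in> cball 0 R")
    case True thus ?thesis by (rule v(2))
  next
    case False
    have "h v \<le> h 0" using R by (intro v(2)) simp
    also have "\<dots> = R * \<eta> \<theta>" using \<delta> by (simp add: R_def)
    also have "\<dots> \<le> norm w * \<eta> \<theta>" using False \<delta> by (intro mult_right_mono) auto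
    also have "\<dots> \<le> h w" by (rule grow)
    finally show ?thesis .
  qed
  have "(moment 0 hyp has_derivative (\<lambda>h. moment 0 slope v * fst h + moment 1 slope v * snd h)) (at v)"
    using has_derivative_moment[OF open_UNIV convex_UNIV has_derivative_hyp continuous_slope, of v 0] by simp
  hence "(h has_derivative (\<lambda>h. moment 0 slope v * fst h + moment 1 slope v * snd h - fst h * c1 - snd h * c2)) (at v)"
    unfolding h_def
    by (intro has_derivative_diff has_derivative_mult_left has_derivative_fst has_derivative_snd has_derivative_ident)
  hence "(\<lambda>h. moment 0 slope v * fst h + moment 1 slope v * snd h - fst h * c1 - snd h * c2) = (\<lambda>h. 0)"
    by (rule differential_zero_maxmin[OF UNIV_I open_UNIV]) (use min in blast)
  from fun_cong[OF this, of "(1, 0)"] fun_cong[OF this, of "(0, 1)"]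
  have "slopes v = (c1, c2)" by (simp add: slopes_def)
  thus ?thesis by (rule that)
qed

text \<open>
  The multipliers of the optimal curve minimise the dual bound, which is at least the length of
  some curve and hence bounded below by a positive number.
\<close>
lemma positive_distance_imp_endpoint:
  assumes "0 < d q"
  obtains x v where "0 < x" "q = endpoint x v"
proof -
  obtain X Y Z where q: "q = (X, Y, Z)" by (metis prod.exhaust)
  have "lengths_to q \<noteq> {}" using assms by (auto simp: d_def)
  hence "0 < (SUP l\<in>lengths_to q. ereal l)" using assms by (simp add: d_def)
  then obtain l where "l \<in> lengths_to q" "0 < ereal l"
    unfolding less_SUP_iff by blast
  hence l: "l \<in> lengths_to q" "0 < l" by simp_all
  note db = dual_bound[OF l(1)[unfolded q]]
  have X: "0 < X"
  proof (rule ccontr)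
    assume "\<not> 0 < X"
    hence "X = 0" using db(1) by simp
    thus False using db(2)[of 0 0] l(2) by simp
  qed
  have "l / X \<le> moment 0 hyp v - fst v * (Y / X) - snd v * (2 * Z / X ^ 3)" for v
  proof -
    have "l \<le> X * moment 0 hyp v - fst v * Y - 2 * (snd v / X\<^sup>2) * Z"
      using db(2)[of "fst v" "snd v / X\<^sup>2"] X by (simp add: primitive_eq_moment)
    also have "\<dots> = X * (moment 0 hyp v - fst v * (Y / X) - snd v * (2 * Z / X ^ 3))"
      using X by (simp add: field_simps power2_eq_square power3_eq_cube)
    finally show ?thesis
      using X by (simp add: divide_le_eq mult.commute)
  qed
  from tilted_hyp_minimiser[OF divide_pos_pos[OF l(2) X] this]
  obtain v where "slopes v = (Y / X, 2 * Z / X ^ 3)" by blast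
  hence "q = endpoint X v"
    using X by (simp add: q endpoint_def slopes_def)
  thus ?thesis using that X by blast
qed

text \<open>
  The first coordinate is chosen such that the length equals 1.
\<close>
definition sphere_point :: "real \<times> real \<Rightarrow> point" where
  "sphere_point v = endpoint (1 / moment 0 rate v) v"

lemma unit_sphere_eq: "unit_sphere = range sphere_point"
proof (intro antisym subsetI)
  fix q assume "q \<in> unit_sphere"
  hence q: "d q = 1" by (simp add: unit_sphere_def)
  hence "0 < d q" by simp
  then obtain x v where x: "0 < x" "q = endpoint x v"
    by (rule positive_distance_imp_endpoint)
  hence "x * moment 0 rate v = 1"
    using q d_endpoint[OF x(1), of v] by simp
  hence "x = 1 / moment 0 rate v"
    using moment_rate_pos[of v] by (simp add: field_simps)
  thus "q \<in> range sphere_point" using x by (simp add: sphere_point_def)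
next
  fix q assume "q \<in> range sphere_point"
  then obtain v where v: "q = endpoint (1 / moment 0 rate v) v"
    by (auto simp: sphere_point_def)
  have "d q = 1"
    using d_endpoint[of "1 / moment 0 rate v" v] moment_rate_pos[of v]
    by (simp add: v)
  thus "q \<in> unit_sphere" by (simp add: unit_sphere_def)
qed

section \<open>The exponential mapping and its lifetime\<close>

lemma cosh_eq_hyp_sinh: "cosh r = hyp (sinh r)" for r :: real
  unfolding hyp_def by (rule real_sqrt_unique[symmetric]) (simp_all add: cosh_square_eq add.commute)

lemma slope_times_hyp: "slope p * hyp p = p"
  using hyp_pos[of p] by (simp add: slope_def hyp_def)

lemma rate_times_hyp: "rate p * hyp p = 1"
  using hyp_pos[of p] by (simp add: rate_def hyp_def)

lemma strict_mono_primitive_rate: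
  assumes "X < X'"
  shows "primitive 0 rate a b X < primitive 0 rate a b X'"
  using assms
proof (rule DERIV_pos_imp_increasing[where f = "primitive 0 rate a b"])
  fix x
  show "\<exists>y. (primitive 0 rate a b has_real_derivative y) (at x) \<and> 0 < y"
    using has_derivative_primitive[OF continuous_rate, of 0 a b x] rate_pos[of "a + b * x\<^sup>2"] by auto
qed

lemma primitive_rate_inject: "primitive 0 rate a b X = primitive 0 rate a b X' \<longleftrightarrow> X = X'"
  by (metis strict_mono_primitive_rate less_irrefl linorder_neqE_linordered_idom)

lemma zero_derivative_on_interval:
  assumes "\<And>t. t \<in> {0..T} \<Longrightarrow> (f has_real_derivative 0) (at t within {0..T})" "t \<in> {0..T}"
  shows "f t = f 0"
proof -
  obtain c where "\<And>t. t \<in> {0..T} \<Longrightarrow> f t = c"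
    using has_field_derivative_zero_constant[of "{0..T}" f] assms(1) by (auto simp: convex_closed_interval)
  thus ?thesis using assms(2) by simp
qed

text \<open>
  Along a solution \<open>sinh \<psi> - c x\<^sup>2 / 2\<close> is constant. This integrates the system: all other unknowns become
  explicit functions of \<open>x\<close>, and \<open>x\<close> is determined implicitly by the time.
\<close>
lemma extremal_in_x:
  assumes ext: "extremal (\<psi>0, c) T \<psi> x y z" and t: "t \<in> {0..T}"
  defines "a \<equiv> sinh \<psi>0" and "b \<equiv> c / 2"
  shows "primitive 0 rate a b (x t) = t" "y t = primitive 0 slope a b (x t)" "z t = primitive 1 slope a b (x t) / 2"
proof -
  have init: "\<psi> 0 = \<psi>0" "x 0 = 0" "y 0 = 0" "z 0 = 0"
    and d\<psi>: "\<And>t. t \<in> {0..T} \<Longrightarrow> (\<psi> has_real_derivative c * x t) (at t within {0..T})"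
    and dx: "\<And>t. t \<in> {0..T} \<Longrightarrow> (x has_real_derivative cosh (\<psi> t)) (at t within {0..T})"
    and dy: "\<And>t. t \<in> {0..T} \<Longrightarrow> (y has_real_derivative sinh (\<psi> t)) (at t within {0..T})"
    and dz: "\<And>t. t \<in> {0..T} \<Longrightarrow> (z has_real_derivative (x t)\<^sup>2 / 2 * sinh (\<psi> t)) (at t within {0..T})"
    using ext by (auto simp: extremal_def)
  have sinh_\<psi>: "sinh (\<psi> t) = a + b * (x t)\<^sup>2" if t: "t \<in> {0..T}" for t
  proof -
    have "((\<lambda>t. sinh (\<psi> t) - b * (x t)\<^sup>2) has_real_derivative 0) (at t within {0..T})"
      if "t \<in> {0..T}" for t
      using d\<psi>[OF that] dx[OF that]
      by (auto intro!: derivative_eq_intros simp: b_def)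
    from zero_derivative_on_interval[OF this t] show ?thesis
      by (simp add: init a_def)
  qed
  have chain: "((\<lambda>t. primitive n g a b (x t)) has_real_derivative (x t) ^ (2 * n) * g (sinh (\<psi> t)) * hyp (sinh (\<psi> t)))
      (at t within {0..T})" if "continuous_on UNIV g" "t \<in> {0..T}" for n g t
    by (rule DERIV_cong[OF DERIV_chain2[OF has_derivative_primitive[OF that(1)] dx[OF that(2)]]])
      (simp add: sinh_\<psi>[OF that(2)] cosh_eq_hyp_sinh)
  have "((\<lambda>t. primitive 0 rate a b (x t) - t) has_real_derivative 0) (at t within {0..T})" if "t \<in> {0..T}" for t
    using DERIV_diff[OF chain[OF continuous_rate that, of 0] DERIV_ident] by (simp add: rate_times_hyp)
  from zero_derivative_on_interval[OF this t] show "primitive 0 rate a b (x t) = t"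
    by (simp add: init)
  have "((\<lambda>t. y t - primitive 0 slope a b (x t)) has_real_derivative 0) (at t within {0..T})" if "t \<in> {0..T}" for t
    using DERIV_diff[OF dy[OF that] chain[OF continuous_slope that, of 0]] by (simp add: slope_times_hyp)
  from zero_derivative_on_interval[OF this t] show "y t = primitive 0 slope a b (x t)"
    by (simp add: init)
  have "((\<lambda>t. z t - primitive 1 slope a b (x t) / 2) has_real_derivative 0) (at t within {0..T})" if "t \<in> {0..T}" for t
    using DERIV_diff[OF dz[OF that] DERIV_cdivide[OF chain[OF continuous_slope that, of 1], of 2]]
    by (simp add: slope_times_hyp mult.assoc)
  from zero_derivative_on_interval[OF this t] show "z t = primitive 1 slope a b (x t) / 2"
    by (simp add: init)
qed

lemma extremal_exists:
  fixes \<psi>0 c :: real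
  defines "a \<equiv> sinh \<psi>0" and "b \<equiv> c / 2"
  assumes X: "0 \<le> X" "primitive 0 rate a b X = T"
  obtains \<psi> x y z where "extremal (\<psi>0, c) T \<psi> x y z"
proof -
  let ?T = "primitive 0 rate a b"
  let ?p = "\<lambda>x. a + b * x\<^sup>2"
  \<comment> \<open>Time as a function of \<open>x\<close> is explicit; the solution inverts it.\<close>
  define g where "g = inv ?T"
  have inj: "inj ?T" by (rule injI) (simp add: primitive_rate_inject)
  have g: "g (?T x) = x" for x by (simp add: g_def inj)
  have dT: "(?T has_real_derivative rate (?p x)) (at x)" for x
    using has_derivative_primitive[OF continuous_rate, of 0 a b x] by simp
  have dg: "(g has_real_derivative hyp (?p x)) (at (?T x))" for x
  proof -
    have "(g has_real_derivative inverse (rate (?p x))) (at (?T x))"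
      by (rule has_field_derivative_inverse_strong[OF dT _ open_UNIV UNIV_I])
        (use rate_pos[of "?p x"] g in \<open>auto intro: continuous_primitive continuous_rate\<close>)
    moreover have "inverse (rate (?p x)) = hyp (?p x)"
      using rate_times_hyp[of "?p x"] rate_pos[of "?p x"] by (simp add: field_simps)
    ultimately show ?thesis by simp
  qed
  have Tg: "?T (g t) = t" if t: "t \<in> {0..T}" for t
  proof -
    have "\<exists>x\<ge>0. x \<le> X \<and> ?T x = t"
      by (rule IVT') (use t X in \<open>auto intro: continuous_primitive continuous_rate\<close>)
    thus ?thesis using g by auto
  qed
  have dg': "(g has_real_derivative hyp (?p (g t))) (at t within {0..T})" if "t \<in> {0..T}" for t
    using dg[of "g t"] by (simp add: Tg[OF that] has_field_derivative_at_within)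
  have g0: "g 0 = 0" using g[of 0] by simp
  define \<psi> where "\<psi> = (\<lambda>t. arsinh (?p (g t)))"
  have sinh_\<psi>: "sinh (\<psi> t) = ?p (g t)" for t by (simp add: \<psi>_def)
  have cosh_\<psi>: "cosh (\<psi> t) = hyp (?p (g t))" for t by (simp add: cosh_eq_hyp_sinh sinh_\<psi>)
  have chain: "((\<lambda>t. primitive n f a b (g t)) has_real_derivative (g t) ^ (2 * n) * f (?p (g t)) * hyp (?p (g t)))
      (at t within {0..T})" if "continuous_on UNIV f" "t \<in> {0..T}" for n f t
    by (rule DERIV_chain2[OF has_derivative_primitive[OF that(1)] dg'[OF that(2)]])
  have "extremal (\<psi>0, c) T \<psi> g (\<lambda>t. primitive 0 slope a b (g t)) (\<lambda>t. primitive 1 slope a b (g t) / 2)"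
    unfolding extremal_def prod.case
  proof (intro conjI ballI)
    show "\<psi> 0 = \<psi>0" by (simp add: \<psi>_def g0 a_def arsinh_sinh_real)
    fix t assume t: "t \<in> {0..T}"
    have "((\<lambda>t. ?p (g t)) has_real_derivative 2 * b * g t * hyp (?p (g t))) (at t within {0..T})"
      using dg'[OF t] by (auto intro!: derivative_eq_intros)
    from DERIV_chain2[OF arsinh_real_has_field_derivative this]
    have "(\<psi> has_real_derivative (1 / sqrt ((?p (g t))\<^sup>2 + 1)) * (2 * b * g t * hyp (?p (g t)))) (at t within {0..T})"
      by (simp add: \<psi>_def)
    moreover have "(1 / sqrt ((?p (g t))\<^sup>2 + 1)) * (2 * b * g t * hyp (?p (g t))) = c * g t"
    proof -
      have "sqrt ((?p (g t))\<^sup>2 + 1) = hyp (?p (g t))" by (simp add: hyp_def add.commute)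
      thus ?thesis using hyp_pos[of "?p (g t)"] by (simp add: b_def)
    qed
    ultimately show "(\<psi> has_real_derivative c * g t) (at t within {0..T})" by simp
    show "(g has_real_derivative cosh (\<psi> t)) (at t within {0..T})"
      unfolding cosh_\<psi> by (rule dg'[OF t])
    show "((\<lambda>t. primitive 0 slope a b (g t)) has_real_derivative sinh (\<psi> t)) (at t within {0..T})"
      using chain[OF continuous_slope t, of 0] by (simp add: sinh_\<psi> slope_times_hyp)
    show "((\<lambda>t. primitive 1 slope a b (g t) / 2) has_real_derivative (g t)\<^sup>2 / 2 * sinh (\<psi> t)) (at t within {0..T})"
      using DERIV_cdivide[OF chain[OF continuous_slope t, of 1], of 2]
      by (simp add: sinh_\<psi> slope_times_hyp mult.assoc)
  qed (simp_all add: g0)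
  thus ?thesis by (rule that)
qed

text \<open>
  In these coordinates the exponential map is algebraic in the moments; the multiplier \<open>b\<close> is
  half of the constant \<open>c\<close>.
\<close>
lemma Exp_eq_endpoint:
  assumes X: "0 < X" "primitive 0 rate (sinh \<psi>0) (c / 2) X = T"
  shows "Exp (\<psi>0, c) T = endpoint X (sinh \<psi>0, c / 2 * X\<^sup>2)"
proof -
  let ?a = "sinh \<psi>0" and ?b = "c / 2"
  have T: "0 \<le> T"
    using strict_mono_primitive_rate[OF X(1), of ?a ?b] X(2) by simp
  have val: "(x T, y T, z T) = (X, primitive 0 slope ?a ?b X, primitive 1 slope ?a ?b X / 2)"
    if "extremal (\<psi>0, c) T \<psi> x y z" for \<psi> x y z
  proof -
    note E = extremal_in_x[OF that, of T]
    have "x T = X" using E(1) T X(2) primitive_rate_inject[of ?a ?b "x T" X] by simp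
    thus ?thesis using E T by simp
  qed
  from extremal_exists[OF less_imp_le[OF X(1)] X(2)]
  obtain \<psi> x y z where ext: "extremal (\<psi>0, c) T \<psi> x y z" by blast
  have "Exp (\<psi>0, c) T = (X, primitive 0 slope ?a ?b X, primitive 1 slope ?a ?b X / 2)"
    unfolding Exp_def
  proof (rule the_equality)
    show "\<exists>\<psi> x y z. extremal (\<psi>0, c) T \<psi> x y z \<and>
        (X, primitive 0 slope ?a ?b X, primitive 1 slope ?a ?b X / 2) = (x T, y T, z T)"
      by (intro exI conjI, rule ext, rule val[OF ext, symmetric])
    fix q assume "\<exists>\<psi> x y z. extremal (\<psi>0, c) T \<psi> x y z \<and> q = (x T, y T, z T)"
    thus "q = (X, primitive 0 slope ?a ?b X, primitive 1 slope ?a ?b X / 2)"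
      using val by blast
  qed
  thus ?thesis
    by (simp add: endpoint_def primitive_def eval_nat_numeral algebra_simps)
qed

text \<open>
  The time at which a solution blows up is the improper integral of \<open>rate (a + b * s\<^sup>2)\<close> over the half line; the
  half-angle substitution turns it into a complete elliptic integral.
\<close>
lemma primitive_rate_elliptic:
  fixes a b :: real
  assumes b: "b \<noteq> 0"
  defines "s \<equiv> sqrt (1 + a\<^sup>2)"
  defines "k \<equiv> sqrt ((1 - sgn b * (a / s)) / 2)"
  defines "L \<equiv> elliptic_K k / sqrt (\<bar>b\<bar> * s)"
  shows "(primitive 0 rate a b \<longlongrightarrow> L) at_top" "primitive 0 rate a b X < L"
proof -
  have s: "0 < s" "s\<^sup>2 = 1 + a\<^sup>2" by (simp_all add: s_def)
  have "\<bar>a\<bar> < s"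
    unfolding s_def by (rule real_less_rsqrt) simp
  define r where "r = sgn b * (a / s)"
  have "\<bar>r\<bar> < 1"
    using \<open>\<bar>a\<bar> < s\<close> b s(1) by (simp add: r_def abs_mult abs_sgn_eq)
  hence r: "-1 < r" "r < 1" by auto
  have k2: "k\<^sup>2 = (1 - r) / 2"
    unfolding k_def r_def[symmetric] using r by (intro real_sqrt_pow2) simp
  hence k1: "k\<^sup>2 < 1" using r by simp
  have sr: "s * r = sgn b * a" using s(1) by (simp add: r_def)
  define \<Delta> where "\<Delta> = (\<lambda>\<theta>. 1 - k\<^sup>2 * (sin \<theta>)\<^sup>2)"
  have \<Delta>: "0 < \<Delta> \<theta>" for \<theta>
  proof -
    have "k\<^sup>2 * (sin \<theta>)\<^sup>2 \<le> k\<^sup>2 * 1"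
      by (intro mult_left_mono) (simp_all add: abs_square_le_1)
    thus ?thesis using k1 by (simp add: \<Delta>_def)
  qed
  define f where "f = (\<lambda>\<theta>. 1 / sqrt (\<Delta> \<theta>))"
  have f: "0 < f \<theta>" for \<theta> using \<Delta> by (simp add: f_def)
  have nz: "\<Delta> \<theta> \<noteq> 0" for \<theta> using \<Delta>[of \<theta>] by simp
  have cf: "continuous_on UNIV f"
    unfolding f_def using nz by (intro continuous_intros) (auto simp: \<Delta>_def intro!: continuous_intros)
  from ex_antiderivative[OF cf]
  obtain A where A: "\<And>\<theta>. (A has_real_derivative f \<theta>) (at \<theta>)" "A 0 = 0" by blast
  have A_mono: "A \<theta> < A \<theta>'" if "\<theta> < \<theta>'" for \<theta> \<theta>'
    by (rule DERIV_pos_imp_increasing[OF that]) (use A(1) f in blast)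
  \<comment> \<open>reflection in the symmetry axis of the sine\<close>
  \<comment> \<open>The integrand is symmetric about \<open>pi / 2\<close>.\<close>
  have "A pi = 2 * elliptic_K k"
  proof -
    have "((\<lambda>\<theta>. A \<theta> + A (pi - \<theta>)) has_real_derivative f \<theta> + f (pi - \<theta>) * (0 - 1)) (at \<theta>)" for \<theta>
      by (intro DERIV_add A(1) DERIV_chain2[OF A(1)] DERIV_diff DERIV_const DERIV_ident)
    hence "((\<lambda>\<theta>. A \<theta> + A (pi - \<theta>)) has_real_derivative 0) (at \<theta>)" for \<theta>
      by (simp add: f_def \<Delta>_def)
    hence "A pi = A (pi / 2) + A (pi / 2)"
      using DERIV_isconst_all[of "\<lambda>\<theta>. A \<theta> + A (pi - \<theta>)" 0 "pi / 2"] by (simp add: A(2))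
    moreover have "(f has_integral A (pi / 2) - A 0) {0..pi/2}"
      by (rule fundamental_theorem_of_calculus)
        (use A(1) in \<open>auto simp: has_real_derivative_iff_has_vector_derivative has_vector_derivative_at_within\<close>)
    ultimately show ?thesis
      by (simp add: elliptic_K_def integral_unique f_def \<Delta>_def A(2))
  qed
  define \<mu> where "\<mu> = sqrt (s / \<bar>b\<bar>)"
  have \<mu>: "0 < \<mu>" "\<mu>\<^sup>2 = s / \<bar>b\<bar>" using s b by (simp_all add: \<mu>_def)
  define C where "C = 1 / (2 * \<bar>b\<bar> * \<mu>)"
  have C: "0 < C" using \<mu> b by (simp add: C_def)
  have CL: "C * A pi = L"
  proof -
    have "\<bar>b\<bar> * \<mu> = sqrt (\<bar>b\<bar> * s)"
    proof (rule real_sqrt_unique[symmetric])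
      have "(\<bar>b\<bar> * \<mu>)\<^sup>2 = \<bar>b\<bar> * \<bar>b\<bar> * (s / \<bar>b\<bar>)"
        by (simp only: power_mult_distrib \<mu>(2) power2_eq_square[of "\<bar>b\<bar>"])
      thus "(\<bar>b\<bar> * \<mu>)\<^sup>2 = \<bar>b\<bar> * s"
        using b by (cases "b > 0") simp_all
    qed (use \<mu>(1) in simp)
    thus ?thesis
      by (simp add: C_def L_def \<open>A pi = 2 * elliptic_K k\<close> mult.assoc)
  qed
  \<comment> \<open>Both sides vanish at 0 and have the same derivative: this is the substitution
    \<open>X = \<mu> * tan (\<theta> / 2)\<close>, where \<open>\<mu>\<close> is chosen such that \<open>1 + (a + b * X\<^sup>2)\<^sup>2\<close> becomes a
    palindromic quartic in \<open>tan (\<theta> / 2)\<close>.\<close>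
  have T_eq: "primitive 0 rate a b X = C * A (2 * arctan (X / \<mu>))" for X
  proof -
    have key: "C * (f (2 * arctan (X / \<mu>)) * (2 * (inverse (1 + (X / \<mu>)\<^sup>2) * (1 / \<mu>)))) = rate (a + b * X\<^sup>2)" for X
    proof -
      define \<tau> where "\<tau> = X / \<mu>"
      define w where "w = 1 + \<tau>\<^sup>2"
      have w: "0 < w" by (simp add: w_def)
      have "sqrt w * sqrt w = w" using w by simp
      hence sin2: "sin (2 * arctan \<tau>) = 2 * \<tau> / w"
        by (simp add: sin_double sin_arctan cos_arctan w_def[symmetric])
      have X2: "X\<^sup>2 = \<tau>\<^sup>2 * (s / \<bar>b\<bar>)"
        using \<mu> by (simp add: \<tau>_def power_divide flip: \<mu>(2))
      have bX: "b * X\<^sup>2 = sgn b * s * \<tau>\<^sup>2"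
        using b by (simp add: X2 sgn_if)
      have sg: "sgn b * sgn b = 1" using b by (simp add: sgn_if)
      have "(s * w)\<^sup>2 * \<Delta> (2 * arctan \<tau>) = s\<^sup>2 * (w\<^sup>2 - 4 * k\<^sup>2 * \<tau>\<^sup>2)"
        using w unfolding \<Delta>_def sin2 by (simp add: field_simps power2_eq_square)
      also have "\<dots> = s\<^sup>2 * (w\<^sup>2 - 2 * \<tau>\<^sup>2) + 2 * (s * (s * r)) * \<tau>\<^sup>2"
        unfolding k2 by (simp add: field_simps power2_eq_square)
      also have "\<dots> = 1 + a\<^sup>2 + 2 * a * (b * X\<^sup>2) + (sgn b * sgn b) * s\<^sup>2 * (\<tau>\<^sup>2 * \<tau>\<^sup>2)"
        unfolding bX sg w_def sr s(2)[symmetric] by (simp add: algebra_simps power2_eq_square)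
      also have "\<dots> = 1 + (a + b * X\<^sup>2)\<^sup>2"
        unfolding bX by (simp add: algebra_simps power2_eq_square)
      finally have "sqrt (1 + (a + b * X\<^sup>2)\<^sup>2) = s * w * sqrt (\<Delta> (2 * arctan \<tau>))"
        using s w by (metis abs_of_pos mult_pos_pos real_sqrt_abs real_sqrt_mult)
      hence "rate (a + b * X\<^sup>2) = f (2 * arctan \<tau>) * (1 / (s * w))"
        by (simp add: rate_def f_def)
      moreover have "C * (2 * (inverse w * (1 / \<mu>))) = 1 / (s * w)"
      proof -
        have "C * (2 * (inverse w * (1 / \<mu>))) = 1 / (\<bar>b\<bar> * \<mu>\<^sup>2 * w)"
          using \<mu>(1) b w by (simp add: C_def field_simps power2_eq_square)
        thus ?thesis using b by (simp add: \<mu>(2))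
      qed
      moreover have "C * (f \<theta> * (2 * (inverse w * (1 / \<mu>)))) = f \<theta> * (C * (2 * (inverse w * (1 / \<mu>))))" for \<theta>
        by (simp only: ac_simps)
      ultimately show ?thesis
        unfolding \<tau>_def[symmetric] w_def[symmetric] by (simp only:)
    qed
    have "((\<lambda>X. primitive 0 rate a b X - C * A (2 * arctan (X / \<mu>))) has_real_derivative 0) (at X)" for X
    proof -
      have "((\<lambda>X. C * A (2 * arctan (X / \<mu>))) has_real_derivative
          C * (f (2 * arctan (X / \<mu>)) * (2 * (inverse (1 + (X / \<mu>)\<^sup>2) * (1 / \<mu>))))) (at X)"
        by (intro DERIV_cmult DERIV_chain2[OF A(1)] DERIV_chain2[OF DERIV_arctan] DERIV_cdivide DERIV_ident)
      from DERIV_diff[OF has_derivative_primitive[OF continuous_rate, of 0 a b X] this]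
      show ?thesis unfolding key by simp
    qed
    hence "primitive 0 rate a b X - C * A (2 * arctan (X / \<mu>)) = primitive 0 rate a b 0 - C * A (2 * arctan (0 / \<mu>))"
      by (intro DERIV_isconst_all) blast
    thus ?thesis by (simp add: A(2))
  qed
  show "primitive 0 rate a b X < L"
  proof -
    have "A (2 * arctan (X / \<mu>)) < A pi"
      using arctan_ubound[of "X / \<mu>"] by (intro A_mono) simp
    thus ?thesis using C by (simp add: T_eq CL[symmetric])
  qed
  show "(primitive 0 rate a b \<longlongrightarrow> L) at_top"
  proof -
    have "filterlim (\<lambda>X. X / \<mu>) at_top at_top"
      using filterlim_tendsto_pos_mult_at_top[OF tendsto_const _ filterlim_ident, of "inverse \<mu>"] \<mu>(1)
      by (simp add: field_simps)
    from filterlim_compose[OF tendsto_arctan_at_top this]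
    have "((\<lambda>X. 2 * arctan (X / \<mu>)) \<longlongrightarrow> 2 * (pi / 2)) at_top"
      by (intro tendsto_mult_left)
    hence "((\<lambda>X. A (2 * arctan (X / \<mu>))) \<longlongrightarrow> A pi) at_top"
      using isCont_tendsto_compose[OF DERIV_isCont[OF A(1)]] by simp
    hence "((\<lambda>X. C * A (2 * arctan (X / \<mu>))) \<longlongrightarrow> C * A pi) at_top"
      by (intro tendsto_mult_left)
    thus ?thesis by (simp add: T_eq[abs_def] CL)
  qed
qed

text \<open>
  A solution lives longer than \<open>T\<close> exactly if time \<open>T\<close> is reached at a finite value of \<open>x\<close>.
\<close>
lemma lifetime_gt_iff:
  assumes T: "0 < T"
  shows "lifetime (\<psi>0, c) > ereal T \<longleftrightarrow> (\<exists>X>0. primitive 0 rate (sinh \<psi>0) (c / 2) X = T)"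
proof (cases "c = 0")
  case True
  have "primitive 0 rate (sinh \<psi>0) 0 (T / rate (sinh \<psi>0)) = T"
    using rate_pos[of "sinh \<psi>0"] by (simp add: primitive_def moment_def)
  hence "\<exists>X>0. primitive 0 rate (sinh \<psi>0) (c / 2) X = T"
    using T rate_pos[of "sinh \<psi>0"] True by (intro exI[of _ "T / rate (sinh \<psi>0)"]) simp
  thus ?thesis using True by (simp add: lifetime_def)
next
  case False
  define a b where "a = sinh \<psi>0" and "b = c / 2"
  define s where "s = sqrt (1 + a\<^sup>2)"
  define k where "k = sqrt ((1 - sgn b * (a / s)) / 2)"
  define L where "L = elliptic_K k / sqrt (\<bar>b\<bar> * s)"
  have b: "b \<noteq> 0" using False by (simp add: b_def)
  note lim = primitive_rate_elliptic(1)[OF b, of a, folded s_def, folded k_def, folded L_def]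
    and less = primitive_rate_elliptic(2)[OF b, of a, folded s_def, folded k_def, folded L_def]
  have "lifetime (\<psi>0, c) = ereal L"
  proof -
    have "sgn c = sgn b" by (simp add: b_def sgn_if)
    hence "sqrt (1 / 2 * (1 + sgn c * (- a / s))) = k"
      by (simp add: k_def field_simps)
    moreover have "sqrt (s / 2) * sqrt \<bar>c\<bar> = sqrt (\<bar>b\<bar> * s)"
      by (simp add: b_def real_sqrt_mult[symmetric] field_simps)
    ultimately show ?thesis
      using False by (simp add: lifetime_def Let_def L_def s_def a_def[symmetric] del: real_sqrt_mult)
  qed
  moreover have "T < L \<longleftrightarrow> (\<exists>X>0. primitive 0 rate a b X = T)"
  proof
    assume "T < L"
    hence "eventually (\<lambda>X. T < primitive 0 rate a b X) at_top"
      by (rule order_tendstoD(1)[OF lim])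
    then obtain N where N: "\<And>X. N \<le> X \<Longrightarrow> T < primitive 0 rate a b X"
      by (auto simp: eventually_at_top_linorder)
    have "\<exists>X\<ge>0. X \<le> max N 0 \<and> primitive 0 rate a b X = T"
      by (rule IVT') (use T N[of "max N 0"] in \<open>auto intro: continuous_primitive continuous_rate\<close>)
    then obtain X where X: "0 \<le> X" "primitive 0 rate a b X = T" by blast
    hence "X \<noteq> 0" using T by auto
    thus "\<exists>X>0. primitive 0 rate a b X = T" using X by (intro exI[of _ X]) simp
  next
    assume "\<exists>X>0. primitive 0 rate a b X = T"
    thus "T < L" using less by auto
  qed
  ultimately show ?thesis by (simp add: a_def b_def)
qed

lemma lifetime_gt_1_iff:
  "lifetime (\<psi>0, c) > 1 \<longleftrightarrow> (\<exists>X>0. primitive 0 rate (sinh \<psi>0) (c / 2) X = 1)"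
  unfolding one_ereal_def by (rule lifetime_gt_iff) simp

lemma range_sphere_point_eq_Exp: "range sphere_point = {Exp lam 1 | lam. lifetime lam > 1}"
proof (intro antisym subsetI)
  fix q assume "q \<in> range sphere_point"
  then obtain a e where q: "q = sphere_point (a, e)" by auto
  define X where "X = 1 / moment 0 rate (a, e)"
  have X: "0 < X" using moment_rate_pos by (simp add: X_def)
  define \<psi>0 c where "\<psi>0 = arsinh a" and "c = 2 * e / X\<^sup>2"
  have c: "c / 2 = e / X\<^sup>2" "c / 2 * X\<^sup>2 = e" using X by (simp_all add: c_def)
  have a: "sinh \<psi>0 = a" by (simp add: \<psi>0_def)
  have T: "primitive 0 rate (sinh \<psi>0) (c / 2) X = 1"
    using X moment_rate_pos[of "(a, e)"] unfolding a c(1) by (simp add: primitive_eq_moment) (simp add: X_def)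
  have "Exp (\<psi>0, c) 1 = endpoint X (a, e)"
    using Exp_eq_endpoint[OF X T] unfolding a c(2) .
  hence "Exp (\<psi>0, c) 1 = q"
    by (simp add: q sphere_point_def X_def)
  moreover have "lifetime (\<psi>0, c) > 1"
    unfolding lifetime_gt_1_iff using X T by blast
  ultimately show "q \<in> {Exp lam 1 | lam. lifetime lam > 1}" by blast
next
  fix q assume "q \<in> {Exp lam 1 | lam. lifetime lam > 1}"
  then obtain \<psi>0 c where q: "q = Exp (\<psi>0, c) 1" and "lifetime (\<psi>0, c) > 1" by auto
  then obtain X where X: "0 < X" "primitive 0 rate (sinh \<psi>0) (c / 2) X = 1"
    unfolding lifetime_gt_1_iff by blast
  have "X = 1 / moment 0 rate (sinh \<psi>0, c / 2 * X\<^sup>2)"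
    using X moment_rate_pos[of "(sinh \<psi>0, c / 2 * X\<^sup>2)"] by (simp add: primitive_def field_simps)
  hence "q = sphere_point (sinh \<psi>0, c / 2 * X\<^sup>2)"
    using Exp_eq_endpoint[OF X] by (simp add: q sphere_point_def)
  thus "q \<in> range sphere_point" by simp
qed

section \<open>Analytic coordinates\<close>

text \<open>
  Three variables suffice: functions of two variables are restrictions to a coordinate plane.
\<close>
definition separately_holomorphic_on :: "(complex \<times> complex \<times> complex \<Rightarrow> complex) \<Rightarrow> (complex \<times> complex \<times> complex) set \<Rightarrow> bool" where
  "separately_holomorphic_on h W \<longleftrightarrow> continuous_on W h \<and>
     (\<forall>z w v. (z, w, v) \<in> W \<longrightarrow> (\<lambda>u. h (u, w, v)) field_differentiable at z \<and>
        (\<lambda>u. h (z, u, v)) field_differentiable at w \<and> (\<lambda>u. h (z, w, u)) field_differentiable at v)"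

lemma separately_holomorphic_on_const: "separately_holomorphic_on (\<lambda>p. c) W"
  by (simp add: separately_holomorphic_on_def continuous_on_const)

lemma separately_holomorphic_on_coords:
  "separately_holomorphic_on (\<lambda>p. fst p) W"
  "separately_holomorphic_on (\<lambda>p. fst (snd p)) W"
  "separately_holomorphic_on (\<lambda>p. snd (snd p)) W"
  by (simp_all add: separately_holomorphic_on_def continuous_on_fst continuous_on_snd continuous_on_id
      field_differentiable_ident)

lemma separately_holomorphic_on_add:
  assumes "separately_holomorphic_on f W" "separately_holomorphic_on g W"
  shows "separately_holomorphic_on (\<lambda>p. f p + g p) W"
  using assms unfolding separately_holomorphic_on_def
  by (simp add: continuous_on_add field_differentiable_add)

lemma separately_holomorphic_on_diff:
  assumes "separately_holomorphic_on f W" "separately_holomorphic_on g W"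
  shows "separately_holomorphic_on (\<lambda>p. f p - g p) W"
  using assms unfolding separately_holomorphic_on_def
  by (simp add: continuous_on_diff field_differentiable_diff)

lemma separately_holomorphic_on_mult:
  assumes "separately_holomorphic_on f W" "separately_holomorphic_on g W"
  shows "separately_holomorphic_on (\<lambda>p. f p * g p) W"
  using assms unfolding separately_holomorphic_on_def
  by (simp add: continuous_on_mult field_differentiable_mult)

lemma separately_holomorphic_on_power:
  assumes "separately_holomorphic_on f W"
  shows "separately_holomorphic_on (\<lambda>p. f p ^ n) W"
  by (induction n)
    (simp_all add: separately_holomorphic_on_const separately_holomorphic_on_mult assms)

lemma separately_holomorphic_on_divide:
  assumes "separately_holomorphic_on f W" "separately_holomorphic_on g W" "\<And>p. p \<in> W \<Longrightarrow> g p \<noteq> 0"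
  shows "separately_holomorphic_on (\<lambda>p. f p / g p) W"
  using assms unfolding separately_holomorphic_on_def
  by (simp add: continuous_on_divide field_differentiable_divide)

lemma field_differentiable_compose_pair:
  assumes "(m has_derivative (\<lambda>h. A * fst h + B * snd h)) (at (p z, q z))"
    and "p field_differentiable at z" "q field_differentiable at z"
  shows "(\<lambda>u. m (p u, q u) :: complex) field_differentiable at z"
proof -
  obtain p' q' where "(p has_field_derivative p') (at z)" "(q has_field_derivative q') (at z)"
    using assms(2,3) unfolding field_differentiable_def by blast
  hence "((\<lambda>u. (p u, q u)) has_derivative (\<lambda>h. (p' * h, q' * h))) (at z)"
    unfolding has_field_derivative_def by (rule has_derivative_Pair)
  from has_derivative_compose[OF this assms(1)]
  have "((\<lambda>u. m (p u, q u)) has_derivative (\<lambda>h. (A * p' + B * q') * h)) (at z)"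
    by (rule has_derivative_eq_rhs) (simp add: fun_eq_iff algebra_simps)
  thus ?thesis
    unfolding field_differentiable_def has_field_derivative_def by blast
qed

text \<open>
  Composition needs a total complex derivative of the outer function \<open>m\<close>, which the moments and
  the local inverse of \<open>cslopes\<close> have.
\<close>
lemma separately_holomorphic_on_compose_pair:
  assumes m: "\<And>y. y \<in> V \<Longrightarrow> \<exists>A B. (m has_derivative (\<lambda>h. A * fst h + B * snd h)) (at y)"
    and p: "separately_holomorphic_on p W" and q: "separately_holomorphic_on q W"
    and V: "\<And>x. x \<in> W \<Longrightarrow> (p x, q x) \<in> V"
  shows "separately_holomorphic_on (\<lambda>x. m (p x, q x) :: complex) W"
  unfolding separately_holomorphic_on_def
proof (intro conjI allI impI)
  have "continuous_on V m"
    by (rule continuous_at_imp_continuous_on) (use m has_derivative_continuous in blast)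
  thus "continuous_on W (\<lambda>x. m (p x, q x))"
    by (rule continuous_on_compose2)
      (use p q V in \<open>auto simp: separately_holomorphic_on_def intro: continuous_on_Pair\<close>)
  fix z w v assume x: "(z, w, v) \<in> W"
  obtain A B where AB: "(m has_derivative (\<lambda>h. A * fst h + B * snd h)) (at (p (z, w, v), q (z, w, v)))"
    using m[OF V[OF x]] by blast
  note pq = p[unfolded separately_holomorphic_on_def] q[unfolded separately_holomorphic_on_def]
  show "(\<lambda>u. m (p (u, w, v), q (u, w, v))) field_differentiable at z"
    by (rule field_differentiable_compose_pair[where p = "\<lambda>u. p (u, w, v)" and q = "\<lambda>u. q (u, w, v)", OF AB])
      (use pq x in simp_all)
  show "(\<lambda>u. m (p (z, u, v), q (z, u, v))) field_differentiable at w"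
    by (rule field_differentiable_compose_pair[where p = "\<lambda>u. p (z, u, v)" and q = "\<lambda>u. q (z, u, v)", OF AB])
      (use pq x in simp_all)
  show "(\<lambda>u. m (p (z, w, u), q (z, w, u))) field_differentiable at v"
    by (rule field_differentiable_compose_pair[where p = "\<lambda>u. p (z, w, u)" and q = "\<lambda>u. q (z, w, u)", OF AB])
      (use pq x in simp_all)
qed

lemma real_analytic_at_separately_holomorphic:
  fixes f :: "real \<times> real \<times> real \<Rightarrow> 'b::euclidean_space"
  assumes W: "open W" "(of_real a1, of_real a2, of_real a3) \<in> W"
    and h: "\<And>b. b \<in> Basis \<Longrightarrow> separately_holomorphic_on (h b) W"
    and ext: "\<And>b x y z. \<lbrakk>b \<in> Basis; (of_real x, of_real y, of_real z) \<in> W\<rbrakk> \<Longrightarrow>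
      h b (of_real x, of_real y, of_real z) = of_real (f (x, y, z) \<bullet> b)"
  shows "real_analytic_at f (a1, a2, a3)"
    and "a1 = 0 \<Longrightarrow> real_analytic_at (\<lambda>v. f (0, v)) (a2, a3)"
proof -
  show "real_analytic_at f (a1, a2, a3)"
    by (rule real_analytic_at_tripleI[OF W, where G = h])
      (use h ext in \<open>simp_all add: separately_holomorphic_on_def\<close>)
  assume [simp]: "a1 = 0"
  let ?W = "(\<lambda>p. (0, p)) -` W"
  show "real_analytic_at (\<lambda>v. f (0, v)) (a2, a3)"
  proof (rule real_analytic_at_pairI[where W = ?W and G = "\<lambda>b p. h b (0, p)"])
    show "open ?W"
      by (intro open_vimage W(1) continuous_on_Pair continuous_on_const continuous_on_id)
    show "(of_real a2, of_real a3) \<in> ?W" using W(2) by simp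
    fix b :: 'b assume b: "b \<in> Basis"
    note hb = h[OF b, unfolded separately_holomorphic_on_def]
    show "continuous_on ?W (\<lambda>p. h b (0, p))"
      by (rule continuous_on_compose2[OF conjunct1[OF hb]])
        (auto intro: continuous_on_Pair continuous_on_const continuous_on_id)
    show "(\<lambda>u. h b (0, u, w)) field_differentiable at z"
      "(\<lambda>u. h b (0, z, u)) field_differentiable at w" if "(z, w) \<in> ?W" for z w
      using hb that by simp_all
    show "f (0, x, y) \<bullet> b = Re (h b (0, of_real x, of_real y))"
      if "(complex_of_real x, complex_of_real y) \<in> ?W" for x y
      using ext[OF b, of 0 x y] that by simp
  qed
qed

lemma moment_complex_linear_derivative:
  assumes "v \<in> chords strip"
  shows "\<exists>A B. (moment n cslope has_derivative (\<lambda>h. A * fst h + B * snd h)) (at v)"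
    and "\<exists>A B. (moment n crate has_derivative (\<lambda>h. A * fst h + B * snd h)) (at v)"
proof -
  have c: "continuous_on strip (\<lambda>p. crate p ^ 3)" "continuous_on strip (\<lambda>p. - p * crate p ^ 3)"
    by (intro continuous_on_mult continuous_on_minus continuous_on_id continuous_on_power continuous_crate)+
  show "\<exists>A B. (moment n cslope has_derivative (\<lambda>h. A * fst h + B * snd h)) (at v)"
    by (intro exI, rule has_derivative_moment[OF open_strip convex_strip has_derivative_cslope c(1) assms])
  show "\<exists>A B. (moment n crate has_derivative (\<lambda>h. A * fst h + B * snd h)) (at v)"
    by (intro exI, rule has_derivative_moment[OF open_strip convex_strip has_derivative_crate c(2) assms])
qed

text \<open>
  Dilations of the sphere: \<open>cone_point (t, v)\<close> has distance \<open>1 + t\<close> for \<open>t > -1\<close>, so \<open>(t, v)\<close> are coordinates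
  on the set of points at positive distance in which the sphere is the plane \<open>t = 0\<close>.
\<close>
definition cone_point :: "real \<times> real \<times> real \<Rightarrow> point" where
  "cone_point p = endpoint ((1 + fst p) / moment 0 rate (snd p)) (snd p)"

text \<open>
  The inverse of \<open>cone_point\<close>. The parameters \<open>v\<close> are recovered from the dilation invariants \<open>y / x\<close> and \<open>z / x\<^sup>3\<close>.
\<close>
definition cone_coords :: "point \<Rightarrow> real \<times> real \<times> real" where
  "cone_coords q = (let v = inv slopes (fst (snd q) / fst q, 2 * snd (snd q) / fst q ^ 3)
     in (fst q * moment 0 rate v - 1, v))"

lemma sphere_point_eq_cone_point: "sphere_point v = cone_point (0, v)"
  by (simp add: sphere_point_def cone_point_def)

lemma cone_coords_cone_point:
  assumes "-1 < fst p"
  shows "cone_coords (cone_point p) = p"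
proof -
  define x where "x = (1 + fst p) / moment 0 rate (snd p)"
  have x: "0 < x" using assms moment_rate_pos[of "snd p"] by (simp add: x_def)
  have q: "cone_point p = (x, x * moment 0 slope (snd p), x ^ 3 / 2 * moment 1 slope (snd p))"
    by (simp add: cone_point_def endpoint_def x_def)
  have "(x * moment 0 slope (snd p) / x, 2 * (x ^ 3 / 2 * moment 1 slope (snd p)) / x ^ 3) = slopes (snd p)"
    using x by (simp add: slopes_def)
  moreover have "inv slopes (slopes (snd p)) = snd p"
    by (rule inv_f_f[OF inj_slopes])
  moreover have "x * moment 0 rate (snd p) - 1 = fst p"
    using moment_rate_pos[of "snd p"] by (simp add: x_def)
  ultimately show ?thesis
    unfolding cone_coords_def q fst_conv snd_conv Let_def by simp
qed

lemma cone_point_analytic: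
  "real_analytic_at cone_point p" "fst p = 0 \<Longrightarrow> real_analytic_at (\<lambda>v. cone_point (0, v)) (snd p)"
proof -
  obtain \<tau> a e where p: "p = (\<tau>, a, e)" by (metis prod.exhaust)
  define cI where "cI = (\<lambda>p :: complex \<times> complex \<times> complex. moment 0 crate (fst (snd p), snd (snd p)))"
  define cJ where "cJ = (\<lambda>n (p :: complex \<times> complex \<times> complex). moment n cslope (fst (snd p), snd (snd p)))"
  define W0 where "W0 = (snd -` chords strip :: (complex \<times> complex \<times> complex) set)"
  define W where "W = W0 \<inter> cI -` (- {0})"
  have oW0: "open W0"
    unfolding W0_def by (intro open_vimage open_chords open_strip continuous_on_snd continuous_on_id)
  have hI0: "separately_holomorphic_on cI W0"
    unfolding cI_def
    by (rule separately_holomorphic_on_compose_pair[OF moment_complex_linear_derivative(2)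
          separately_holomorphic_on_coords(2,3)]) (auto simp: W0_def)
  have oW: "open W"
    unfolding W_def
    by (rule continuous_open_preimage) (use hI0 oW0 in \<open>auto simp: separately_holomorphic_on_def\<close>)
  have hI: "separately_holomorphic_on cI W"
    unfolding cI_def
    by (rule separately_holomorphic_on_compose_pair[OF moment_complex_linear_derivative(2)
          separately_holomorphic_on_coords(2,3)]) (auto simp: W0_def W_def)
  have hJ: "separately_holomorphic_on (cJ n) W" for n
    unfolding cJ_def
    by (rule separately_holomorphic_on_compose_pair[OF moment_complex_linear_derivative(1)
          separately_holomorphic_on_coords(2,3)]) (auto simp: W0_def W_def)
  define cX where "cX = (\<lambda>p. (1 + fst p) / cI p)"
  have hX: "separately_holomorphic_on cX W"
    unfolding cX_def
    by (intro separately_holomorphic_on_divide separately_holomorphic_on_add separately_holomorphic_on_const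
        separately_holomorphic_on_coords hI) (simp add: W_def)
  define h where "h = (\<lambda>(b :: point) p. cX p * of_real (fst b) + (cX p * cJ 0 p * of_real (fst (snd b))
      + cX p ^ 3 / 2 * cJ 1 p * of_real (snd (snd b))))"
  have hh: "separately_holomorphic_on (h b) W" for b
    unfolding h_def
    by (intro separately_holomorphic_on_add separately_holomorphic_on_mult separately_holomorphic_on_divide
        separately_holomorphic_on_power separately_holomorphic_on_const hX hJ) simp
  have cI_real: "cI (of_real t, of_real a, of_real e) = of_real (moment 0 rate (a, e))" for t a e
    by (simp add: cI_def moment_of_real[OF crate_of_real continuous_rate])
  have cJ_real: "cJ n (of_real t, of_real a, of_real e) = of_real (moment n slope (a, e))" for n t a e
    by (simp add: cJ_def moment_of_real[OF cslope_of_real continuous_slope])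
  have ext: "h b (of_real t, of_real a, of_real e) = of_real (cone_point (t, a, e) \<bullet> b)" for b t a e
    by (cases b) (simp add: h_def cX_def cI_real cJ_real cone_point_def endpoint_def inner_prod_def)
  have mem: "(of_real \<tau>, of_real a, of_real e) \<in> W"
    using moment_rate_pos[of "(a, e)"] by (simp add: W_def W0_def cI_real chords_def flip: of_real_add)
  show "real_analytic_at cone_point p"
    unfolding p by (rule real_analytic_at_separately_holomorphic(1)[OF oW mem hh ext])
  assume "fst p = 0"
  thus "real_analytic_at (\<lambda>v. cone_point (0, v)) (snd p)"
    using real_analytic_at_separately_holomorphic(2)[OF oW mem hh ext] by (simp add: p)
qed

lemma cone_coords_analytic:
  assumes p: "-1 < fst p"
  shows "real_analytic_at cone_coords (cone_point p)"
    and "real_analytic_at (\<lambda>q. snd (cone_coords q)) (cone_point p)"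
proof -
  define x where "x = (1 + fst p) / moment 0 rate (snd p)"
  have x: "0 < x" using p moment_rate_pos[of "snd p"] by (simp add: x_def)
  define y where "y = x * moment 0 slope (snd p)"
  define z where "z = x ^ 3 / 2 * moment 1 slope (snd p)"
  have q: "cone_point p = (x, y, z)"
    by (simp add: cone_point_def endpoint_def x_def y_def z_def)
  have sl: "slopes (snd p) = (y / x, 2 * z / x ^ 3)"
    using x by (simp add: slopes_def y_def z_def)
  obtain V G where V: "open V" "(of_real (fst (slopes (snd p))), of_real (snd (slopes (snd p)))) \<in> V"
    and G1: "\<And>y. y \<in> V \<Longrightarrow> G y \<in> chords strip"
    and G2: "\<And>y. y \<in> V \<Longrightarrow> \<exists>A B C D. (G has_derivative
        (\<lambda>h. (A * fst h + B * snd h, C * fst h + D * snd h))) (at y)"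
    and G3: "\<And>y1 y2. (of_real y1, of_real y2) \<in> V \<Longrightarrow>
        \<exists>a e. slopes (a, e) = (y1, y2) \<and> G (of_real y1, of_real y2) = (of_real a, of_real e)"
    by (rule cslopes_local_inverse[of "snd p"]) blast
  define r where "r = (\<lambda>q :: complex \<times> complex \<times> complex. (fst (snd q) / fst q, 2 * snd (snd q) / fst q ^ 3))"
  define W0 where "W0 = (fst -` (- {0}) :: (complex \<times> complex \<times> complex) set)"
  define W where "W = W0 \<inter> r -` V"
  have oW0: "open W0"
    unfolding W0_def by (intro open_vimage open_Compl closed_singleton continuous_on_fst continuous_on_id)
  have cr: "continuous_on W0 r"
    unfolding r_def
    by (intro continuous_on_Pair continuous_on_divide continuous_on_mult continuous_on_power continuous_on_const
        continuous_on_fst continuous_on_snd continuous_on_id) (auto simp: W0_def)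
  have oW: "open W"
    unfolding W_def by (rule continuous_open_preimage[OF cr oW0 V(1)])
  note sh = separately_holomorphic_on_divide separately_holomorphic_on_mult separately_holomorphic_on_power
    separately_holomorphic_on_const separately_holomorphic_on_coords
  have h_r: "separately_holomorphic_on (\<lambda>q. fst (snd q) / fst q) W"
    "separately_holomorphic_on (\<lambda>q. 2 * snd (snd q) / fst q ^ 3) W"
    by (intro sh; simp add: W_def W0_def)+
  have rV: "(fst (snd q) / fst q, 2 * snd (snd q) / fst q ^ 3) \<in> V" if "q \<in> W" for q
    using that by (simp add: W_def r_def)
  have dG: "\<exists>A B. ((\<lambda>y. fst (G y)) has_derivative (\<lambda>h. A * fst h + B * snd h)) (at y)"
    "\<exists>A B. ((\<lambda>y. snd (G y)) has_derivative (\<lambda>h. A * fst h + B * snd h)) (at y)" if y: "y \<in> V" for y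
  proof -
    from G2[OF y] obtain A B C D where D: "(G has_derivative
        (\<lambda>h. (A * fst h + B * snd h, C * fst h + D * snd h))) (at y)" by blast
    show "\<exists>A B. ((\<lambda>y. fst (G y)) has_derivative (\<lambda>h. A * fst h + B * snd h)) (at y)"
      using has_derivative_fst[OF D] by auto
    show "\<exists>A B. ((\<lambda>y. snd (G y)) has_derivative (\<lambda>h. A * fst h + B * snd h)) (at y)"
      using has_derivative_snd[OF D] by auto
  qed
  define g1 where "g1 = (\<lambda>q. fst (G (fst (snd q) / fst q, 2 * snd (snd q) / fst q ^ 3)))"
  define g2 where "g2 = (\<lambda>q. snd (G (fst (snd q) / fst q, 2 * snd (snd q) / fst q ^ 3)))"
  have hg1: "separately_holomorphic_on g1 W"
    unfolding g1_def
    by (rule separately_holomorphic_on_compose_pair[where m = "\<lambda>y. fst (G y)", OF dG(1) h_r rV])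
  have hg2: "separately_holomorphic_on g2 W"
    unfolding g2_def
    by (rule separately_holomorphic_on_compose_pair[where m = "\<lambda>y. snd (G y)", OF dG(2) h_r rV])
  have gmem: "(g1 q, g2 q) \<in> chords strip" if "q \<in> W" for q
    using G1[OF rV[OF that]] by (simp add: g1_def g2_def)
  define g0 where "g0 = (\<lambda>q. fst q * moment 0 crate (g1 q, g2 q) - 1)"
  have hg0: "separately_holomorphic_on g0 W"
    unfolding g0_def
    by (intro separately_holomorphic_on_diff separately_holomorphic_on_mult separately_holomorphic_on_const
        separately_holomorphic_on_coords
        separately_holomorphic_on_compose_pair[OF moment_complex_linear_derivative(2) hg1 hg2 gmem])
  have real: "g0 (of_real x, of_real y, of_real z) = of_real (fst (cone_coords (x, y, z))) \<and>
      g1 (of_real x, of_real y, of_real z) = of_real (fst (snd (cone_coords (x, y, z)))) \<and>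
      g2 (of_real x, of_real y, of_real z) = of_real (snd (snd (cone_coords (x, y, z))))"
    if "(of_real x, of_real y, of_real z) \<in> W" for x y z
  proof -
    have eq: "(complex_of_real y / of_real x, 2 * complex_of_real z / of_real x ^ 3)
        = (of_real (y / x), of_real (2 * z / x ^ 3))" by simp
    have "(complex_of_real (y / x), complex_of_real (2 * z / x ^ 3)) \<in> V"
      using rV[OF that] unfolding fst_conv snd_conv eq .
    then obtain a e where ae: "slopes (a, e) = (y / x, 2 * z / x ^ 3)"
      "G (of_real (y / x), of_real (2 * z / x ^ 3)) = (of_real a, of_real e)"
      using G3 by blast
    have "inv slopes (y / x, 2 * z / x ^ 3) = (a, e)"
      using inv_f_f[OF inj_slopes, of "(a, e)"] unfolding ae(1) .
    hence c: "cone_coords (x, y, z) = (x * moment 0 rate (a, e) - 1, a, e)"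
      by (simp add: cone_coords_def Let_def)
    have g12: "g1 (of_real x, of_real y, of_real z) = of_real a" "g2 (of_real x, of_real y, of_real z) = of_real e"
      unfolding g1_def g2_def fst_conv snd_conv eq ae(2) by simp_all
    show ?thesis
      unfolding c g0_def g12 fst_conv snd_conv
      by (simp add: moment_of_real[OF crate_of_real continuous_rate])
  qed
  have mem: "(of_real x, of_real y, of_real z) \<in> W"
    using V(2) x by (simp add: W_def W0_def r_def sl)
  show "real_analytic_at cone_coords (cone_point p)"
    unfolding q
  proof (rule real_analytic_at_separately_holomorphic(1)[OF oW mem, where h = "\<lambda>b q. g0 q * of_real (fst b)
        + (g1 q * of_real (fst (snd b)) + g2 q * of_real (snd (snd b)))"])
    show "separately_holomorphic_on (\<lambda>q. g0 q * of_real (fst b) + (g1 q * of_real (fst (snd b))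
        + g2 q * of_real (snd (snd b)))) W" for b :: "real \<times> real \<times> real"
      by (intro separately_holomorphic_on_add separately_holomorphic_on_mult separately_holomorphic_on_const
          hg0 hg1 hg2)
  qed (use real in \<open>simp add: inner_prod_def\<close>)
  show "real_analytic_at (\<lambda>q. snd (cone_coords q)) (cone_point p)"
    unfolding q
  proof (rule real_analytic_at_separately_holomorphic(1)[OF oW mem, where h = "\<lambda>b q. g1 q * of_real (fst b)
        + g2 q * of_real (snd b)"])
    show "separately_holomorphic_on (\<lambda>q. g1 q * of_real (fst b) + g2 q * of_real (snd b)) W" for b :: "real \<times> real"
      by (intro separately_holomorphic_on_add separately_holomorphic_on_mult separately_holomorphic_on_const
          hg1 hg2)
  qed (use real in \<open>simp add: inner_prod_def\<close>)
qed

lemma real_analytic_onI: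
  assumes "\<And>a. a \<in> A \<Longrightarrow> real_analytic_at g a" "\<And>x. x \<in> A \<Longrightarrow> f x = g x"
  shows "real_analytic_on f A"
  unfolding real_analytic_on_def
  by (intro ballI exI[of _ UNIV] exI[of _ g]) (use assms in auto)

lemma continuous_moment_real:
  "continuous_on UNIV g \<Longrightarrow> continuous_on A (moment n g :: real \<times> real \<Rightarrow> real)"
  using continuous_on_subset[OF continuous_on_moment[OF convex_UNIV, of g n]] by simp

lemma continuous_cone_point: "continuous_on A cone_point"
proof -
  have m: "continuous_on A (\<lambda>p. moment n g (snd p))" if "continuous_on UNIV g" for n and g :: "real \<Rightarrow> real"
    by (rule continuous_on_compose2[OF continuous_moment_real[OF that] continuous_on_snd[OF continuous_on_id]]) auto
  have x: "continuous_on A (\<lambda>p. (1 + fst p) / moment 0 rate (snd p))"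
    by (intro continuous_on_divide continuous_on_add continuous_on_const continuous_on_fst continuous_on_id
        m continuous_rate) (use moment_rate_pos in \<open>simp add: less_imp_neq[symmetric]\<close>)
  show ?thesis
    unfolding cone_point_def[abs_def] endpoint_def
    by (intro continuous_on_Pair continuous_on_mult continuous_on_divide continuous_on_power
        continuous_on_const x m continuous_slope) simp
qed

theorem theorem15:
  "real_analytic_submanifold 2 unit_sphere \<and>
   real_analytic_diffeomorphic unit_sphere (UNIV :: (real \<times> real) set) \<and>
   unit_sphere = {Exp lam 1 | lam. lifetime lam > 1}"
proof (intro conjI)
  show "unit_sphere = {Exp lam 1 | lam. lifetime lam > 1}"
    unfolding unit_sphere_eq by (rule range_sphere_point_eq_Exp)
  have coords_sphere: "cone_coords (sphere_point v) = (0, v)" for v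
    unfolding sphere_point_eq_cone_point by (rule cone_coords_cone_point) simp
  show "real_analytic_diffeomorphic unit_sphere (UNIV :: (real \<times> real) set)"
    unfolding real_analytic_diffeomorphic_def real_analytic_diffeo_def
  proof (intro exI conjI)
    let ?F = "\<lambda>q. snd (cone_coords q)"
    show bij: "bij_betw ?F unit_sphere UNIV"
      by (rule bij_betw_byWitness[where f' = sphere_point])
        (simp_all add: unit_sphere_eq coords_sphere)
    show "real_analytic_on ?F unit_sphere"
    proof (rule real_analytic_onI[OF _ refl])
      fix q assume "q \<in> unit_sphere"
      then obtain v where "q = cone_point (0, v)"
        unfolding unit_sphere_eq sphere_point_eq_cone_point by blast
      thus "real_analytic_at ?F q"
        using cone_coords_analytic(2)[of "(0, v)"] by simp
    qed
    show "real_analytic_on (inv_into unit_sphere ?F) UNIV"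
    proof (rule real_analytic_onI)
      fix v :: "real \<times> real"
      show "real_analytic_at (\<lambda>v. cone_point (0, v)) v"
        using cone_point_analytic(2)[of "(0, v)"] by simp
      show "inv_into unit_sphere ?F v = cone_point (0, v)"
        using inv_into_f_f[OF bij_betw_imp_inj_on[OF bij], of "sphere_point v"]
        by (simp add: unit_sphere_eq coords_sphere sphere_point_eq_cone_point[symmetric])
    qed
  qed
  show "real_analytic_submanifold 2 unit_sphere"
    unfolding real_analytic_submanifold_def
  proof
    fix p assume p: "p \<in> unit_sphere"
    define V where "V = {p :: real \<times> real \<times> real. -1 < fst p}"
    define U where "U = cone_point ` V"
    define L where "L = {p :: real \<times> real \<times> real. (1, 0, 0) \<bullet> p = 0}"
    have oV: "open V"
      unfolding V_def by (intro open_Collect_less continuous_on_const continuous_on_fst continuous_on_id)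
    have inv: "cone_coords (cone_point p) = p" if "p \<in> V" for p
      using that by (intro cone_coords_cone_point) (simp add: V_def)
    have inj: "inj_on cone_point V"
      by (rule inj_on_inverseI[where g = cone_coords]) (rule inv)
    have oU: "open U"
      unfolding U_def by (rule invariance_of_domain[OF continuous_cone_point oV inj])
    have SU: "unit_sphere = cone_point ` (V \<inter> L)"
    proof -
      have "V \<inter> L = range (Pair 0)"
        by (auto simp: V_def L_def inner_prod_def)
      thus ?thesis
        by (simp only: unit_sphere_eq image_image sphere_point_eq_cone_point[abs_def])
    qed
    have "dim L = DIM(real \<times> real \<times> real) - 1"
      unfolding L_def by (rule dim_special_hyperplane) (simp add: Basis_prod_def zero_prod_def)
    hence dimL: "dim L = 2" by simp
    have bij: "bij_betw cone_coords U V"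
      unfolding U_def by (rule bij_betw_byWitness[where f' = cone_point]) (auto simp: inv)
    have diffeo: "real_analytic_diffeo cone_coords U V"
      unfolding real_analytic_diffeo_def
    proof (intro conjI bij)
      show "real_analytic_on cone_coords U"
      proof (rule real_analytic_onI[OF _ refl])
        fix q assume "q \<in> U"
        then obtain p where "q = cone_point p" "-1 < fst p"
          unfolding U_def V_def by blast
        thus "real_analytic_at cone_coords q"
          using cone_coords_analytic(1)[of p] by simp
      qed
      show "real_analytic_on (inv_into U cone_coords) V"
      proof (rule real_analytic_onI[OF cone_point_analytic(1)])
        fix p assume "p \<in> V"
        thus "inv_into U cone_coords p = cone_point p"
          using inv_into_f_f[OF bij_betw_imp_inj_on[OF bij], of "cone_point p"] by (simp add: U_def inv)
      qed
    qed
    have flat: "cone_coords ` (unit_sphere \<inter> U) = V \<inter> L"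
    proof -
      have "unit_sphere \<inter> U = cone_point ` (V \<inter> L)"
        unfolding SU U_def by auto
      hence "cone_coords ` (unit_sphere \<inter> U) = (\<lambda>p. cone_coords (cone_point p)) ` (V \<inter> L)"
        by (simp only: image_image)
      also have "\<dots> = (\<lambda>p. p) ` (V \<inter> L)"
        by (rule image_cong[OF refl]) (use inv in blast)
      finally show ?thesis by simp
    qed
    have pU: "p \<in> U" using p unfolding SU U_def by blast
    have sL: "subspace L" unfolding L_def by (rule subspace_hyperplane)
    show "\<exists>U V L (f :: point \<Rightarrow> point). open U \<and> p \<in> U \<and> open V \<and> subspace L \<and> dim L = 2 \<and>
        real_analytic_diffeo f U V \<and> f ` (unit_sphere \<inter> U) = V \<inter> L"
      by (rule exI[of _ U], rule exI[of _ V], rule exI[of _ L], rule exI[of _ cone_coords])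
        (intro conjI oU pU oV sL dimL diffeo flat)
  qed
qed

end
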